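(* For every relation $A : I \times J \to \{0,1\}$ and natural numbers $k \geq k' \geq 1$ and $l \geq l' \geq 1$ there are zigzags of weak homotopy equivalences (the horizontal edges) that make the diagram $$\begin{array}{ccc} |R(A_{k,l})| & \overset{\sim}{-\!\!\!-\!\!\!-} & \mathrm{B}\mathbf{R}(A_{k,1},A^{\top}_{k,l}) \\ \downarrow & & \downarrow \\ |R(A_{k',l'})| & \overset{\sim}{-\!\!\!-\!\!\!-} & \mathrm{B}\mathbf{R}(A_{k',1},A^{\top}_{k',l'}) \end{array}$$ commute (in the homotopy category), where the vertical maps are induced by the inclusions $I_l \subseteq I_{l'}$ and $J_k\subseteq J_{k'}$.
   Context: A relation is a map $A : I\times J\to\{0,1\}$; its transpose is $A^\top : J\times I\to\{0,1\}$, $A^\top(j,i)=A(i,j)$. The row complex $R(A)$ is the simplicial complex whose simplices are the nonempty finite $\sigma\subseteq I$ such that there is $j\in J$ with $A(i,j)=1$ for all $i\in\sigma$; $|\cdot|$ denotes geometric realization. For integers $k,l\geq1$ put $I_l=\{\sigma\subseteq I\mid \#\sigma\geq l\}$, $J_k=\{\tau\subseteq J\mid\#\tau\geq k\}$, and let $A_{k,l} : I_l\times J_k\to\{0,1\}$ be the relation with $A_{k,l}(\sigma,\tau)=1$ if $A(i,j)=1$ for all $i\in\sigma$, $j\in\tau$, and $0$ otherwise. Thus $A_{k,1} : I_1 \times J_k\to\{0,1\}$ and $A_{k,l}^\top : J_k\times I_l\to\{0,1\}$. For relations $P : S\times T\to\{0,1\}$ and $Q : T\times W\to\{0,1\}$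 and $\sigma\subseteq S$ let $T_\sigma=\{t\in T\mid P(s,t)=1\text{ for all }s\in\sigma\}$. $\mathbf{R}(P,Q)$ is the topological category with space of objects $\bigsqcup_{\sigma\in R(P)}|R(Q|_{T_\sigma\times W})|$ and space of morphisms $\bigsqcup_{\sigma_1\subseteq\sigma_0}|R(Q|_{T_{\sigma_0}\times W})|$ (pairs of simplices of $R(P)$), where a morphism $x$ in the component $\sigma_1\subseteq\sigma_0$ has source $x$ in the component $\sigma_0$ and target the image of $x$ under the inclusion $|R(Q|_{T_{\sigma_0}\times W})|\hookrightarrow|R(Q|_{T_{\sigma_1}\times W})|$ in the component $\sigma_1$. For a topological category $\mathbf{T}$, $\mathrm{B}\mathbf{T}$ denotes the geometric realization of its nerve. The right vertical map is induced by the functor sending the component of $\chi\in R(A_{k,1})$ to the component of $\chi\in R(A_{k',1})$ via the inclusion of row complexes induced by $J_k\subseteq J_{k'}$. *)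

theory Defs
  imports "HOL-Homology.Homology"
begin

section \<open>Relations and row complexes\<close>

text \<open>A relation is a 0/1-valued map on \<open>rows \<times> cols\<close>; the values of \<open>holds\<close> outside the
  carriers play no role.\<close>

record ('a, 'b) relation =
  rows :: "'a set"
  cols :: "'b set"
  holds :: "'a \<Rightarrow> 'b \<Rightarrow> bool"

definition transp_rel :: "('a, 'b) relation \<Rightarrow> ('b, 'a) relation" where
  "transp_rel A = \<lparr>rows = cols A, cols = rows A, holds = (\<lambda>j i. holds A i j)\<rparr>"

definition row_complex :: "('a, 'b) relation \<Rightarrow> 'a set set" where
  "row_complex A =
    {\<sigma>. \<sigma> \<noteq> {} \<and> finite \<sigma> \<and> \<sigma> \<subseteq> rows A \<and> (\<exists>j\<in>cols A. \<forall>i\<in>\<sigma>. holds A i j)}"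

text \<open>Infinite subsets count as having at least \<open>n\<close> elements.\<close>

definition subsets_ge :: "nat \<Rightarrow> 'a set \<Rightarrow> 'a set set" where
  "subsets_ge n S = {\<sigma>. \<sigma> \<subseteq> S \<and> (infinite \<sigma> \<or> n \<le> card \<sigma>)}"

definition multi_rel :: "('i, 'j) relation \<Rightarrow> nat \<Rightarrow> nat \<Rightarrow> ('i set, 'j set) relation" where
  "multi_rel A k l =
    \<lparr>rows = subsets_ge l (rows A), cols = subsets_ge k (cols A),
     holds = (\<lambda>\<sigma> \<tau>. \<forall>i\<in>\<sigma>. \<forall>j\<in>\<tau>. holds A i j)\<rparr>"


section \<open>Geometric realization of simplicial complexes\<close>

text \<open>Points are given by barycentric coordinates, extended by zero to the whole vertex type.
  Thus the realization of a subcomplex is a subset of the realization of the complex, and the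
  map induced by the inclusion does not change the underlying function.\<close>

definition closed_simplex :: "'v set \<Rightarrow> ('v \<Rightarrow> real) set" where
  "closed_simplex \<sigma> = {x. (\<forall>v. 0 \<le> x v) \<and> {v. x v \<noteq> 0} \<subseteq> \<sigma> \<and> (\<Sum>v\<in>\<sigma>. x v) = 1}"

text \<open>The weak topology determined by the closed simplices. On functions supported in a fixed
  finite set, the product topology is the Euclidean one.\<close>

definition realization :: "'v set set \<Rightarrow> ('v \<Rightarrow> real) topology" where
  "realization K = topology (\<lambda>U. U \<subseteq> (\<Union>\<sigma>\<in>K. closed_simplex \<sigma>) \<and>
    (\<forall>\<sigma>\<in>K. openin (subtopology (powertop_real UNIV) (closed_simplex \<sigma>)) (U \<inter> closed_simplex \<sigma>)))"

lemma openin_realization: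
  "openin (realization K) U \<longleftrightarrow> U \<subseteq> (\<Union>\<sigma>\<in>K. closed_simplex \<sigma>) \<and>
    (\<forall>\<sigma>\<in>K. openin (subtopology (powertop_real UNIV) (closed_simplex \<sigma>)) (U \<inter> closed_simplex \<sigma>))"
proof -
  let ?P = "\<lambda>U. U \<subseteq> (\<Union>\<sigma>\<in>K. closed_simplex \<sigma>) \<and>
    (\<forall>\<sigma>\<in>K. openin (subtopology (powertop_real UNIV) (closed_simplex \<sigma>)) (U \<inter> closed_simplex \<sigma>))"
  have "?P (S \<inter> T)" if "?P S" "?P T" for S T
  proof -
    have "S \<inter> T \<inter> closed_simplex \<sigma> = (S \<inter> closed_simplex \<sigma>) \<inter> (T \<inter> closed_simplex \<sigma>)" for \<sigma>
      by auto
    with that show ?thesis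
      by (metis (no_types, lifting) le_infI1 openin_Int)
  qed
  moreover have "?P (\<Union>\<K>)" if "\<forall>V\<in>\<K>. ?P V" for \<K>
  proof -
    have "\<Union>\<K> \<inter> closed_simplex \<sigma> = (\<Union>V\<in>\<K>. V \<inter> closed_simplex \<sigma>)" for \<sigma>
      by auto
    moreover have "openin (subtopology (powertop_real UNIV) (closed_simplex \<sigma>))
        (\<Union>V\<in>\<K>. V \<inter> closed_simplex \<sigma>)" if "\<sigma> \<in> K" for \<sigma>
      using \<open>\<forall>V\<in>\<K>. ?P V\<close> \<open>\<sigma> \<in> K\<close> by (intro openin_Union) blast
    ultimately show ?thesis
      using that by (simp add: Sup_le_iff)
  qed
  ultimately have "istopology ?P"
    unfolding istopology_def by blast
  then show ?thesis
    by (simp add: realization_def)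
qed

lemma topspace_realization: "topspace (realization K) = (\<Union>\<sigma>\<in>K. closed_simplex \<sigma>)"
proof -
  have "openin (realization K) (\<Union>\<sigma>\<in>K. closed_simplex \<sigma>)"
    unfolding openin_realization
  proof (intro conjI ballI)
    fix \<sigma> assume "\<sigma> \<in> K"
    then have "(\<Union>\<sigma>\<in>K. closed_simplex \<sigma>) \<inter> closed_simplex \<sigma> =
        topspace (subtopology (powertop_real UNIV) (closed_simplex \<sigma>))"
      by auto
    then show "openin (subtopology (powertop_real UNIV) (closed_simplex \<sigma>))
        ((\<Union>\<sigma>\<in>K. closed_simplex \<sigma>) \<inter> closed_simplex \<sigma>)"
      by (metis openin_topspace)
  qed simp
  then show ?thesis
    by (meson openin_realization openin_subset openin_topspace subset_antisym)
qed


section \<open>Quotient spaces\<close>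

definition quotient_space :: "'a topology \<Rightarrow> 'a rel \<Rightarrow> 'a set topology" where
  "quotient_space X E = topology (\<lambda>U. U \<subseteq> topspace X // E \<and> openin X {p \<in> topspace X. E `` {p} \<in> U})"

lemma openin_quotient_space:
  "openin (quotient_space X E) U \<longleftrightarrow>
    U \<subseteq> topspace X // E \<and> openin X {p \<in> topspace X. E `` {p} \<in> U}"
proof -
  let ?P = "\<lambda>U. U \<subseteq> topspace X // E \<and> openin X {p \<in> topspace X. E `` {p} \<in> U}"
  have 1: "{p \<in> topspace X. E `` {p} \<in> S \<inter> T} =
      {p \<in> topspace X. E `` {p} \<in> S} \<inter> {p \<in> topspace X. E `` {p} \<in> T}" for S T
    by auto
  have 2: "{p \<in> topspace X. E `` {p} \<in> \<Union>\<K>} = (\<Union>V\<in>\<K>. {p \<in> topspace X. E `` {p} \<in> V})" for \<K>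
    by auto
  have "istopology ?P"
    unfolding istopology_def 1 2 by blast
  then show ?thesis
    by (simp add: quotient_space_def)
qed

lemma topspace_quotient_space: "topspace (quotient_space X E) = topspace X // E"
proof -
  have "{p \<in> topspace X. E `` {p} \<in> topspace X // E} = topspace X"
    by (auto intro: quotientI)
  then have "openin (quotient_space X E) (topspace X // E)"
    by (simp add: openin_quotient_space)
  then show ?thesis
    by (meson openin_quotient_space openin_subset openin_topspace subset_antisym)
qed

text \<open>The map between sets of equivalence classes induced by \<open>g\<close>, where \<open>E\<close> is the equivalence
  relation on the target: if \<open>g\<close> respects the relations, this sends the class of \<open>p\<close> to the
  class of \<open>g p\<close>.\<close>

definition class_map :: "'b rel \<Rightarrow> ('a \<Rightarrow> 'b) \<Rightarrow> 'a set \<Rightarrow> 'b set" where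
  "class_map E g c = E `` (g ` c)"


section \<open>Geometric realization of simplicial spaces\<close>

definition simplex_op :: "nat \<Rightarrow> nat \<Rightarrow> (nat \<Rightarrow> nat) \<Rightarrow> bool" where
  "simplex_op m n \<theta> \<longleftrightarrow> mono_on {..m} \<theta> \<and> \<theta> ` {..m} \<subseteq> {..n}"

definition simplex_push :: "nat \<Rightarrow> (nat \<Rightarrow> nat) \<Rightarrow> (nat \<Rightarrow> real) \<Rightarrow> (nat \<Rightarrow> real)" where
  "simplex_push m \<theta> t = (\<lambda>j. \<Sum>i | i \<le> m \<and> \<theta> i = j. t i)"

text \<open>A simplicial space is given by its levels \<open>X n\<close> and, for \<open>\<theta> : [m] \<rightarrow> [n]\<close>, the operator
  \<open>act m \<theta> : X n \<rightarrow> X m\<close>.\<close>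

definition glue ::
  "(nat \<Rightarrow> 'x topology) \<Rightarrow> (nat \<Rightarrow> (nat \<Rightarrow> nat) \<Rightarrow> 'x \<Rightarrow> 'x) \<Rightarrow> (nat \<times> 'x \<times> (nat \<Rightarrow> real)) rel" where
  "glue X act = {((m, act m \<theta> x, t), (n, x, simplex_push m \<theta> t)) | m n \<theta> x t.
    simplex_op m n \<theta> \<and> x \<in> topspace (X n) \<and> t \<in> standard_simplex m}"

definition glue_equiv ::
  "(nat \<Rightarrow> 'x topology) \<Rightarrow> (nat \<Rightarrow> (nat \<Rightarrow> nat) \<Rightarrow> 'x \<Rightarrow> 'x) \<Rightarrow> (nat \<times> 'x \<times> (nat \<Rightarrow> real)) rel" where
  "glue_equiv X act = (glue X act \<union> (glue X act)\<inverse>)\<^sup>*"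

definition simplicial_realization ::
  "(nat \<Rightarrow> 'x topology) \<Rightarrow> (nat \<Rightarrow> (nat \<Rightarrow> nat) \<Rightarrow> 'x \<Rightarrow> 'x)
    \<Rightarrow> (nat \<times> 'x \<times> (nat \<Rightarrow> real)) set topology" where
  "simplicial_realization X act =
    quotient_space
      (sum_topology
        (\<lambda>n. prod_topology (X n) (subtopology (powertop_real UNIV) (standard_simplex n))) UNIV)
      (glue_equiv X act)"


section \<open>Topological categories and their classifying spaces\<close>

text \<open>\<open>Comp g f\<close> is the composite of \<open>f\<close> followed by \<open>g\<close>.\<close>

record ('o, 'm) topcat =
  Ob :: "'o topology"
  Mor :: "'m topology"
  Src :: "'m \<Rightarrow> 'o"
  Tgt :: "'m \<Rightarrow> 'o"
  Idn :: "'o \<Rightarrow> 'm"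
  Comp :: "'m \<Rightarrow> 'm \<Rightarrow> 'm"

text \<open>The space of \<open>n\<close>-simplices of the nerve is the space of functors from the poset
  \<open>0 \<le> \<dots> \<le> n\<close> to the category, and the simplicial operators are given by precomposition.\<close>

type_synonym ('o, 'm) nerve_simplex = "(nat \<Rightarrow> 'o) \<times> (nat \<times> nat \<Rightarrow> 'm)"

definition poset_pairs :: "nat \<Rightarrow> (nat \<times> nat) set" where
  "poset_pairs n = {(i, j). i \<le> j \<and> j \<le> n}"

definition is_functor :: "('o, 'm) topcat \<Rightarrow> nat \<Rightarrow> ('o, 'm) nerve_simplex \<Rightarrow> bool" where
  "is_functor C n = (\<lambda>(x, f).
    (\<forall>i j. i \<le> j \<and> j \<le> n \<longrightarrow> Src C (f (i, j)) = x i \<and> Tgt C (f (i, j)) = x j) \<and>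
    (\<forall>i\<le>n. f (i, i) = Idn C (x i)) \<and>
    (\<forall>h i j. h \<le> i \<and> i \<le> j \<and> j \<le> n \<longrightarrow> f (h, j) = Comp C (f (i, j)) (f (h, i))))"

definition nerve :: "('o, 'm) topcat \<Rightarrow> nat \<Rightarrow> ('o, 'm) nerve_simplex topology" where
  "nerve C n = subtopology
    (prod_topology (product_topology (\<lambda>_. Ob C) {..n}) (product_topology (\<lambda>_. Mor C) (poset_pairs n)))
    {F. is_functor C n F}"

definition nerve_op ::
  "nat \<Rightarrow> (nat \<Rightarrow> nat) \<Rightarrow> ('o, 'm) nerve_simplex \<Rightarrow> ('o, 'm) nerve_simplex" where
  "nerve_op m \<theta> = (\<lambda>(x, f).
    (restrict (\<lambda>i. x (\<theta> i)) {..m}, restrict (\<lambda>(i, j). f (\<theta> i, \<theta> j)) (poset_pairs m)))"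

type_synonym ('o, 'm) class_point = "(nat \<times> ('o, 'm) nerve_simplex \<times> (nat \<Rightarrow> real)) set"

definition classifying_space :: "('o, 'm) topcat \<Rightarrow> ('o, 'm) class_point topology" where
  "classifying_space C = simplicial_realization (nerve C) nerve_op"

text \<open>The map induced by a functor to \<open>D\<close> with object part \<open>fo\<close> and morphism part \<open>fm\<close>.\<close>

definition nerve_map ::
  "('o \<Rightarrow> 'p) \<Rightarrow> ('m \<Rightarrow> 'q) \<Rightarrow> nat \<Rightarrow> ('o, 'm) nerve_simplex \<Rightarrow> ('p, 'q) nerve_simplex" where
  "nerve_map fo fm n = (\<lambda>(x, f).
    (restrict (\<lambda>i. fo (x i)) {..n}, restrict (\<lambda>p. fm (f p)) (poset_pairs n)))"

definition classifying_map ::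
  "('p, 'q) topcat \<Rightarrow> ('o \<Rightarrow> 'p) \<Rightarrow> ('m \<Rightarrow> 'q) \<Rightarrow> ('o, 'm) class_point \<Rightarrow> ('p, 'q) class_point" where
  "classifying_map D fo fm =
    class_map (glue_equiv (nerve D) nerve_op) (\<lambda>(n, F, t). (n, nerve_map fo fm n F, t))"


section \<open>The topological category of a composable pair of relations\<close>

definition common_cols :: "('s, 't) relation \<Rightarrow> 's set \<Rightarrow> 't set" where
  "common_cols P \<sigma> = {t \<in> cols P. \<forall>s\<in>\<sigma>. holds P s t}"

definition fibre :: "('s, 't) relation \<Rightarrow> ('t, 'w) relation \<Rightarrow> 's set \<Rightarrow> ('t \<Rightarrow> real) topology" where
  "fibre P Q \<sigma> = realization (row_complex (Q\<lparr>rows := common_cols P \<sigma>\<rparr>))"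

text \<open>The component of the morphism space indexed by \<open>(\<sigma>0, \<sigma>1)\<close> with \<open>\<sigma>1 \<subseteq> \<sigma>0\<close> consists of
  morphisms from the component of \<open>\<sigma>0\<close> to the component of \<open>\<sigma>1\<close>. The inclusion of the fibre over
  \<open>\<sigma>0\<close> into the fibre over \<open>\<sigma>1\<close> is the identity on coordinates.\<close>

definition rel_cat :: "('s, 't) relation \<Rightarrow> ('t, 'w) relation
    \<Rightarrow> ('s set \<times> ('t \<Rightarrow> real), ('s set \<times> 's set) \<times> ('t \<Rightarrow> real)) topcat" where
  "rel_cat P Q =
    \<lparr>Ob = sum_topology (fibre P Q) (row_complex P),
     Mor = sum_topology (\<lambda>(\<sigma>0, \<sigma>1). fibre P Q \<sigma>0)
       {(\<sigma>0, \<sigma>1). \<sigma>0 \<in> row_complex P \<and> \<sigma>1 \<in> row_complex P \<and> \<sigma>1 \<subseteq> \<sigma>0},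
     Src = (\<lambda>((\<sigma>0, \<sigma>1), x). (\<sigma>0, x)),
     Tgt = (\<lambda>((\<sigma>0, \<sigma>1), x). (\<sigma>1, x)),
     Idn = (\<lambda>(\<sigma>, x). ((\<sigma>, \<sigma>), x)),
     Comp = (\<lambda>((\<sigma>1, \<sigma>2), y) ((\<sigma>0, \<sigma>1'), x). ((\<sigma>0, \<sigma>2), x))\<rparr>"


section \<open>Weak homotopy equivalences\<close>

definition cube :: "nat \<Rightarrow> (nat \<Rightarrow> real) topology" where
  "cube n = product_topology (\<lambda>_. top_of_set {0..1}) {..<n}"

definition cube_boundary :: "nat \<Rightarrow> (nat \<Rightarrow> real) set" where
  "cube_boundary n = {t \<in> topspace (cube n). \<exists>i<n. t i = 0 \<or> t i = 1}"

definition spheroids :: "nat \<Rightarrow> 'a topology \<Rightarrow> 'a \<Rightarrow> ((nat \<Rightarrow> real) \<Rightarrow> 'a) set" where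
  "spheroids n X x = {f. continuous_map (cube n) X f \<and> (\<forall>t\<in>cube_boundary n. f t = x)}"

definition spheroid_homotopy :: "nat \<Rightarrow> 'a topology \<Rightarrow> 'a \<Rightarrow> ((nat \<Rightarrow> real) \<Rightarrow> 'a) rel" where
  "spheroid_homotopy n X x =
    {(f, g). homotopic_with (\<lambda>h. \<forall>t\<in>cube_boundary n. h t = x) (cube n) X f g}"

definition homotopy_group :: "nat \<Rightarrow> 'a topology \<Rightarrow> 'a \<Rightarrow> ((nat \<Rightarrow> real) \<Rightarrow> 'a) set set" where
  "homotopy_group n X x = spheroids n X x // spheroid_homotopy n X x"

text \<open>The induced maps on homotopy groups are homomorphisms, so they are isomorphisms iff they
  are bijective, and the group structure need not be introduced.\<close>

definition weak_equivalence :: "'a topology \<Rightarrow> 'b topology \<Rightarrow> ('a \<Rightarrow> 'b) \<Rightarrow> bool" where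
  "weak_equivalence X Y \<phi> \<longleftrightarrow> continuous_map X Y \<phi> \<and>
    bij_betw (class_map {(y, y'). path_component_of Y y y'} \<phi>)
      (path_components_of X) (path_components_of Y) \<and>
    (\<forall>n\<ge>1. \<forall>x\<in>topspace X.
      bij_betw (class_map (spheroid_homotopy n Y (\<phi> x)) (\<lambda>f. \<phi> \<circ> f))
        (homotopy_group n X x) (homotopy_group n Y (\<phi> x)))"


section \<open>The homotopy category\<close>

text \<open>The homotopy category is obtained from spaces and homotopy classes of maps by formally
  inverting the weak homotopy equivalences. Its morphisms are represented by zigzags;
  \<open>Fwd X f Y\<close> is a continuous map from \<open>X\<close> to \<open>Y\<close>, and \<open>Bwd X f Y\<close> is the formal inverse, going
  from \<open>X\<close> to \<open>Y\<close>, of a weak homotopy equivalence \<open>f\<close> from \<open>Y\<close> to \<open>X\<close>.\<close>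

datatype 'a arrow = Fwd "'a topology" "'a \<Rightarrow> 'a" "'a topology" | Bwd "'a topology" "'a \<Rightarrow> 'a" "'a topology"

inductive zigzag :: "'a topology \<Rightarrow> 'a arrow list \<Rightarrow> 'a topology \<Rightarrow> bool" where
  Nil: "zigzag X [] X"
| Fwd: "continuous_map X Y f \<Longrightarrow> zigzag Y zs Z \<Longrightarrow> zigzag X (Fwd X f Y # zs) Z"
| Bwd: "weak_equivalence Y X f \<Longrightarrow> zigzag Y zs Z \<Longrightarrow> zigzag X (Bwd X f Y # zs) Z"

text \<open>Equality of the morphisms represented by two zigzags.\<close>

inductive ho_eq :: "'a topology \<Rightarrow> 'a topology \<Rightarrow> 'a arrow list \<Rightarrow> 'a arrow list \<Rightarrow> bool" where
  refl: "zigzag X zs Y \<Longrightarrow> ho_eq X Y zs zs"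
| sym: "ho_eq X Y zs ws \<Longrightarrow> ho_eq X Y ws zs"
| trans: "ho_eq X Y zs ws \<Longrightarrow> ho_eq X Y ws vs \<Longrightarrow> ho_eq X Y zs vs"
| cong: "zigzag W as X \<Longrightarrow> ho_eq X Y zs ws \<Longrightarrow> zigzag Y bs Z \<Longrightarrow> ho_eq W Z (as @ zs @ bs) (as @ ws @ bs)"
| homotopic: "homotopic_with (\<lambda>_. True) X Y f g \<Longrightarrow> ho_eq X Y [Fwd X f Y] [Fwd X g Y]"
| ident: "ho_eq X X [Fwd X id X] []"
| comp: "continuous_map X Y f \<Longrightarrow> continuous_map Y Z g \<Longrightarrow>
    ho_eq X Z [Fwd X f Y, Fwd Y g Z] [Fwd X (g \<circ> f) Z]"
| inv_right: "weak_equivalence X Y f \<Longrightarrow> ho_eq X X [Fwd X f Y, Bwd Y f X] []"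
| inv_left: "weak_equivalence X Y f \<Longrightarrow> ho_eq Y Y [Bwd Y f X, Fwd X f Y] []"

fun is_weak_arrow :: "'a arrow \<Rightarrow> bool" where
  "is_weak_arrow (Fwd X f Y) = weak_equivalence X Y f"
| "is_weak_arrow (Bwd X f Y) = weak_equivalence Y X f"

definition weak_zigzag :: "'a topology \<Rightarrow> 'a arrow list \<Rightarrow> 'a topology \<Rightarrow> bool" where
  "weak_zigzag X zs Y \<longleftrightarrow> zigzag X zs Y \<and> (\<forall>z\<in>set zs. is_weak_arrow z)"


section \<open>The four spaces of the square\<close>

text \<open>Zigzags and \<open>ho_eq\<close> only involve spaces whose points lie in one fixed type. The type below
  contains the points of both kinds of spaces in the square. Its cardinality is of the form \<open>2^s\<close> with \<open>s\<close> at least the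
  continuum, so up to homeomorphism the spaces with points in it are closed under cylinders, path
  spaces and realizations of singular complexes; hence morphisms and their equality are the same
  as in the homotopy category of all spaces.\<close>

type_synonym ('i, 'j) points =
  "('i set \<Rightarrow> real) +
   ('i set set \<times> ('j set \<Rightarrow> real), ('i set set \<times> 'i set set) \<times> ('j set \<Rightarrow> real)) class_point"

definition multi_cat :: "('i, 'j) relation \<Rightarrow> nat \<Rightarrow> nat
    \<Rightarrow> ('i set set \<times> ('j set \<Rightarrow> real), ('i set set \<times> 'i set set) \<times> ('j set \<Rightarrow> real)) topcat" where
  "multi_cat A k l = rel_cat (multi_rel A k 1) (transp_rel (multi_rel A k l))"

text \<open>Homeomorphic copies of the realization of the row complex and of the classifying space.\<close>

definition row_space :: "('i, 'j) relation \<Rightarrow> nat \<Rightarrow> nat \<Rightarrow> ('i, 'j) points topology" where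
  "row_space A k l = pullback_topology (range Inl) projl (realization (row_complex (multi_rel A k l)))"

definition cat_space :: "('i, 'j) relation \<Rightarrow> nat \<Rightarrow> nat \<Rightarrow> ('i, 'j) points topology" where
  "cat_space A k l = pullback_topology (range Inr) projr (classifying_space (multi_cat A k l))"

text \<open>The vertical maps from the spaces for any \<open>(k, l)\<close> to those for \<open>(k', l')\<close>; source and
  target are specified by the arrows in which they occur. On the left, the inclusion of row
  complexes is the identity on coordinates. On the right, the functor sends the component of
  \<open>\<sigma>\<close> to the component of \<open>\<sigma>\<close> by the inclusion.\<close>

definition row_incl :: "('i, 'j) points \<Rightarrow> ('i, 'j) points" where
  "row_incl = id"

definition cat_incl :: "('i, 'j) relation \<Rightarrow> nat \<Rightarrow> nat \<Rightarrow> ('i, 'j) points \<Rightarrow> ('i, 'j) points" where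
  "cat_incl A k' l' = map_sum (\<lambda>x. x)
    (classifying_map (multi_cat A k' l') (\<lambda>(\<sigma>, x). (\<sigma>, x)) (\<lambda>((\<sigma>0, \<sigma>1), x). ((\<sigma>0, \<sigma>1), x)))"

end

theory Submission
  imports Defs "HOL-Analysis.Abstract_Topological_Spaces"
begin

text \<open>A point of the classifying space is described by two coordinates: the fibre coordinate
  \<open>x\<close>, a weighting of members of \<open>J\<^sub>k\<close>, and the base coordinate \<open>z\<close>, the combination
  \<open>\<Sum>\<^sub>i t\<^sub>i b(C\<^sub>i)\<close> of the barycentres of a chain \<open>C\<^sub>0 \<supseteq> \<dots> \<supseteq> C\<^sub>n\<close>, a weighting of members of \<open>I\<^sub>1\<close>.
  Pushing a weighting forward along the polar map \<open>S \<mapsto> {i. A i j for all j \<in> \<Union>S}\<close>, applied to a random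
  subset of its support, is a continuous version of Dowker duality. The homotopy equivalence from
  the classifying space to the row complex sends \<open>(x, z)\<close> to the image of \<open>x\<close>; its inverse
  sends \<open>w\<close> to the pair of the image of \<open>w\<close> and the part of \<open>w\<close> of large weight. All homotopies
  are straight lines. Since the polar map does not depend on \<open>k\<close> and \<open>l\<close>, the equivalence is
  strictly natural.\<close>

section \<open>Homotopy equivalences are weak equivalences\<close>

text \<open>The obstacle is that supports do not vary continuously: taking the polar set of the full
  support would make the map jump whenever a weight reaches 0. Averaging over subsets
  \<open>T\<close> whose inclusion probabilities vanish with the weight removes the jump. Two bounds
  on \<open>T\<close> do the combinatorial work, since polar maps reverse inclusion. Because
  \<open>T\<close> lies in the support, its polar set is at least as large as that of the support
  and meets the cardinality bound. Because \<open>T\<close> contains the nonempty core, all sets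
  obtained are related to a common member of the core and span a simplex. The classifying space is
  an iterated quotient. It becomes tractable once the two coordinates are known to separate the
  glueing classes: a map into it can then be given by pairs of coordinates. Homotopies descend along
  the quotient maps because products with compact Hausdorff spaces preserve these. Weak equivalence
  is stated with based spheroids, whereas the homotopies move base points; this is why the first
  section works with a collar of the cube.\<close>

abbreviation unit_interval :: "real topology" where
  "unit_interval \<equiv> top_of_set {0..1}"

section \<open>Cubes with a collar around the middle third\<close>

lemma topspace_cube: "t \<in> topspace (cube n) \<longleftrightarrow> t \<in> extensional {..<n} \<and> (\<forall>i<n. 0 \<le> t i \<and> t i \<le> 1)"
  by (auto simp: cube_def PiE_iff)

lemma continuous_map_cube_coordinate:
  "i < n \<Longrightarrow> continuous_map (cube n) euclideanreal (\<lambda>t. t i)"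
  unfolding cube_def
  using continuous_map_product_projection[of i "{..<n}" "\<lambda>_. unit_interval"]
  by (auto intro: continuous_map_into_fulltopology)

lemma continuous_map_into_cube:
  assumes "\<And>i. i < n \<Longrightarrow> continuous_map X euclideanreal (\<lambda>x. f x i)"
    and "\<And>x. x \<in> topspace X \<Longrightarrow> f x \<in> topspace (cube n)"
  shows "continuous_map X (cube n) f"
  using assms
  by (auto simp: cube_def continuous_map_componentwise continuous_map_in_subtopology PiE_iff Pi_iff)

text \<open>The middle cube of side 1/3 is stretched over the whole cube, and the collar around it
  is retracted to the boundary.\<close>

definition cube_clamp :: "nat \<Rightarrow> (nat \<Rightarrow> real) \<Rightarrow> (nat \<Rightarrow> real)" where
  "cube_clamp n t = restrict (\<lambda>i. max 0 (min 1 (3 * t i - 1))) {..<n}"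

text \<open>Position in the collar: 0 on the middle cube, 1 on the boundary. The sum stands in for a
  maximum over the coordinates, and truncation at 1 makes the value a time of a homotopy.\<close>

definition cube_depth :: "nat \<Rightarrow> (nat \<Rightarrow> real) \<Rightarrow> real" where
  "cube_depth n t = min 1 (\<Sum>i<n. max 0 (max (1 - 3 * t i) (3 * t i - 2)))"

text \<open>Vanishes exactly where \<open>cube_clamp\<close> hits the boundary. Comparison with
  \<open>cube_depth\<close> turns the distinction between middle cube and collar into an inequality
  of continuous functions, with equality only where the two regions meet.\<close>

definition cube_inner :: "nat \<Rightarrow> (nat \<Rightarrow> real) \<Rightarrow> real" where
  "cube_inner n t = (\<Prod>i<n. cube_clamp n t i * (1 - cube_clamp n t i))"

lemma cube_clamp_in_cube: "cube_clamp n t \<in> topspace (cube n)"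
  by (auto simp: topspace_cube cube_clamp_def)

lemma cube_clamp_boundary: "t \<in> cube_boundary n \<Longrightarrow> cube_clamp n t \<in> cube_boundary n"
proof -
  assume "t \<in> cube_boundary n"
  then obtain i where "i < n" "t i = 0 \<or> t i = 1"
    by (auto simp: cube_boundary_def)
  then have "cube_clamp n t i = 0 \<or> cube_clamp n t i = 1"
    by (auto simp: cube_clamp_def)
  then show ?thesis
    using \<open>i < n\<close> cube_clamp_in_cube by (auto simp: cube_boundary_def)
qed

lemma cube_depth_range: "0 \<le> cube_depth n t" "cube_depth n t \<le> 1"
  unfolding cube_depth_def by (auto intro: sum_nonneg)

lemma cube_depth_boundary:
  assumes "t \<in> cube_boundary n" shows "cube_depth n t = 1"
proof -
  obtain i where i: "i < n" "t i = 0 \<or> t i = 1"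
    using assms by (auto simp: cube_boundary_def)
  have "1 = max 0 (max (1 - 3 * t i) (3 * t i - 2))"
    using i by auto
  also have "\<dots> \<le> (\<Sum>i<n. max 0 (max (1 - 3 * t i) (3 * t i - 2)))"
    by (rule member_le_sum) (use i in auto)
  finally show ?thesis by (simp add: cube_depth_def)
qed

lemma cube_inner_nonneg: "0 \<le> cube_inner n t"
  unfolding cube_inner_def by (intro prod_nonneg) (auto simp: cube_clamp_def)

lemma cube_inner_zero_iff: "cube_inner n t = 0 \<longleftrightarrow> cube_clamp n t \<in> cube_boundary n"
  unfolding cube_inner_def cube_boundary_def using cube_clamp_in_cube by (auto)

lemma cube_depth_pos:
  assumes "0 < cube_depth n t" shows "cube_clamp n t \<in> cube_boundary n"
proof -
  have "\<not> (\<forall>i\<in>{..<n}. max 0 (max (1 - 3 * t i) (3 * t i - 2)) = 0)"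
  proof
    assume "\<forall>i\<in>{..<n}. max 0 (max (1 - 3 * t i) (3 * t i - 2)) = 0"
    then have "(\<Sum>i<n. max 0 (max (1 - 3 * t i) (3 * t i - 2))) = 0"
      by (intro sum.neutral)
    with assms show False by (simp add: cube_depth_def)
  qed
  then obtain i where "i < n" "max 0 (max (1 - 3 * t i) (3 * t i - 2)) \<noteq> 0"
    by auto
  then have "i < n" "cube_clamp n t i = 0 \<or> cube_clamp n t i = 1"
    by (auto simp: cube_clamp_def max_def min_def split: if_splits)
  then show ?thesis using cube_clamp_in_cube by (auto simp: cube_boundary_def)
qed

text \<open>At every point \<open>cube_depth\<close> or \<open>cube_inner\<close> is 0, so the test
  \<open>cube_depth n t \<le> cube_inner n t\<close> singles out the middle cube.\<close>

lemma cube_shell_cases: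
  obtains "cube_depth n t = 0" "cube_depth n t \<le> cube_inner n t"
  | "cube_inner n t < cube_depth n t" "cube_clamp n t \<in> cube_boundary n"
  using cube_depth_pos[of n t] cube_inner_zero_iff[of n t] cube_inner_nonneg[of n t]
    cube_depth_range[of n t] by force

lemma continuous_map_cube_clamp: "continuous_map (cube n) (cube n) (cube_clamp n)"
  by (rule continuous_map_into_cube)
     (auto simp: cube_clamp_in_cube, auto simp: cube_clamp_def
       intro!: continuous_intros continuous_map_real_max continuous_map_real_min
         continuous_map_cube_coordinate)

lemma continuous_map_cube_depth: "continuous_map (cube n) euclideanreal (cube_depth n)"
  unfolding cube_depth_def
  by (auto intro!: continuous_intros continuous_map_real_max continuous_map_real_min
         continuous_map_cube_coordinate)

lemma continuous_map_cube_inner: "continuous_map (cube n) euclideanreal (cube_inner n)"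
  unfolding cube_inner_def cube_clamp_def
  by (auto intro!: continuous_intros continuous_map_prod continuous_map_real_max continuous_map_real_min
         continuous_map_cube_coordinate)

lemma continuous_map_cube_shell:
  assumes u: "continuous_map (prod_topology unit_interval (cube n)) X u"
    and v: "continuous_map (prod_topology unit_interval (cube n)) X v"
    and eq: "\<And>s t. \<lbrakk>s \<in> {0..1}; t \<in> topspace (cube n); cube_depth n t = 0;
      cube_clamp n t \<in> cube_boundary n\<rbrakk> \<Longrightarrow> u (s, t) = v (s, t)"
  shows "continuous_map (prod_topology unit_interval (cube n)) X
    (\<lambda>p. if cube_depth n (snd p) \<le> cube_inner n (snd p) then u p else v p)"
proof (rule continuous_map_cases_le)
  show "continuous_map (prod_topology unit_interval (cube n)) euclideanreal (\<lambda>p. cube_depth n (snd p))"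
    using continuous_map_compose[OF continuous_map_snd continuous_map_cube_depth, of unit_interval]
    by (simp add: o_def)
  show "continuous_map (prod_topology unit_interval (cube n)) euclideanreal (\<lambda>p. cube_inner n (snd p))"
    using continuous_map_compose[OF continuous_map_snd continuous_map_cube_inner, of unit_interval]
    by (simp add: o_def)
  fix p assume p: "p \<in> topspace (prod_topology unit_interval (cube n))"
    "cube_depth n (snd p) = cube_inner n (snd p)"
  obtain s t where st: "p = (s, t)" by (cases p)
  show "u p = v p"
    using p cube_shell_cases[of n t] cube_inner_zero_iff[of n t] unfolding st
    by (intro eq) auto
qed (use u v in \<open>auto intro: continuous_map_from_subtopology\<close>)

section \<open>Homotopies of spheroids relative to the boundary\<close>

lemma spheroid_homotopyI:
  assumes "continuous_map (prod_topology unit_interval (cube n)) X h"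
    and "\<And>t. t \<in> topspace (cube n) \<Longrightarrow> h (0, t) = f t"
    and "\<And>t. t \<in> topspace (cube n) \<Longrightarrow> h (1, t) = g t"
    and "\<And>s t. s \<in> {0..1} \<Longrightarrow> t \<in> cube_boundary n \<Longrightarrow> h (s, t) = x"
  shows "(f, g) \<in> spheroid_homotopy n X x"
proof -
  have "homotopic_with (\<lambda>h. \<forall>t\<in>cube_boundary n. h t = x) (cube n) X f g"
  proof (subst homotopic_with, goal_cases)
    case (1 h k)
    then show ?case by (auto simp: cube_boundary_def)
  next
    case 2
    show ?case by (intro exI[of _ h]) (use assms in auto)
  qed
  then show ?thesis by (simp add: spheroid_homotopy_def)
qed

lemma spheroid_homotopyE:
  assumes "(f, g) \<in> spheroid_homotopy n X x"
  obtains h where "continuous_map (prod_topology unit_interval (cube n)) X h"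
    "\<And>t. h (0, t) = f t" "\<And>t. h (1, t) = g t"
    "\<And>s t. s \<in> {0..1} \<Longrightarrow> t \<in> cube_boundary n \<Longrightarrow> h (s, t) = x"
  using assms unfolding spheroid_homotopy_def homotopic_with_def by auto

lemma spheroid_homotopy_spheroids:
  assumes "(f, g) \<in> spheroid_homotopy n X x" shows "f \<in> spheroids n X x" "g \<in> spheroids n X x"
  using assms homotopic_with_imp_continuous_maps[of _ "cube n" X f g]
    homotopic_with_imp_property[of _ "cube n" X f g]
  unfolding spheroid_homotopy_def spheroids_def mem_Collect_eq case_prod_conv by blast+

lemma spheroid_homotopy_refl: "f \<in> spheroids n X x \<Longrightarrow> (f, f) \<in> spheroid_homotopy n X x"
  by (auto simp: spheroid_homotopy_def spheroids_def)

lemma spheroid_homotopy_sym: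
  "(f, g) \<in> spheroid_homotopy n X x \<Longrightarrow> (g, f) \<in> spheroid_homotopy n X x"
  unfolding spheroid_homotopy_def mem_Collect_eq case_prod_conv by (rule homotopic_with_symD)

lemma spheroid_homotopy_trans:
  "(f, g) \<in> spheroid_homotopy n X x \<Longrightarrow> (g, h) \<in> spheroid_homotopy n X x \<Longrightarrow>
    (f, h) \<in> spheroid_homotopy n X x"
  unfolding spheroid_homotopy_def mem_Collect_eq case_prod_conv by (rule homotopic_with_trans)

lemma spheroid_homotopy_compose:
  assumes "(f, g) \<in> spheroid_homotopy n X x" "continuous_map X Y \<phi>"
  shows "(\<phi> \<circ> f, \<phi> \<circ> g) \<in> spheroid_homotopy n Y (\<phi> x)"
  using assms unfolding spheroid_homotopy_def mem_Collect_eq case_prod_conv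
  by (elim homotopic_with_compose_continuous_map_left) auto

lemma spheroids_compose:
  "f \<in> spheroids n X x \<Longrightarrow> continuous_map X Y \<phi> \<Longrightarrow> \<phi> \<circ> f \<in> spheroids n Y (\<phi> x)"
  by (auto simp: spheroids_def intro: continuous_map_compose)

lemma spheroid_continuous: "f \<in> spheroids n X x \<Longrightarrow> continuous_map (cube n) X f"
  by (simp add: spheroids_def)

lemma spheroid_boundary: "f \<in> spheroids n X x \<Longrightarrow> t \<in> cube_boundary n \<Longrightarrow> f t = x"
  by (simp add: spheroids_def)

lemma continuous_map_pair_snd:
  "continuous_map X Y f \<Longrightarrow> continuous_map (prod_topology Z X) Y (\<lambda>p. f (snd p))"
  using continuous_map_compose[OF continuous_map_snd, of X Y f Z] by (simp add: o_def)

lemma continuous_map_unit_interval_fst: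
  "continuous_map (prod_topology unit_interval X) euclideanreal fst"
  by (metis continuous_map_fst continuous_map_into_fulltopology)

lemma spheroid_homotopy_clamp:
  assumes c: "c \<in> spheroids n X x"
  shows "(c \<circ> cube_clamp n, c) \<in> spheroid_homotopy n X x"
proof (rule spheroid_homotopyI)
  \<comment> \<open>Linear interpolation between \<open>3 * t i - 1\<close> at \<open>s = 0\<close>
    and \<open>t i\<close> at \<open>s = 1\<close>. Its value is at most 0 for
    \<open>t i = 0\<close> and at least 1 for \<open>t i = 1\<close>, so after truncation every face
    stays in place.\<close>
  define k :: "real \<times> (nat \<Rightarrow> real) \<Rightarrow> nat \<Rightarrow> real"
    where "k = (\<lambda>(s, t). restrict (\<lambda>i. max 0 (min 1 ((3 - 2 * s) * t i - (1 - s)))) {..<n})"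
  have "continuous_map (prod_topology unit_interval (cube n)) (cube n) k"
    by (rule continuous_map_into_cube)
       (auto simp: k_def topspace_cube case_prod_unfold
         intro!: continuous_intros continuous_map_real_max continuous_map_real_min continuous_map_real_mult
           continuous_map_diff continuous_map_unit_interval_fst
           continuous_map_pair_snd[OF continuous_map_cube_coordinate])
  then show "continuous_map (prod_topology unit_interval (cube n)) X (c \<circ> k)"
    using c by (blast intro: continuous_map_compose spheroid_continuous)
  show "(c \<circ> k) (0, t) = (c \<circ> cube_clamp n) t" for t
    by (simp add: k_def cube_clamp_def)
  show "(c \<circ> k) (1, t) = c t" if "t \<in> topspace (cube n)" for t
  proof -
    have "k (1, t) = t"
      using that by (auto simp: k_def topspace_cube fun_eq_iff extensional_def)
    then show ?thesis by simp
  qed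
  show "(c \<circ> k) (s, t) = x" if st: "s \<in> {0..1}" "t \<in> cube_boundary n" for s t
  proof -
    obtain i where "i < n" "t i = 0 \<or> t i = 1" using st by (auto simp: cube_boundary_def)
    then have "k (s, t) i = 0 \<or> k (s, t) i = 1"
      using st by (auto simp: k_def)
    moreover have "k (s, t) \<in> topspace (cube n)"
      by (auto simp: k_def topspace_cube)
    ultimately have "k (s, t) \<in> cube_boundary n"
      using \<open>i < n\<close> by (auto simp: cube_boundary_def)
    then show ?thesis using c by (simp add: spheroid_boundary)
  qed
qed

lemma spheroids_clamp: "c \<in> spheroids n X x \<Longrightarrow> c \<circ> cube_clamp n \<in> spheroids n X x"
  by (rule spheroid_homotopy_spheroids(1)[OF spheroid_homotopy_clamp])

text \<open>The track of the base point \<open>x\<close> under the homotopy is inserted in the shell of the cube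
  where \<open>cube_depth\<close> is positive; there \<open>cube_clamp\<close> takes values in the boundary.\<close>

locale homotopic_to_id =
  fixes X :: "'a topology" and H :: "real \<times> 'a \<Rightarrow> 'a" and h :: "'a \<Rightarrow> 'a" and x :: 'a
  assumes cont: "continuous_map (prod_topology unit_interval X) X H"
    and H0: "\<And>y. H (0, y) = h y" and H1: "\<And>y. y \<in> topspace X \<Longrightarrow> H (1, y) = y"
    and x: "x \<in> topspace X"
begin

lemma cont_compose:
  assumes "continuous_map Z euclideanreal r" "\<And>z. z \<in> topspace Z \<Longrightarrow> r z \<in> {0..1}"
    and "continuous_map Z X f"
  shows "continuous_map Z X (\<lambda>z. H (r z, f z))"
proof -
  have "continuous_map Z (prod_topology unit_interval X) (\<lambda>z. (r z, f z))"
    using assms by (auto simp: continuous_map_pairwise o_def continuous_map_in_subtopology)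
  then show ?thesis using continuous_map_compose[OF _ cont] by (auto simp: o_def)
qed

lemma cont_x: "continuous_map Z X (\<lambda>_. x)"
  using x by simp

lemmas cont_rules = continuous_map_real_max continuous_map_real_min continuous_map_real_mult
  continuous_map_diff continuous_map_unit_interval_fst
  continuous_map_pair_snd[OF continuous_map_cube_depth] cont_x

text \<open>The left spheroid is \<open>h \<circ> a\<close> in the middle cube, with the track of
  \<open>x\<close> in the collar. Raising the time from \<open>cube_depth\<close> to 1 everywhere
  turns \<open>H\<close> into the identity.\<close>

lemma transported:
  assumes a: "a \<in> spheroids n X x"
  shows "(\<lambda>t. H (cube_depth n t, a (cube_clamp n t)), a) \<in> spheroid_homotopy n X x"
proof -
  have "(\<lambda>t. H (cube_depth n t, a (cube_clamp n t)), a \<circ> cube_clamp n) \<in> spheroid_homotopy n X x"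
  proof (rule spheroid_homotopyI[where h = "\<lambda>p. H (max (fst p) (cube_depth n (snd p)), a (cube_clamp n (snd p)))"])
    show "continuous_map (prod_topology unit_interval (cube n)) X
        (\<lambda>p. H (max (fst p) (cube_depth n (snd p)), a (cube_clamp n (snd p))))"
      using spheroid_continuous[OF spheroids_clamp[OF a]]
      by (intro cont_compose cont_rules)
         (auto simp: cube_depth_range max_def o_def intro!: continuous_map_pair_snd)
    show "H (max (fst (1, t)) (cube_depth n (snd (1, t))), a (cube_clamp n (snd (1, t)))) = (a \<circ> cube_clamp n) t"
      if "t \<in> topspace (cube n)" for t
    proof -
      have "a (cube_clamp n t) \<in> topspace X"
        using spheroid_continuous[OF a] cube_clamp_in_cube by (auto dest: continuous_map_funspace)
      then show ?thesis
        using cube_depth_range(2)[of n t] by (simp add: max_def H1)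
    qed
  qed (use cube_clamp_boundary a in \<open>auto simp: cube_depth_range cube_depth_boundary max_def H1 x spheroid_boundary\<close>)
  then show ?thesis by (rule spheroid_homotopy_trans[OF _ spheroid_homotopy_clamp[OF a]])
qed

text \<open>Injectivity of \<open>h\<close> on homotopy classes. A homotopy \<open>G\<close> between
  the images fills the middle cube, and the collar carries the track of \<open>x\<close> at all
  times; the two ends are then the spheroids of \<open>transported\<close>.\<close>

lemma spheroid_homotopy_reflect:
  assumes a: "a \<in> spheroids n X x" and b: "b \<in> spheroids n X x"
    and ab: "(h \<circ> a, h \<circ> b) \<in> spheroid_homotopy n X (h x)"
  shows "(a, b) \<in> spheroid_homotopy n X x"
proof -
  obtain G where G: "continuous_map (prod_topology unit_interval (cube n)) X G"
    "\<And>t. G (0, t) = h (a t)" "\<And>t. G (1, t) = h (b t)"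
    "\<And>s t. s \<in> {0..1} \<Longrightarrow> t \<in> cube_boundary n \<Longrightarrow> G (s, t) = h x"
    using ab by (auto elim!: spheroid_homotopyE)
  define F where "F = (\<lambda>p. if cube_depth n (snd p) \<le> cube_inner n (snd p)
    then G (fst p, cube_clamp n (snd p)) else H (cube_depth n (snd p), x))"
  have Fcont: "continuous_map (prod_topology unit_interval (cube n)) X F"
    unfolding F_def
  proof (rule continuous_map_cube_shell)
    have "continuous_map (prod_topology unit_interval (cube n)) (prod_topology unit_interval (cube n))
        (\<lambda>p. (fst p, cube_clamp n (snd p)))"
      by (auto simp: continuous_map_pairwise o_def continuous_map_fst
          intro: continuous_map_pair_snd continuous_map_cube_clamp)
    from continuous_map_compose[OF this G(1)]
    show "continuous_map (prod_topology unit_interval (cube n)) X (\<lambda>p. G (fst p, cube_clamp n (snd p)))"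
      by (simp add: o_def)
    show "continuous_map (prod_topology unit_interval (cube n)) X (\<lambda>p. H (cube_depth n (snd p), x))"
      by (intro cont_compose cont_rules) (auto simp: cube_depth_range)
  qed (use G(4) in \<open>auto simp: H0\<close>)
  have ends: "(if cube_depth n t \<le> cube_inner n t then h (c (cube_clamp n t)) else H (cube_depth n t, x))
      = H (cube_depth n t, c (cube_clamp n t))" if "c \<in> spheroids n X x" for c t
    by (cases rule: cube_shell_cases[of n t]) (auto simp: H0 spheroid_boundary[OF that])
  have bd: "\<not> cube_depth n t \<le> cube_inner n t" if "t \<in> cube_boundary n" for t
    using cube_depth_boundary[OF that] cube_shell_cases[of n t] by fastforce
  have "(\<lambda>t. H (cube_depth n t, a (cube_clamp n t)), \<lambda>t. H (cube_depth n t, b (cube_clamp n t)))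
      \<in> spheroid_homotopy n X x"
    by (rule spheroid_homotopyI[OF Fcont])
       (use bd in \<open>auto simp: F_def G ends[OF a, symmetric] ends[OF b, symmetric] cube_depth_boundary H1 x\<close>)
  from spheroid_homotopy_trans[OF spheroid_homotopy_sym[OF transported[OF a]] this]
  show ?thesis by (rule spheroid_homotopy_trans) (rule transported[OF b])
qed

text \<open>Surjectivity of \<open>h\<close> onto the classes based at \<open>h x\<close>.
  Surrounding \<open>c\<close> by the track from \<open>h x\<close> to \<open>x\<close> gives
  \<open>a\<close>. Then \<open>h \<circ> a\<close> is homotopic to \<open>Q\<close>, which is
  \<open>a\<close> surrounded by the reversed track, and the two tracks cancel.\<close>

lemma spheroid_homotopy_lift:
  assumes c: "c \<in> spheroids n X (h x)"
  obtains a where "a \<in> spheroids n X x" "(h \<circ> a, c) \<in> spheroid_homotopy n X (h x)"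
proof -
  \<comment> \<open>The first argument says how much of the track is followed: nothing at 0, all the
    way to \<open>x\<close> at 1.\<close>
  define K where "K = (\<lambda>p. if cube_depth n (snd p) \<le> cube_inner n (snd p)
    then c (cube_clamp n (snd p)) else H (fst p * cube_depth n (snd p), x))"
  define a where "a = (\<lambda>t. K (1, t))"
  have mult01: "0 \<le> s * r \<and> s * r \<le> 1" if "s \<in> {0..1}" "r \<in> {0..1}" for s r :: real
    using that by (auto simp: mult_le_one)
  have cc: "continuous_map (cube n) X (\<lambda>t. c (cube_clamp n t))"
    using spheroid_continuous[OF spheroids_clamp[OF c]] by (simp add: o_def)
  have Kcont: "continuous_map (prod_topology unit_interval (cube n)) X K"
    unfolding K_def
  proof (rule continuous_map_cube_shell)
    show "continuous_map (prod_topology unit_interval (cube n)) X (\<lambda>p. H (fst p * cube_depth n (snd p), x))"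
      by (intro cont_compose cont_rules) (use mult01 cube_depth_range in auto)
  qed (use c cc in \<open>auto simp: H0 spheroid_boundary intro: continuous_map_pair_snd\<close>)
  have bd: "\<not> cube_depth n t \<le> cube_inner n t" if "t \<in> cube_boundary n" for t
    using cube_depth_boundary[OF that] cube_shell_cases[of n t] by fastforce
  have "continuous_map (cube n) X a"
    using continuous_map_o_Pair[OF Kcont, of 1] by (simp add: a_def o_def)
  then have a: "a \<in> spheroids n X x"
    using bd by (auto simp: spheroids_def a_def K_def cube_depth_boundary H1 x)
  have ha: "h \<circ> a \<in> spheroids n X (h x)"
  proof -
    have "continuous_map X X (\<lambda>y. H (0, y))"
      using continuous_map_o_Pair[OF cont, of 0] by (simp add: o_def)
    then show ?thesis using spheroids_compose[OF a] by (simp add: H0 eta_contract_eq)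
  qed
  define Q where "Q = (\<lambda>t. H (1 - cube_depth n t, a (cube_clamp n t)))"
  have 1: "((h \<circ> a) \<circ> cube_clamp n, Q) \<in> spheroid_homotopy n X (h x)"
  proof (rule spheroid_homotopyI[where h = "\<lambda>p. H (min (fst p) (1 - cube_depth n (snd p)), a (cube_clamp n (snd p)))"])
    show "continuous_map (prod_topology unit_interval (cube n)) X
        (\<lambda>p. H (min (fst p) (1 - cube_depth n (snd p)), a (cube_clamp n (snd p))))"
      using spheroid_continuous[OF spheroids_clamp[OF a]] cube_depth_range
      by (intro cont_compose cont_rules)
         (auto simp: min_def o_def intro!: continuous_map_pair_snd)
  qed (use cube_clamp_boundary a in
      \<open>auto simp: cube_depth_boundary cube_depth_range min.absorb1 min.absorb2 H0 spheroid_boundary Q_def\<close>)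
  \<comment> \<open>Both tracks are shortened simultaneously, so the boundary value stays
    \<open>h x\<close>. At time 0 only \<open>c\<close> is left, clamped twice: once by
    \<open>K\<close> and once by the outer collar.\<close>
  define L where "L = (\<lambda>p. if cube_depth n (snd p) \<le> cube_inner n (snd p)
    then K (fst p, cube_clamp n (snd p)) else H (fst p * (1 - cube_depth n (snd p)), x))"
  have Lcont: "continuous_map (prod_topology unit_interval (cube n)) X L"
    unfolding L_def
  proof (rule continuous_map_cube_shell)
    have "continuous_map (prod_topology unit_interval (cube n)) (prod_topology unit_interval (cube n))
        (\<lambda>p. (fst p, cube_clamp n (snd p)))"
      by (auto simp: continuous_map_pairwise o_def continuous_map_fst
          intro: continuous_map_pair_snd continuous_map_cube_clamp)
    from continuous_map_compose[OF this Kcont]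
    show "continuous_map (prod_topology unit_interval (cube n)) X (\<lambda>p. K (fst p, cube_clamp n (snd p)))"
      by (simp add: o_def)
    show "continuous_map (prod_topology unit_interval (cube n)) X (\<lambda>p. H (fst p * (1 - cube_depth n (snd p)), x))"
      by (intro cont_compose cont_rules) (use mult01 cube_depth_range in auto)
  qed (use bd in \<open>auto simp: K_def cube_depth_boundary\<close>)
  have 2: "((c \<circ> cube_clamp n) \<circ> cube_clamp n, Q) \<in> spheroid_homotopy n X (h x)"
  proof (rule spheroid_homotopyI[OF Lcont])
    show "L (0, t) = ((c \<circ> cube_clamp n) \<circ> cube_clamp n) t" for t
      using cube_clamp_boundary[of "cube_clamp n t" n] cube_depth_pos[of n "cube_clamp n t"]
      by (cases rule: cube_shell_cases[of n t]; cases rule: cube_shell_cases[of n "cube_clamp n t"])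
         (auto simp: L_def K_def H0 spheroid_boundary[OF c])
    show "L (1, t) = Q t" if "t \<in> topspace (cube n)" for t
    proof -
      have "a (cube_clamp n t) \<in> topspace X"
        using spheroid_continuous[OF a] cube_clamp_in_cube by (auto dest: continuous_map_funspace)
      then show ?thesis
        by (cases rule: cube_shell_cases[of n t])
           (auto simp: L_def Q_def H1 spheroid_boundary[OF a], simp add: a_def)
    qed
    show "L (s, t) = h x" if "s \<in> {0..1}" "t \<in> cube_boundary n" for s t
      using that bd by (auto simp: L_def cube_depth_boundary H0)
  qed
  have "(h \<circ> a, c) \<in> spheroid_homotopy n X (h x)"
    by (rule spheroid_homotopy_trans[OF spheroid_homotopy_sym[OF spheroid_homotopy_clamp[OF ha]]
          spheroid_homotopy_trans[OF 1 spheroid_homotopy_trans[OF spheroid_homotopy_sym[OF 2]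
            spheroid_homotopy_trans[OF spheroid_homotopy_clamp[OF spheroids_clamp[OF c]]
              spheroid_homotopy_clamp[OF c]]]]])
  with a show thesis by (rule that)
qed

end

section \<open>Path components and homotopy groups\<close>

lemma homotopic_to_idI:
  assumes "homotopic_with (\<lambda>_. True) X X h id" "x \<in> topspace X"
  obtains H where "homotopic_to_id X H h x"
proof -
  obtain H where "continuous_map (prod_topology unit_interval X) X H" "\<And>y. H (0, y) = h y"
    "\<And>y. H (1, y) = id y"
    using assms(1) unfolding homotopic_with_def by blast
  then have "homotopic_to_id X H h x"
    using assms(2) by unfold_locales auto
  then show thesis by (rule that)
qed

lemma bij_betw_class_map:
  assumes "equiv S E" "equiv T F"
    and mono: "\<And>a b. (a, b) \<in> E \<Longrightarrow> (g a, g b) \<in> F"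
    and inj: "\<And>a b. a \<in> S \<Longrightarrow> b \<in> S \<Longrightarrow> (g a, g b) \<in> F \<Longrightarrow> (a, b) \<in> E"
    and surj: "\<And>c. c \<in> T \<Longrightarrow> \<exists>a\<in>S. (g a, c) \<in> F"
  shows "bij_betw (class_map F g) (S // E) (T // F)"
proof -
  have eq: "class_map F g (E `` {a}) = F `` {g a}" if "a \<in> S" for a
  proof -
    have "(a, a) \<in> E" using that assms(1) by (meson equivE refl_onD)
    moreover have "(g a, d) \<in> F" if "(a, b) \<in> E" "(g b, d) \<in> F" for b d
      using mono that assms(2) by (meson equivE transD)
    ultimately show ?thesis by (auto simp: class_map_def)
  qed
  have gT: "g a \<in> T" if "a \<in> S" for a
    using mono that assms(1,2) by (meson equivE refl_onD equiv_class_eq_iff)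
  show ?thesis
  proof (rule bij_betw_imageI)
    show "inj_on (class_map F g) (S // E)"
    proof (rule inj_onI)
      fix p q assume "p \<in> S // E" "q \<in> S // E" "class_map F g p = class_map F g q"
      then obtain a b where "p = E `` {a}" "q = E `` {b}" "a \<in> S" "b \<in> S" "F `` {g a} = F `` {g b}"
        by (auto elim!: quotientE simp: eq)
      then show "p = q"
        using inj assms(1,2) gT by (metis eq_equiv_class equiv_class_eq)
    qed
    show "class_map F g ` (S // E) = T // F"
    proof
      show "class_map F g ` (S // E) \<subseteq> T // F"
        using gT by (auto elim!: quotientE simp: eq) (simp add: quotientI)
      show "T // F \<subseteq> class_map F g ` (S // E)"
      proof
        fix q assume "q \<in> T // F"
        then obtain c where c: "c \<in> T" "q = F `` {c}" by (auto elim: quotientE)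
        obtain a where "a \<in> S" "(g a, c) \<in> F" using surj c by blast
        then have "class_map F g (E `` {a}) = q" "E `` {a} \<in> S // E"
          using c eq assms(2) by (auto simp: equiv_class_eq intro: quotientI)
        then show "q \<in> class_map F g ` (S // E)" by blast
      qed
    qed
  qed
qed

lemma equiv_spheroid_homotopy: "equiv (spheroids n X x) (spheroid_homotopy n X x)"
proof (intro equivI)
  show "spheroid_homotopy n X x \<subseteq> spheroids n X x \<times> spheroids n X x"
    by (auto simp only: mem_Times_iff split_paired_all fst_conv snd_conv spheroid_homotopy_spheroids intro!: subsetI)
  show "refl_on (spheroids n X x) (spheroid_homotopy n X x)"
    by (rule refl_onI) (rule spheroid_homotopy_refl)
  show "sym (spheroid_homotopy n X x)" by (rule symI) (rule spheroid_homotopy_sym)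
  show "trans (spheroid_homotopy n X x)" by (rule transI) (rule spheroid_homotopy_trans)
qed

lemma equiv_path_component_of: "equiv (topspace X) {(y, y'). path_component_of X y y'}"
  by (intro equivI refl_onI symI transI)
     (auto simp: path_component_of_refl intro: path_component_of_sym path_component_of_trans
       dest: path_component_of_equiv[THEN iffD1] path_component_in_topspace)

lemma path_components_of_quotient:
  "path_components_of X = topspace X // {(y, y'). path_component_of X y y'}"
  unfolding path_components_of_def quotient_def by (auto simp: Image_def)

lemma path_component_of_homotopic:
  assumes "homotopic_with (\<lambda>_. True) X X h id" "x \<in> topspace X"
  shows "path_component_of X (h x) x"
proof -
  obtain H where H: "homotopic_to_id X H h x" using assms by (rule homotopic_to_idI)
  interpret homotopic_to_id X H h x by (rule H)
  have "continuous_map unit_interval X (\<lambda>s. H (s, x))"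
    by (rule cont_compose) (auto simp: x)
  then show ?thesis
    unfolding path_component_of_def pathin_def using H0 H1 x by force
qed

text \<open>In general \<open>g (f x)\<close> differs from \<open>x\<close>, so functoriality alone
  gives no inverse on homotopy groups. Injectivity holds because \<open>g \<circ> f\<close> reflects
  homotopies. For surjectivity, lift \<open>g \<circ> c\<close> along \<open>g \<circ> f\<close> to
  some \<open>a\<close>; then \<open>f \<circ> a\<close> and \<open>c\<close> become homotopic after
  \<open>f \<circ> g\<close>, which also reflects homotopies.\<close>

proposition homotopy_equivalence_imp_weak_equivalence:
  assumes f: "continuous_map X Y f" and g: "continuous_map Y X g"
    and gf: "homotopic_with (\<lambda>_. True) X X (g \<circ> f) id"
    and fg: "homotopic_with (\<lambda>_. True) Y Y (f \<circ> g) id"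
  shows "weak_equivalence X Y f"
  unfolding weak_equivalence_def
proof (intro conjI allI impI ballI)
  show "continuous_map X Y f" by fact
  have pc: "path_component_of Z' (k a) (k b)" if "path_component_of Z a b" "continuous_map Z Z' k"
    for Z :: "'c topology" and Z' :: "'d topology" and k a b
    using that path_component_of_continuous_image by fastforce
  show "bij_betw (class_map {(y, y'). path_component_of Y y y'} f) (path_components_of X) (path_components_of Y)"
    unfolding path_components_of_quotient
  proof (rule bij_betw_class_map[OF equiv_path_component_of equiv_path_component_of])
    fix a b assume ab: "a \<in> topspace X" "b \<in> topspace X" "(f a, f b) \<in> {(y, y'). path_component_of Y y y'}"
    then have "path_component_of X (g (f a)) (g (f b))" using pc g by auto
    then show "(a, b) \<in> {(y, y'). path_component_of X y y'}"
      using path_component_of_homotopic[OF gf] ab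
      by (auto simp: o_def) (meson path_component_of_sym path_component_of_trans)
  next
    fix c assume "c \<in> topspace Y"
    then show "\<exists>a\<in>topspace X. (f a, c) \<in> {(y, y'). path_component_of Y y y'}"
      using path_component_of_homotopic[OF fg] g by (auto dest: continuous_map_funspace)
  qed (use pc f in auto)
  fix n :: nat and x assume x: "x \<in> topspace X"
  then have fx: "f x \<in> topspace Y" using f by (auto dest: continuous_map_funspace)
  obtain H where H: "homotopic_to_id X H (g \<circ> f) x" using gf x by (rule homotopic_to_idI)
  obtain K where K: "homotopic_to_id Y K (f \<circ> g) (f x)" using fg fx by (rule homotopic_to_idI)
  show "bij_betw (class_map (spheroid_homotopy n Y (f x)) ((\<circ>) f)) (homotopy_group n X x)
    (homotopy_group n Y (f x))"
    unfolding homotopy_group_def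
  proof (rule bij_betw_class_map[OF equiv_spheroid_homotopy equiv_spheroid_homotopy])
    fix a b assume ab: "a \<in> spheroids n X x" "b \<in> spheroids n X x"
      "(f \<circ> a, f \<circ> b) \<in> spheroid_homotopy n Y (f x)"
    from spheroid_homotopy_compose[OF ab(3) g]
    have "((g \<circ> f) \<circ> a, (g \<circ> f) \<circ> b) \<in> spheroid_homotopy n X ((g \<circ> f) x)" by (simp add: o_assoc)
    then show "(a, b) \<in> spheroid_homotopy n X x"
      using homotopic_to_id.spheroid_homotopy_reflect[OF H] ab by blast
  next
    fix c assume c: "c \<in> spheroids n Y (f x)"
    then have "g \<circ> c \<in> spheroids n X ((g \<circ> f) x)" using spheroids_compose[OF c g] by simp
    from homotopic_to_id.spheroid_homotopy_lift[OF H this]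
    obtain a where a: "a \<in> spheroids n X x" "((g \<circ> f) \<circ> a, g \<circ> c) \<in> spheroid_homotopy n X ((g \<circ> f) x)" .
    from spheroid_homotopy_compose[OF a(2) f]
    have "((f \<circ> g) \<circ> (f \<circ> a), (f \<circ> g) \<circ> c) \<in> spheroid_homotopy n Y ((f \<circ> g) (f x))"
      by (simp add: o_assoc)
    then have "(f \<circ> a, c) \<in> spheroid_homotopy n Y (f x)"
      using homotopic_to_id.spheroid_homotopy_reflect[OF K] spheroids_compose[OF a(1) f] c by blast
    with a show "\<exists>a\<in>spheroids n X x. (f \<circ> a, c) \<in> spheroid_homotopy n Y (f x)" by blast
  qed (rule spheroid_homotopy_compose[OF _ f])
qed

section \<open>Maps into and out of realizations and quotients\<close>

lemma powertop_real_eq: "powertop_real UNIV = (euclidean :: ('v \<Rightarrow> real) topology)"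
  by (rule euclidean_product_topology)

lemma continuous_on_eval: "continuous_on S f \<Longrightarrow> continuous_on S (\<lambda>z. f z v)"
  for f :: "'z::topological_space \<Rightarrow> 'v \<Rightarrow> real"
  by (rule continuous_on_product_then_coordinatewise)

text \<open>A sum over an infinite set is 0 by convention, hence never 1.\<close>

lemma closed_simplex_finite: "x \<in> closed_simplex \<sigma> \<Longrightarrow> finite \<sigma>"
  by (rule ccontr) (auto simp: closed_simplex_def)

text \<open>With the total taken over the support, it no longer depends on \<open>\<sigma>\<close>,
  and a simplex can be enlarged or shrunk without recomputing sums.\<close>

lemma closed_simplex_iff:
  "x \<in> closed_simplex \<sigma> \<longleftrightarrow> finite \<sigma> \<and> (\<forall>v. 0 \<le> x v) \<and> (\<forall>v. v \<notin> \<sigma> \<longrightarrow> x v = 0) \<and> sum x {v. x v \<noteq> 0} = 1"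
  (is "?L \<longleftrightarrow> ?R")
proof -
  have eq: "sum x {v. x v \<noteq> 0} = sum x \<sigma>" if "finite \<sigma>" "\<forall>v. v \<notin> \<sigma> \<longrightarrow> x v = 0"
    using that by (intro sum.mono_neutral_left) auto
  show ?thesis
  proof
    assume L: ?L
    then show ?R
      using closed_simplex_finite[OF L] eq unfolding closed_simplex_def by auto
  next
    assume ?R
    with eq show ?L unfolding closed_simplex_def by auto
  qed
qed

lemma closed_simplex_mono: "\<sigma> \<subseteq> \<tau> \<Longrightarrow> finite \<tau> \<Longrightarrow> closed_simplex \<sigma> \<subseteq> closed_simplex \<tau>"
  unfolding closed_simplex_iff subset_iff by blast

lemma closed_simplex_support_subset: "x \<in> closed_simplex \<sigma> \<Longrightarrow> {v. x v \<noteq> 0} \<subseteq> \<sigma>"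
  by (auto simp: closed_simplex_iff)

lemma closed_simplex_support: "x \<in> closed_simplex \<sigma> \<Longrightarrow> x \<in> closed_simplex {v. x v \<noteq> 0}"
  using finite_subset[OF closed_simplex_support_subset[of x \<sigma>]] by (auto simp: closed_simplex_iff)

lemma closed_simplex_nonempty: "x \<in> closed_simplex \<sigma> \<Longrightarrow> {v. x v \<noteq> 0} \<noteq> {}"
  unfolding closed_simplex_iff by (metis sum.empty zero_neq_one)

lemma closed_closed_simplex:
  fixes \<sigma> :: "'v set"
  shows "closed (closed_simplex \<sigma>)"
proof -
  have "closed_simplex \<sigma> = (\<Inter>v. {x. 0 \<le> x v}) \<inter> (\<Inter>v\<in>-\<sigma>. {x. x v = 0}) \<inter> {x. sum x \<sigma> = 1}"
    by (auto simp: closed_simplex_def)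
  also have "closed \<dots>"
    by (intro closed_Int closed_INT ballI closed_Collect_le closed_Collect_eq continuous_intros
        continuous_on_eval)
  finally show ?thesis .
qed

text \<open>Only nonempty faces are asked for, since row complexes do not contain the empty
  set.\<close>

definition down_closed :: "'v set set \<Rightarrow> bool" where
  "down_closed K \<longleftrightarrow> (\<forall>\<sigma>\<in>K. \<forall>\<tau>. \<tau> \<noteq> {} \<and> \<tau> \<subseteq> \<sigma> \<longrightarrow> \<tau> \<in> K)"

lemma down_closedD: "down_closed K \<Longrightarrow> \<sigma> \<in> K \<Longrightarrow> \<tau> \<subseteq> \<sigma> \<Longrightarrow> \<tau> \<noteq> {} \<Longrightarrow> \<tau> \<in> K"
  unfolding down_closed_def by simp

lemma down_closed_row_complex: "down_closed (row_complex A)"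
  unfolding down_closed_def row_complex_def by (auto intro: finite_subset)

section \<open>Continuity for the weak topology\<close>

lemma in_realization_iff:
  "x \<in> topspace (realization K) \<longleftrightarrow> (\<exists>\<sigma>\<in>K. x \<in> closed_simplex \<sigma>)"
  by (simp add: topspace_realization)

lemma continuous_map_closed_simplex_realization:
  assumes "\<sigma> \<in> K"
  shows "continuous_map (top_of_set (closed_simplex \<sigma>)) (realization K) (\<lambda>x. x)"
proof -
  have "{x \<in> closed_simplex \<sigma>. x \<in> U} = U \<inter> closed_simplex \<sigma>" for U by auto
  then show ?thesis
    using assms by (auto simp: continuous_map_def openin_realization powertop_real_eq topspace_realization)
qed

text \<open>On an infinite complex the weak topology can be strictly finer than the product
  topology, so continuous coordinates are not enough in general. With all supports inside a finite
  \<open>V\<close> only finitely many simplices occur; their preimages are closed, and a finite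
  closed cover permits pasting.\<close>

lemma continuous_map_into_realization:
  fixes h :: "'z::topological_space \<Rightarrow> 'v \<Rightarrow> real"
  assumes K: "down_closed K" and V: "finite V"
    and supp: "\<And>z. z \<in> Z \<Longrightarrow> {v. h z v \<noteq> 0} \<subseteq> V"
    and h: "\<And>z. z \<in> Z \<Longrightarrow> h z \<in> topspace (realization K)"
    and cont: "\<And>v. continuous_on Z (\<lambda>z. h z v)"
  shows "continuous_map (top_of_set Z) (realization K) h"
proof (rule pasting_lemma_closed[where I = "{\<sigma> \<in> K. \<sigma> \<subseteq> V}" and T = "\<lambda>\<sigma>. Z \<inter> h -` closed_simplex \<sigma>" and f = "\<lambda>_. h"])
  have hc: "continuous_on Z h"
    using cont by (rule continuous_on_coordinatewise_then_product)
  show "finite {\<sigma> \<in> K. \<sigma> \<subseteq> V}" using V by simp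
  show "closedin (top_of_set Z) (Z \<inter> h -` closed_simplex \<sigma>)" for \<sigma>
    using hc closed_closed_simplex by (rule continuous_closedin_preimage)
  show "continuous_map (subtopology (top_of_set Z) (Z \<inter> h -` closed_simplex \<sigma>)) (realization K) h"
    if "\<sigma> \<in> {\<sigma> \<in> K. \<sigma> \<subseteq> V}" for \<sigma>
  proof -
    have "continuous_map (subtopology (top_of_set Z) (Z \<inter> h -` closed_simplex \<sigma>))
        (top_of_set (closed_simplex \<sigma>)) h"
      using hc by (auto simp: subtopology_subtopology continuous_map_in_subtopology
          intro: continuous_on_subset)
    from continuous_map_compose[OF this continuous_map_closed_simplex_realization] that
    show ?thesis by (simp add: o_def)
  qed
  show "\<exists>\<sigma>. \<sigma> \<in> {\<sigma> \<in> K. \<sigma> \<subseteq> V} \<and> z \<in> Z \<inter> h -` closed_simplex \<sigma> \<and> h z = h z"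
    if z: "z \<in> topspace (top_of_set Z)" for z
  proof -
    obtain \<sigma> where \<sigma>: "\<sigma> \<in> K" "h z \<in> closed_simplex \<sigma>"
      using h[of z] z unfolding in_realization_iff by auto
    have "{v. h z v \<noteq> 0} \<in> K"
      by (rule down_closedD[OF K \<sigma>(1) closed_simplex_support_subset[OF \<sigma>(2)] closed_simplex_nonempty[OF \<sigma>(2)]])
    then show ?thesis
      using supp[of z] z closed_simplex_support[OF \<sigma>(2)]
      by (intro exI[of _ "{v. h z v \<noteq> 0}"]) simp
  qed
qed simp

section \<open>Disjoint sums and quotient maps\<close>

lemma continuous_map_sum_topology_snd:
  assumes "i \<in> I"
  shows "continuous_map (subtopology (sum_topology X I) ({i} \<times> topspace (X i))) (X i) snd"
proof -
  have "openin (subtopology (sum_topology X I) ({i} \<times> topspace (X i)))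
      {p \<in> topspace (subtopology (sum_topology X I) ({i} \<times> topspace (X i))). snd p \<in> U}"
    if "openin (X i) U" for U
  proof -
    have "{x. (j, x) \<in> {i} \<times> U} = (if j = i then U else {})" for j by auto
    then have "openin (sum_topology X I) ({i} \<times> U)"
      using that assms openin_subset[OF that] by (auto simp: openin_sum_topology)
    moreover have "{p \<in> topspace (subtopology (sum_topology X I) ({i} \<times> topspace (X i))). snd p \<in> U}
        = ({i} \<times> U) \<inter> ({i} \<times> topspace (X i))"
      using assms openin_subset[OF that] by auto
    ultimately show ?thesis by (auto simp: openin_subtopology)
  qed
  then show ?thesis by (auto simp: continuous_map_def)
qed

lemma openin_sum_topology_summand: "i \<in> I \<Longrightarrow> openin (sum_topology X I) ({i} \<times> topspace (X i))"
proof -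
  assume "i \<in> I"
  moreover have "{x. (j, x) \<in> {i} \<times> topspace (X i)} = (if j = i then topspace (X i) else {})" for j
    by auto
  ultimately show ?thesis by (auto simp: openin_sum_topology)
qed

lemma continuous_map_prod_sum_topology:
  assumes "\<And>i. i \<in> I \<Longrightarrow> continuous_map (prod_topology Z (X i)) Y (\<lambda>(z, x). f (z, (i, x)))"
  shows "continuous_map (prod_topology Z (sum_topology X I)) Y f"
proof (rule pasting_lemma[where I = I and T = "\<lambda>i. topspace Z \<times> ({i} \<times> topspace (X i))" and f = "\<lambda>_. f"])
  fix i assume i: "i \<in> I"
  show "openin (prod_topology Z (sum_topology X I)) (topspace Z \<times> ({i} \<times> topspace (X i)))"
    using openin_sum_topology_summand[OF i] by (auto simp: openin_prod_Times_iff)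
  let ?S = "subtopology (prod_topology Z (sum_topology X I)) (topspace Z \<times> ({i} \<times> topspace (X i)))"
  have S: "?S = prod_topology Z (subtopology (sum_topology X I) ({i} \<times> topspace (X i)))"
    by (simp add: prod_topology_subtopology)
  have "continuous_map ?S (prod_topology Z (X i)) (\<lambda>p. (fst p, snd (snd p)))"
    unfolding S using continuous_map_compose[OF continuous_map_snd continuous_map_sum_topology_snd[OF i, of X], of Z]
    by (auto simp: continuous_map_pairwise o_def continuous_map_fst)
  from continuous_map_compose[OF this assms[OF i]]
  have "continuous_map ?S Y (\<lambda>p. f (fst p, (i, snd (snd p))))"
    by (simp add: o_def case_prod_unfold)
  then show "continuous_map ?S Y f"
    by (rule continuous_map_eq) auto
qed auto

text \<open>The weak topology is rephrased as a quotient because quotient maps survive products with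
  locally compact Hausdorff spaces; this is how homotopies on a realization are tested on
  simplices.\<close>

lemma quotient_map_realization:
  "quotient_map (sum_topology (\<lambda>\<sigma>. top_of_set (closed_simplex \<sigma>)) K) (realization K) snd"
  unfolding quotient_map_def
proof (intro conjI allI impI)
  show "snd ` topspace (sum_topology (\<lambda>\<sigma>. top_of_set (closed_simplex \<sigma>)) K) = topspace (realization K)"
    by (force simp: topspace_realization)
  fix U assume U: "U \<subseteq> topspace (realization K)"
  have "{x. (\<sigma>, x) \<in> {p \<in> topspace (sum_topology (\<lambda>\<sigma>. top_of_set (closed_simplex \<sigma>)) K). snd p \<in> U}} = U \<inter> closed_simplex \<sigma>"
    if "\<sigma> \<in> K" for \<sigma>
    using that by auto
  then show "openin (sum_topology (\<lambda>\<sigma>. top_of_set (closed_simplex \<sigma>)) K)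
       {x \<in> topspace (sum_topology (\<lambda>\<sigma>. top_of_set (closed_simplex \<sigma>)) K). snd x \<in> U} =
      openin (realization K) U"
    using U by (auto simp: openin_sum_topology openin_realization powertop_real_eq topspace_realization)
qed

lemma continuous_map_prod_realization:
  assumes "compact_space Z" "Hausdorff_space Z"
    and "\<And>\<sigma>. \<sigma> \<in> K \<Longrightarrow> continuous_map (prod_topology Z (top_of_set (closed_simplex \<sigma>))) Y h"
  shows "continuous_map (prod_topology Z (realization K)) Y h"
proof -
  have "quotient_map (prod_topology Z (sum_topology (\<lambda>\<sigma>. top_of_set (closed_simplex \<sigma>)) K))
     (prod_topology Z (realization K)) (\<lambda>(x, y). (x, snd y))"
    using assms by (intro quotient_map_prod_right quotient_map_realization)
      (auto simp: compact_imp_locally_compact_space)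
  moreover have "continuous_map (prod_topology Z (sum_topology (\<lambda>\<sigma>. top_of_set (closed_simplex \<sigma>)) K)) Y
     (h \<circ> (\<lambda>(x, y). (x, snd y)))"
    using assms(3) by (intro continuous_map_prod_sum_topology) (auto simp: o_def case_prod_unfold)
  ultimately show ?thesis
    by (rule continuous_compose_quotient_map)
qed

lemma continuous_map_realization:
  assumes "\<And>\<sigma>. \<sigma> \<in> K \<Longrightarrow> continuous_map (top_of_set (closed_simplex \<sigma>)) Y h"
  shows "continuous_map (realization K) Y h"
proof -
  have "continuous_map (sum_topology (\<lambda>\<sigma>. top_of_set (closed_simplex \<sigma>)) K) Y (h \<circ> snd)"
    using assms unfolding continuous_map_def
    by (auto simp: openin_sum_topology Pi_iff) (simp add: Collect_conj_eq)?
  then show ?thesis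
    by (rule continuous_compose_quotient_map[OF quotient_map_realization])
qed

lemma quotient_map_quotient_space: "quotient_map X (quotient_space X E) (\<lambda>p. E `` {p})"
  unfolding quotient_map_def
proof (intro conjI allI impI)
  show "(\<lambda>p. E `` {p}) ` topspace X = topspace (quotient_space X E)"
    by (auto simp: topspace_quotient_space quotient_def)
  fix U assume "U \<subseteq> topspace (quotient_space X E)"
  then show "openin X {p \<in> topspace X. E `` {p} \<in> U} = openin (quotient_space X E) U"
    by (simp add: openin_quotient_space topspace_quotient_space)
qed

section \<open>Coordinates on the classifying space\<close>

definition fibre_complex :: "('s, 't) relation \<Rightarrow> ('t, 'w) relation \<Rightarrow> 's set \<Rightarrow> 't set set" where
  "fibre_complex P Q \<kappa> = row_complex (Q\<lparr>rows := common_cols P \<kappa>\<rparr>)"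

lemma fibre_eq: "fibre P Q \<kappa> = realization (fibre_complex P Q \<kappa>)"
  by (simp add: fibre_def fibre_complex_def)

lemma down_closed_fibre_complex: "down_closed (fibre_complex P Q \<kappa>)"
  by (simp add: fibre_complex_def down_closed_row_complex)

lemma fibre_complex_antimono: "\<kappa> \<subseteq> \<kappa>' \<Longrightarrow> fibre_complex P Q \<kappa>' \<subseteq> fibre_complex P Q \<kappa>"
  by (auto simp: fibre_complex_def row_complex_def common_cols_def)

lemma fibre_antimono:
  "\<kappa> \<subseteq> \<kappa>' \<Longrightarrow> x \<in> topspace (fibre P Q \<kappa>') \<Longrightarrow> x \<in> topspace (fibre P Q \<kappa>)"
  using fibre_complex_antimono[of \<kappa> \<kappa>' P Q] by (auto simp: fibre_eq in_realization_iff)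

text \<open>Chains descend because morphisms go from larger to smaller simplices. Hence the fibre
  over \<open>C 0\<close> is the smallest one.\<close>

definition chain_on :: "('s, 't) relation \<Rightarrow> nat \<Rightarrow> (nat \<Rightarrow> 's set) \<Rightarrow> bool" where
  "chain_on P n C \<longleftrightarrow> (\<forall>i\<le>n. C i \<in> row_complex P) \<and> (\<forall>i j. i \<le> j \<and> j \<le> n \<longrightarrow> C j \<subseteq> C i)"

text \<open>Morphisms leave the coordinates of a point unchanged, so a functor on the poset amounts
  to a chain and a single point of the fibre over \<open>C 0\<close>;
  \<open>topspace_nerve_subset\<close> proves this. The restrictions are there because points of
  product topologies are extensional.\<close>

definition chain_simplex :: "nat \<Rightarrow> (nat \<Rightarrow> 's set) \<Rightarrow> ('t \<Rightarrow> real) \<Rightarrow>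
    ('s set \<times> ('t \<Rightarrow> real), ('s set \<times> 's set) \<times> ('t \<Rightarrow> real)) nerve_simplex" where
  "chain_simplex n C x =
    (restrict (\<lambda>i. (C i, x)) {..n}, restrict (\<lambda>(i, j). ((C i, C j), x)) (poset_pairs n))"

lemma chain_simplex_cong: "(\<And>i. i \<le> n \<Longrightarrow> C i = D i) \<Longrightarrow> chain_simplex n C x = chain_simplex n D x"
  unfolding chain_simplex_def by (auto simp: poset_pairs_def intro!: restrict_ext)

lemma chain_on_subset: "chain_on P n C \<Longrightarrow> i \<le> n \<Longrightarrow> C i \<subseteq> C 0"
  by (simp add: chain_on_def)

lemma topspace_nerve_subset:
  assumes "F \<in> topspace (nerve (rel_cat P Q) n)"
  obtains C x where "chain_on P n C" "x \<in> topspace (fibre P Q (C 0))" "F = chain_simplex n C x"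
proof -
  obtain ob mr where F: "F = (ob, mr)" by (cases F)
  have ob1: "ob \<in> extensional {..n}" and ob_in: "\<And>i. i \<le> n \<Longrightarrow> ob i \<in> Sigma (row_complex P) (topspace \<circ> fibre P Q)"
    using assms unfolding F nerve_def rel_cat_def by (auto simp: PiE_iff)
  have ob: "fst (ob i) \<in> row_complex P \<and> snd (ob i) \<in> topspace (fibre P Q (fst (ob i)))" if "i \<le> n" for i
    using ob_in[OF that] by (cases "ob i") simp
  have mr: "mr \<in> extensional (poset_pairs n)"
    "\<And>i j. i \<le> j \<Longrightarrow> j \<le> n \<Longrightarrow> snd (fst (mr (i, j))) \<subseteq> fst (fst (mr (i, j)))"
    using assms unfolding F nerve_def rel_cat_def
    by (auto simp: PiE_iff poset_pairs_def) force
  have st: "Src (rel_cat P Q) (mr (i, j)) = ob i" "Tgt (rel_cat P Q) (mr (i, j)) = ob j"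
    if "i \<le> j" "j \<le> n" for i j
    using assms that unfolding F nerve_def is_functor_def by auto
  define C where "C = (\<lambda>i. fst (ob i))"
  define x where "x = snd (ob 0)"
  have mr_eq: "mr (i, j) = ((C i, C j), snd (ob i)) \<and> snd (ob j) = snd (ob i)" if "i \<le> j" "j \<le> n" for i j
  proof -
    obtain a b y where "mr (i, j) = ((a, b), y)" by (metis surj_pair)
    with st[OF that] show ?thesis by (auto simp: rel_cat_def C_def) (metis snd_conv fst_conv)+
  qed
  have obx: "ob i = (C i, x)" if "i \<le> n" for i
    using mr_eq[of 0 i] that by (auto simp: C_def x_def prod_eq_iff)
  have "C j \<subseteq> C i" if "i \<le> j" "j \<le> n" for i j
    using mr(2)[OF that] mr_eq[OF that] by simp
  then have "chain_on P n C"
    using ob by (auto simp: chain_on_def C_def)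
  moreover have "x \<in> topspace (fibre P Q (C 0))"
    using ob[of 0] by (simp add: C_def x_def)
  moreover have "F = chain_simplex n C x"
    unfolding F chain_simplex_def
  proof (intro arg_cong2[where f = Pair])
    show "ob = restrict (\<lambda>i. (C i, x)) {..n}"
      using ob1 obx by (intro extensionalityI[of _ "{..n}"]) auto
    show "mr = restrict (\<lambda>(i, j). ((C i, C j), x)) (poset_pairs n)"
      using mr(1) mr_eq obx by (intro extensionalityI[of _ "poset_pairs n"]) (auto simp: poset_pairs_def)
  qed
  ultimately show thesis by (rule that)
qed

lemma chain_simplex_in_nerve:
  assumes C: "chain_on P n C" and x: "x \<in> topspace (fibre P Q (C 0))"
  shows "chain_simplex n C x \<in> topspace (nerve (rel_cat P Q) n)"
proof -
  have "x \<in> topspace (fibre P Q (C i))" if "i \<le> n" for i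
    using fibre_antimono[OF chain_on_subset[OF C that] x] .
  then show ?thesis
    using C unfolding nerve_def chain_simplex_def rel_cat_def chain_on_def is_functor_def
    by (auto simp: poset_pairs_def) (meson subsetD)
qed

lemma nerve_op_chain_simplex:
  assumes "simplex_op m n \<theta>"
  shows "nerve_op m \<theta> (chain_simplex n C x) = chain_simplex m (C \<circ> \<theta>) x"
proof -
  have "\<theta> i \<le> n" if "i \<le> m" for i
    using assms that by (auto simp: simplex_op_def)
  moreover have "\<theta> i \<le> \<theta> j" if "i \<le> j" "j \<le> m" for i j
    using assms that by (auto simp: simplex_op_def mono_on_def)
  ultimately show ?thesis
    unfolding nerve_op_def chain_simplex_def
    by (auto simp: poset_pairs_def intro!: restrict_ext)
qed

lemma chain_on_compose: "chain_on P n C \<Longrightarrow> simplex_op m n \<theta> \<Longrightarrow> chain_on P m (C \<circ> \<theta>)"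
  by (auto simp: chain_on_def simplex_op_def mono_on_def image_subset_iff)

lemma simplex_push_in_simplex:
  assumes "simplex_op m n \<theta>" "t \<in> standard_simplex m"
  shows "simplex_push m \<theta> t \<in> standard_simplex n"
proof -
  have nn: "0 \<le> t i" for i using assms(2) by (simp add: standard_simplex_def)
  have \<theta>: "\<theta> i \<le> n" if "i \<le> m" for i
    using assms that by (auto simp: simplex_op_def)
  have "(\<Sum>j\<le>n. simplex_push m \<theta> t j) = (\<Sum>j\<le>n. \<Sum>i | i \<in> {..m} \<and> \<theta> i = j. t i)"
    by (simp add: simplex_push_def)
  also have "\<dots> = sum t {..m}"
    by (rule sum.group) (use \<theta> in auto)
  finally have s: "(\<Sum>j\<le>n. simplex_push m \<theta> t j) = 1"
    using assms(2) by (simp add: standard_simplex_def)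
  have p: "0 \<le> simplex_push m \<theta> t j" for j
    by (auto simp: simplex_push_def nn intro: sum_nonneg)
  have z: "simplex_push m \<theta> t j = 0" if "j > n" for j
    unfolding simplex_push_def using \<theta> that by (intro sum.neutral) force
  have "simplex_push m \<theta> t j \<le> 1" for j
    using member_le_sum[of j "{..n}" "simplex_push m \<theta> t"] p s z[of j] by (cases "j \<le> n") auto
  with s p z show ?thesis by (simp add: standard_simplex_def)
qed

definition barycentre :: "'v set \<Rightarrow> 'v \<Rightarrow> real" where
  "barycentre \<sigma> v = (if v \<in> \<sigma> then 1 / card \<sigma> else 0)"

definition chain_comb :: "nat \<Rightarrow> (nat \<Rightarrow> 'v set) \<Rightarrow> (nat \<Rightarrow> real) \<Rightarrow> 'v \<Rightarrow> real" where
  "chain_comb n C t = (\<lambda>v. \<Sum>i\<le>n. t i * barycentre (C i) v)"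

text \<open>Pushing weights forward corresponds to pulling the chain back: the sum is regrouped
  along the fibres of \<open>\<theta>\<close>. This makes the base coordinate invariant under
  glueing.\<close>

lemma chain_comb_push:
  assumes "simplex_op m n \<theta>"
  shows "chain_comb n C (simplex_push m \<theta> t) = chain_comb m (C \<circ> \<theta>) t"
proof
  fix v
  have \<theta>: "\<theta> i \<le> n" if "i \<le> m" for i
    using assms that by (auto simp: simplex_op_def)
  have "chain_comb n C (simplex_push m \<theta> t) v
      = (\<Sum>j\<le>n. \<Sum>i | i \<in> {..m} \<and> \<theta> i = j. t i * barycentre (C (\<theta> i)) v)"
    unfolding chain_comb_def simplex_push_def sum_distrib_right by (intro sum.cong) auto
  also have "\<dots> = (\<Sum>i\<le>m. t i * barycentre (C (\<theta> i)) v)"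
    by (rule sum.group) (use \<theta> in auto)
  finally show "chain_comb n C (simplex_push m \<theta> t) v = chain_comb m (C \<circ> \<theta>) t v"
    by (simp add: chain_comb_def)
qed

lemma row_complexD: "\<kappa> \<in> row_complex P \<Longrightarrow> finite \<kappa> \<and> \<kappa> \<noteq> {}"
  by (simp add: row_complex_def)

lemma chain_onD:
  assumes "chain_on P n C" "i \<le> n" shows "finite (C i)" "C i \<noteq> {}" "C i \<in> row_complex P"
  using assms by (auto simp: chain_on_def dest: row_complexD)

lemma chain_comb_in_simplex:
  assumes C: "chain_on P n C" and t: "t \<in> standard_simplex n"
  shows "chain_comb n C t \<in> closed_simplex (C 0)"
proof -
  have b: "sum (barycentre (C i)) (C 0) = 1" if "i \<le> n" for i
  proof -
    have "sum (barycentre (C i)) (C 0) = sum (barycentre (C i)) (C i)"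
      using chain_on_subset[OF C that] chain_onD(1)[OF C, of 0]
      by (intro sum.mono_neutral_right) (auto simp: barycentre_def)
    also have "\<dots> = 1" using chain_onD[OF C that] by (simp add: barycentre_def)
    finally show ?thesis .
  qed
  have "(\<Sum>v\<in>C 0. chain_comb n C t v) = (\<Sum>i\<le>n. t i * sum (barycentre (C i)) (C 0))"
    unfolding chain_comb_def sum_distrib_left by (rule sum.swap)
  also have "\<dots> = 1"
    using t b by (simp add: standard_simplex_def)
  finally have "(\<Sum>v\<in>C 0. chain_comb n C t v) = 1" .
  moreover have "0 \<le> chain_comb n C t v" for v
    using t unfolding chain_comb_def barycentre_def standard_simplex_def by (intro sum_nonneg) auto
  moreover have "chain_comb n C t v = 0" if "v \<notin> C 0" for v
    unfolding chain_comb_def using chain_on_subset[OF C] that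
    by (intro sum.neutral) (auto simp: barycentre_def)
  ultimately show ?thesis by (auto simp: closed_simplex_def)
qed

section \<open>Coordinates as invariants of the glueing\<close>

definition chain_point :: "nat \<Rightarrow> (nat \<Rightarrow> 's set) \<Rightarrow> ('t \<Rightarrow> real) \<Rightarrow> (nat \<Rightarrow> real) \<Rightarrow>
    nat \<times> ('s set \<times> ('t \<Rightarrow> real), ('s set \<times> 's set) \<times> ('t \<Rightarrow> real)) nerve_simplex \<times> (nat \<Rightarrow> real)" where
  "chain_point n C x t = (n, chain_simplex n C x, t)"

fun fibre_coord :: "nat \<times> ('s set \<times> ('t \<Rightarrow> real), 'm) nerve_simplex \<times> (nat \<Rightarrow> real) \<Rightarrow> 't \<Rightarrow> real" where
  "fibre_coord (n, (ob, mr), t) = snd (ob 0)"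

fun base_coord :: "nat \<times> ('s set \<times> ('t \<Rightarrow> real), 'm) nerve_simplex \<times> (nat \<Rightarrow> real) \<Rightarrow> 's \<Rightarrow> real" where
  "base_coord (n, (ob, mr), t) = chain_comb n (\<lambda>i. fst (ob i)) t"

lemma fibre_coord_chain_point [simp]: "fibre_coord (chain_point n C x t) = x"
  by (simp add: chain_point_def chain_simplex_def)

lemma base_coord_chain_point [simp]: "base_coord (chain_point n C x t) = chain_comb n C t"
  by (simp add: chain_point_def chain_simplex_def chain_comb_def)

definition realization_point where
  "realization_point P Q p \<longleftrightarrow> (\<exists>n C x t. p = chain_point n C x t \<and> chain_on P n C \<and>
    x \<in> topspace (fibre P Q (C 0)) \<and> t \<in> standard_simplex n)"

abbreviation cat_glue where
  "cat_glue P Q \<equiv> glue_equiv (nerve (rel_cat P Q)) nerve_op"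

abbreviation presheaf_sum where
  "presheaf_sum P Q \<equiv> sum_topology
    (\<lambda>n. prod_topology (nerve (rel_cat P Q) n) (subtopology (powertop_real UNIV) (standard_simplex n))) UNIV"

lemma classifying_space_eq:
  "classifying_space (rel_cat P Q) = quotient_space (presheaf_sum P Q) (cat_glue P Q)"
  by (simp add: classifying_space_def simplicial_realization_def)

lemma realization_point_iff: "p \<in> topspace (presheaf_sum P Q) \<longleftrightarrow> realization_point P Q p"
proof
  assume "p \<in> topspace (presheaf_sum P Q)"
  then obtain n F t where p: "p = (n, F, t)" "F \<in> topspace (nerve (rel_cat P Q) n)" "t \<in> standard_simplex n"
    by auto
  from p(2) obtain C x where "chain_on P n C" "x \<in> topspace (fibre P Q (C 0))" "F = chain_simplex n C x"
    by (rule topspace_nerve_subset)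
  with p show "realization_point P Q p"
    unfolding realization_point_def chain_point_def by blast
next
  assume "realization_point P Q p"
  then show "p \<in> topspace (presheaf_sum P Q)"
    unfolding realization_point_def chain_point_def by (auto intro: chain_simplex_in_nerve)
qed

lemma glue_invariant:
  assumes "(p, q) \<in> glue (nerve (rel_cat P Q)) nerve_op"
  shows "realization_point P Q p" "realization_point P Q q"
    "fibre_coord p = fibre_coord q" "base_coord p = base_coord q"
proof -
  obtain m n \<theta> F t where p: "p = (m, nerve_op m \<theta> F, t)" and q: "q = (n, F, simplex_push m \<theta> t)"
    and op: "simplex_op m n \<theta>" and F: "F \<in> topspace (nerve (rel_cat P Q) n)"
    and t: "t \<in> standard_simplex m"
    using assms by (auto simp: glue_def)
  from F obtain C x where C: "chain_on P n C" and x: "x \<in> topspace (fibre P Q (C 0))"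
    and FC: "F = chain_simplex n C x"
    by (rule topspace_nerve_subset)
  have p': "p = chain_point m (C \<circ> \<theta>) x t" and q': "q = chain_point n C x (simplex_push m \<theta> t)"
    using p q op by (simp_all add: FC nerve_op_chain_simplex chain_point_def)
  \<comment> \<open>\<open>\<theta>\<close> may skip the vertex 0. The chain then starts at a
    smaller set, whose fibre still contains \<open>x\<close>.\<close>
  have "\<theta> 0 \<le> n" using op by (auto simp: simplex_op_def)
  then have "x \<in> topspace (fibre P Q ((C \<circ> \<theta>) 0))"
    using fibre_antimono[OF chain_on_subset[OF C] x] by simp
  then show "realization_point P Q p" "realization_point P Q q"
    unfolding realization_point_def p' q'
    using C x t op chain_on_compose simplex_push_in_simplex by blast+
  show "fibre_coord p = fibre_coord q" "base_coord p = base_coord q"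
    by (simp_all add: p' q' chain_comb_push[OF op])
qed

lemma cat_glue_invariant:
  assumes "(p, q) \<in> cat_glue P Q" "realization_point P Q p"
  shows "realization_point P Q q \<and> fibre_coord q = fibre_coord p \<and> base_coord q = base_coord p"
  using assms(1) unfolding glue_equiv_def
proof (induction rule: rtrancl_induct)
  case base
  then show ?case using assms(2) by simp
next
  case (step y z)
  then show ?case using glue_invariant[of y z P Q] glue_invariant[of z y P Q] by auto
qed

lemma cat_glue_sym: "(p, q) \<in> cat_glue P Q \<Longrightarrow> (q, p) \<in> cat_glue P Q"
  unfolding glue_equiv_def by (meson symD sym_Un_converse sym_rtrancl)

lemma cat_glue_trans: "(p, q) \<in> cat_glue P Q \<Longrightarrow> (q, r) \<in> cat_glue P Q \<Longrightarrow> (p, r) \<in> cat_glue P Q"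
  unfolding glue_equiv_def by (rule rtrancl_trans)

lemma cat_glue_chain_point:
  assumes "chain_on P n C" "x \<in> topspace (fibre P Q (C 0))" "simplex_op m n \<theta>" "t \<in> standard_simplex m"
  shows "(chain_point m (C \<circ> \<theta>) x t, chain_point n C x (simplex_push m \<theta> t)) \<in> cat_glue P Q"
proof -
  have "((m, nerve_op m \<theta> (chain_simplex n C x), t), (n, chain_simplex n C x, simplex_push m \<theta> t))
      \<in> glue (nerve (rel_cat P Q)) nerve_op"
    using assms chain_simplex_in_nerve unfolding glue_def by blast
  then show ?thesis
    unfolding glue_equiv_def chain_point_def nerve_op_chain_simplex[OF assms(3)] by blast
qed

section \<open>Flags of prefixes and their coordinates\<close>

definition flag :: "'v list \<Rightarrow> nat \<Rightarrow> 'v set" where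
  "flag e j = set (take (length e - j) e)"

text \<open>Inverse of \<open>chain_comb (length e - 1) (flag e)\<close>. A prefix contributes its
  weight divided by its length to each of its entries, so its weight is its length times the drop of
  \<open>z\<close> from its last entry to the next one, where 0 is used after the end of
  \<open>e\<close>.\<close>

definition flag_coord :: "'v list \<Rightarrow> ('v \<Rightarrow> real) \<Rightarrow> nat \<Rightarrow> real" where
  "flag_coord e z j = (if j < length e
    then real (length e - j) * (z (e ! (length e - 1 - j)) - (if j = 0 then 0 else z (e ! (length e - j))))
    else 0)"

lemma nth_in_set_take:
  assumes "distinct e" "p < length e"
  shows "e ! p \<in> set (take k e) \<longleftrightarrow> p < k"
proof
  assume "e ! p \<in> set (take k e)"
  then obtain i where "i < k" "i < length e" "e ! i = e ! p" by (auto simp: in_set_conv_nth)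
  then show "p < k" using assms nth_eq_iff_index_eq by metis
next
  assume "p < k"
  then show "e ! p \<in> set (take k e)" using assms by (auto simp: in_set_conv_nth)
qed

lemma card_set_take: "distinct e \<Longrightarrow> k \<le> length e \<Longrightarrow> card (set (take k e)) = k"
  by (simp add: distinct_card)

lemma chain_comb_flag_nth:
  assumes e: "distinct e" and p: "p < length e"
  shows "chain_comb (length e - 1) (flag e) t (e ! p) = (\<Sum>j\<le>length e - 1 - p. t j / real (length e - j))"
proof -
  have "chain_comb (length e - 1) (flag e) t (e ! p)
      = (\<Sum>j\<le>length e - 1. if j \<le> length e - 1 - p then t j / real (length e - j) else 0)"
    unfolding chain_comb_def barycentre_def flag_def
    using p by (intro sum.cong) (auto simp: nth_in_set_take[OF e p] card_set_take[OF e])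
  also have "\<dots> = (\<Sum>j\<le>length e - 1 - p. t j / real (length e - j))"
    by (intro sum.mono_neutral_cong_right) auto
  finally show ?thesis .
qed

lemma flag_coord_chain_comb:
  assumes e: "distinct e" "e \<noteq> []" and t: "\<And>j. j > length e - 1 \<Longrightarrow> t j = 0"
  shows "flag_coord e (chain_comb (length e - 1) (flag e) t) = t"
proof
  fix j
  let ?z = "chain_comb (length e - 1) (flag e) t"
  show "flag_coord e ?z j = t j"
  proof (cases "j < length e")
    case True
    have 1: "?z (e ! (length e - 1 - j)) = (\<Sum>i\<le>j. t i / real (length e - i))"
      using chain_comb_flag_nth[OF e(1), of "length e - 1 - j" t] True by simp
    show ?thesis
    proof (cases j)
      case 0
      then show ?thesis using 1 e(2) by (simp add: flag_coord_def)
    next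
      case (Suc k)
      have "length e - 1 - (length e - j) = k" using True Suc by simp
      then have "?z (e ! (length e - j)) = (\<Sum>i\<le>k. t i / real (length e - i))"
        using chain_comb_flag_nth[OF e(1), of "length e - j" t] True Suc by simp
      then show ?thesis using 1 True Suc by (simp add: flag_coord_def)
    qed
  next
    case False
    then show ?thesis using t[of j] e(2) by (cases e) (auto simp: flag_coord_def)
  qed
qed

lemma chain_comb_flag_coord:
  assumes e: "distinct e" "e \<noteq> []" and z: "\<And>v. v \<notin> set e \<Longrightarrow> z v = 0"
  shows "chain_comb (length e - 1) (flag e) (flag_coord e z) = z"
proof
  fix v
  have tele: "(\<Sum>j\<le>m. flag_coord e z j / real (length e - j)) = z (e ! (length e - 1 - m))"
    if "m < length e" for m
    using that
  proof (induction m)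
    case 0
    then show ?case using e by (simp add: flag_coord_def)
  next
    case (Suc m)
    have "flag_coord e z (Suc m) / real (length e - Suc m) =
        z (e ! (length e - 1 - Suc m)) - z (e ! (length e - 1 - m))"
      using Suc.prems by (simp add: flag_coord_def)
    with Suc show ?case by simp
  qed
  show "chain_comb (length e - 1) (flag e) (flag_coord e z) v = z v"
  proof (cases "v \<in> set e")
    case True
    then obtain p where p: "p < length e" "v = e ! p" by (metis in_set_conv_nth)
    then have "chain_comb (length e - 1) (flag e) (flag_coord e z) v =
        z (e ! (length e - 1 - (length e - 1 - p)))"
      unfolding p(2) chain_comb_flag_nth[OF e(1) p(1)] by (intro tele) simp
    then show ?thesis using p by simp
  next
    case False
    then have "barycentre (flag e i) v = 0" for i
      using set_take_subset[of _ e] by (auto simp: barycentre_def flag_def)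
    then show ?thesis using z[OF False] by (simp add: chain_comb_def)
  qed
qed

text \<open>In a decreasing enumeration an upper level set comes first, so its cardinality
  determines it. A general upward closed \<open>U\<close> covers both bounds in the level sets of
  \<open>level_chain\<close> at once.\<close>

lemma sorted_upper_initial:
  fixes z :: "'v \<Rightarrow> real"
  assumes "distinct e" "sorted_wrt (\<lambda>u v. z v \<le> z u) e" "\<And>a b. U a \<Longrightarrow> a \<le> b \<Longrightarrow> U b"
  shows "{v \<in> set e. U (z v)} = set (take (card {v \<in> set e. U (z v)}) e)"
  using assms(1,2)
proof (induction e)
  case (Cons a e)
  show ?case
  proof (cases "U (z a)")
    case True
    define S where "S = {v \<in> set e. U (z v)}"
    have eq: "{v \<in> set (a # e). U (z v)} = insert a S" using True by (auto simp: S_def)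
    have "S = set (take (card S) e)" using Cons unfolding S_def by simp
    moreover have "card (insert a S) = Suc (card S)" using Cons.prems by (simp add: S_def)
    ultimately show ?thesis unfolding eq by simp
  next
    case False
    then have "{v \<in> set (a # e). U (z v)} = {}"
      using Cons.prems assms(3) by fastforce
    then show ?thesis by (simp only: card.empty take_0 list.set)
  qed
qed simp

lemma chain_flag:
  assumes "distinct e" "e \<noteq> []" "set e \<in> row_complex P"
  shows "chain_on P (length e - 1) (flag e)"
proof -
  have "flag e j \<subseteq> flag e i" if "i \<le> j" for i j
    using that by (simp add: flag_def set_take_subset_set_take)
  moreover have "flag e i \<in> row_complex P" if "i \<le> length e - 1" for i
  proof (rule down_closedD[OF down_closed_row_complex assms(3)])
    show "flag e i \<subseteq> set e" by (simp add: flag_def set_take_subset)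
    have "length e - i \<noteq> 0" using that assms(2) by (cases e) auto
    then show "flag e i \<noteq> {}" using assms(2) by (simp add: flag_def)
  qed
  ultimately show ?thesis by (simp add: chain_on_def)
qed

lemma flag_0 [simp]: "flag e 0 = set e"
  by (simp add: flag_def)

text \<open>A chain of prefixes of \<open>e\<close> is the pullback of the full flag along
  \<open>i \<mapsto> length e - card (D i)\<close>. Its points are therefore glued to points over
  the flag, whose weights can be read off from the base coordinate. So two chains adapted to the
  same \<open>e\<close> give glued points as soon as the coordinates agree.\<close>

lemma chain_point_refine_flag:
  assumes e: "distinct e" "e \<noteq> []" "set e \<in> row_complex P"
    and D: "chain_on P m D" "\<And>i. i \<le> m \<Longrightarrow> D i = set (take (card (D i)) e)"
    and x: "x \<in> topspace (fibre P Q (set e))" and t: "t \<in> standard_simplex m"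
  shows "(chain_point m D x t, chain_point (length e - 1) (flag e) x (flag_coord e (chain_comb m D t)))
      \<in> cat_glue P Q"
    and "flag_coord e (chain_comb m D t) \<in> standard_simplex (length e - 1)"
    and "chain_comb (length e - 1) (flag e) (flag_coord e (chain_comb m D t)) = chain_comb m D t"
proof -
  define \<theta> where "\<theta> i = length e - card (D i)" for i
  have sub: "D i \<subseteq> set e" if "i \<le> m" for i
    using D(2)[OF that] set_take_subset by metis
  have cle: "card (D i) \<le> length e" if "i \<le> m" for i
    using card_mono[OF _ sub[OF that]] distinct_card[OF e(1)] by simp
  have c1: "1 \<le> card (D i)" if "i \<le> m" for i
    using chain_onD[OF D(1) that] by (simp add: Suc_le_eq card_gt_0_iff)
  have "card (D j) \<le> card (D i)" if "i \<le> j" "j \<le> m" for i j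
    using D(1) that chain_onD(1)[OF D(1), of i] unfolding chain_on_def by (intro card_mono) auto
  then have op: "simplex_op m (length e - 1) \<theta>"
    using c1 unfolding simplex_op_def by (auto simp: mono_on_def \<theta>_def intro!: diff_le_mono2)
  have D\<theta>: "flag e (\<theta> i) = D i" if "i \<le> m" for i
    using D(2)[OF that] cle[OF that] by (simp add: flag_def \<theta>_def)
  then have pt: "chain_point m (flag e \<circ> \<theta>) x t = chain_point m D x t"
    unfolding chain_point_def by (auto intro!: chain_simplex_cong)
  let ?s = "simplex_push m \<theta> t"
  have s: "?s \<in> standard_simplex (length e - 1)"
    by (rule simplex_push_in_simplex[OF op t])
  have "chain_comb (length e - 1) (flag e) ?s = chain_comb m D t"
    unfolding chain_comb_push[OF op] by (auto simp: chain_comb_def D\<theta>)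
  moreover have "flag_coord e (chain_comb (length e - 1) (flag e) ?s) = ?s"
    using s by (intro flag_coord_chain_comb[OF e(1,2)]) (simp add: standard_simplex_def)
  ultimately have fc: "flag_coord e (chain_comb m D t) = ?s"
    and cc: "chain_comb (length e - 1) (flag e) ?s = chain_comb m D t" by auto
  show "(chain_point m D x t, chain_point (length e - 1) (flag e) x (flag_coord e (chain_comb m D t)))
      \<in> cat_glue P Q"
    using cat_glue_chain_point[OF chain_flag[OF e] _ op t, of x Q] x by (simp add: pt fc)
  show "flag_coord e (chain_comb m D t) \<in> standard_simplex (length e - 1)"
    using s fc by simp
  show "chain_comb (length e - 1) (flag e) (flag_coord e (chain_comb m D t)) = chain_comb m D t"
    using cc fc by simp
qed

text \<open>List the smallest set first and append the successive differences; the induction splits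
  off the largest set.\<close>

lemma adapted_list_exists:
  assumes "chain_on P n C"
  obtains e where "distinct e" "set e = C 0" "\<And>i. i \<le> n \<Longrightarrow> C i = set (take (card (C i)) e)"
proof -
  have "\<exists>e. distinct e \<and> set e = C 0 \<and> (\<forall>i\<le>n. C i = set (take (card (C i)) e))"
    using assms
  proof (induction n arbitrary: C)
    case 0
    then obtain e where "distinct e" "set e = C 0"
      using chain_onD(1)[OF 0] finite_distinct_list by blast
    then show ?case by (intro exI[of _ e]) (simp add: distinct_card[symmetric])
  next
    case (Suc n)
    have "chain_on P n (\<lambda>i. C (Suc i))" using Suc.prems by (auto simp: chain_on_def)
    from Suc.IH[OF this] obtain e where e: "distinct e" "set e = C 1"
      "\<And>i. i \<le> n \<Longrightarrow> C (Suc i) = set (take (card (C (Suc i))) e)" by auto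
    obtain d where d: "distinct d" "set d = C 0 - C 1"
      using chain_onD(1)[OF Suc.prems, of 0] finite_distinct_list by blast
    have sub: "C 1 \<subseteq> C 0" using chain_on_subset[OF Suc.prems, of 1] by simp
    have de: "distinct (e @ d)" using e(1,2) d by auto
    have se: "set (e @ d) = C 0" using e(2) d(2) sub by auto
    have "C i = set (take (card (C i)) (e @ d))" if "i \<le> Suc n" for i
    proof (cases i)
      case 0
      have "card (C 0) = length (e @ d)" using distinct_card[OF de] se by simp
      then show ?thesis using 0 se by simp
    next
      case (Suc k)
      then have "k \<le> n" using that by simp
      have "card (C (Suc k)) \<le> length e"
        using e(3)[OF \<open>k \<le> n\<close>] set_take_subset[of _ e] card_mono[of "set e" "C (Suc k)"]
          distinct_card[OF e(1)] by (metis List.finite_set)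
      then show ?thesis using e(3)[OF \<open>k \<le> n\<close>] Suc by simp
    qed
    with de se show ?case by blast
  qed
  then show thesis using that by blast
qed

text \<open>Each barycentre is constant on a prefix of \<open>e\<close> and 0 after it, and the
  weights are nonnegative.\<close>

lemma sorted_chain_comb:
  assumes "distinct e" "\<And>i. i \<le> n \<Longrightarrow> C i = set (take (card (C i)) e)" "\<And>i. 0 \<le> t i"
  shows "sorted_wrt (\<lambda>u v. chain_comb n C t v \<le> chain_comb n C t u) e"
  unfolding sorted_wrt_iff_nth_less
proof (intro allI impI)
  fix p q assume pq: "p < q" "q < length e"
  have "barycentre (C i) (e ! q) \<le> barycentre (C i) (e ! p)" if "i \<le> n" for i
  proof -
    have "e ! q \<in> C i \<longrightarrow> e ! p \<in> C i"
      using nth_in_set_take[OF assms(1), of _ "card (C i)"] assms(2)[OF that] pq by simp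
    then show ?thesis by (auto simp: barycentre_def)
  qed
  then show "chain_comb n C t (e ! q) \<le> chain_comb n C t (e ! p)"
    unfolding chain_comb_def by (intro sum_mono mult_left_mono assms(3)) auto
qed

text \<open>Being defined by the values of \<open>z\<close>, the level sets are prefixes of every
  decreasing enumeration of a simplex containing \<open>z\<close>. They can differ from the prefixes
  of \<open>e\<close> where \<open>z\<close> has ties or zeros, but only at indices of weight
  \<open>flag_coord e z i = 0\<close>. The condition \<open>0 < z v\<close> keeps them inside the
  support.\<close>

lemma level_chain:
  fixes e :: "'v list" and z :: "'v \<Rightarrow> real"
  defines "L \<equiv> \<lambda>i. {v. 0 < z v \<and> z (e ! (length e - 1 - i)) \<le> z v}"
  assumes e: "distinct e" "e \<noteq> []" "set e \<in> row_complex P"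
    and sorted: "sorted_wrt (\<lambda>u v. z v \<le> z u) e" and z: "z \<in> closed_simplex (set e)"
  shows "chain_on P (length e - 1) L"
    and "chain_comb (length e - 1) L (flag_coord e z) = z"
proof -
  let ?N = "length e - 1"
  have nn: "0 \<le> z v" for v using z by (simp add: closed_simplex_def)
  have supp: "v \<in> set e" if "0 < z v" for v
    using z that by (force simp: closed_simplex_def)
  have ord: "z (e ! q) \<le> z (e ! p)" if "p \<le> q" "q < length e" for p q
    using sorted that by (cases "p = q") (auto simp: sorted_wrt_iff_nth_less)
  have "L j \<subseteq> L i" if "i \<le> j" "j \<le> ?N" for i j
    using ord[of "?N - j" "?N - i"] that e(2) unfolding L_def by (force simp: Suc_le_eq)
  moreover have "L i \<in> row_complex P" for i
  proof (rule down_closedD[OF down_closed_row_complex e(3)])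
    show "L i \<subseteq> set e" using supp by (auto simp: L_def)
    obtain v where v: "z v > 0" using closed_simplex_nonempty[OF z] nn by (auto simp: less_le)
    show "L i \<noteq> {}"
    proof (cases "0 < z (e ! (?N - i))")
      case True
      then show ?thesis by (auto simp: L_def)
    next
      case False
      then show ?thesis using v by (auto simp: L_def)
    qed
  qed
  ultimately show "chain_on P ?N L" by (simp add: chain_on_def)
  have eq: "L i = flag e i" if i: "i \<le> ?N" "flag_coord e z i \<noteq> 0" for i
  proof -
    have iN: "i < length e" using i e(2) by (cases e) auto
    have "z (e ! (?N - i)) \<noteq> (if i = 0 then 0 else z (e ! (length e - i)))"
      using i(2) iN by (auto simp: flag_coord_def)
    moreover have "(if i = 0 then 0 else z (e ! (length e - i))) \<le> z (e ! (?N - i))"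
    proof (cases "i = 0")
      case False
      then have "z (e ! (length e - i)) \<le> z (e ! (?N - i))"
        using iN by (intro ord) auto
      with False show ?thesis by simp
    qed (simp add: nn)
    \<comment> \<open>A nonzero weight means that \<open>z\<close> drops strictly right after the
      prefix, so the prefix is exactly a level set.\<close>
    ultimately have gap: "(if i = 0 then 0 else z (e ! (length e - i))) < z (e ! (?N - i))"
      by (metis less_le)
    have gap0: "0 < z (e ! (?N - i))"
      by (rule le_less_trans[OF _ gap]) (simp add: nn)
    have mem: "e ! p \<in> L i \<longleftrightarrow> p < length e - i" if p: "p < length e" for p
    proof (cases "p \<le> ?N - i")
      case True
      then have "z (e ! (?N - i)) \<le> z (e ! p)" using ord iN by auto
      then have "e ! p \<in> L i" using gap0 unfolding L_def by auto
      then show ?thesis using True iN by auto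
    next
      case False
      then have ip: "i \<noteq> 0" "length e - i \<le> p" using p iN by auto
      then have "z (e ! p) \<le> z (e ! (length e - i))" using ord p by auto
      then have "z (e ! p) < z (e ! (?N - i))" using gap ip(1) by auto
      then show ?thesis using ip unfolding L_def by auto
    qed
    show ?thesis
    proof (rule Set.set_eqI)
      fix v
      show "v \<in> L i \<longleftrightarrow> v \<in> flag e i"
      proof (cases "v \<in> set e")
        case True
        then obtain p where "p < length e" "v = e ! p" by (metis in_set_conv_nth)
        then show ?thesis using mem nth_in_set_take[OF e(1)] by (simp add: flag_def)
      next
        case False
        then have "v \<notin> flag e i" using set_take_subset[of _ e] by (auto simp: flag_def)
        moreover have "v \<notin> L i" using False supp by (auto simp: L_def)
        ultimately show ?thesis by simp
      qed
    qed
  qed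
  have "chain_comb ?N L (flag_coord e z) = chain_comb ?N (flag e) (flag_coord e z)"
  proof
    fix v
    show "chain_comb ?N L (flag_coord e z) v = chain_comb ?N (flag e) (flag_coord e z) v"
      unfolding chain_comb_def
    proof (rule sum.cong[OF HOL.refl])
      fix i assume "i \<in> {..?N}"
      then show "flag_coord e z i * barycentre (L i) v = flag_coord e z i * barycentre (flag e i) v"
        using eq[of i] by (cases "flag_coord e z i = 0") simp_all
    qed
  qed
  also have "\<dots> = z"
    using z by (intro chain_comb_flag_coord e) (auto simp: closed_simplex_def)
  finally show "chain_comb ?N L (flag_coord e z) = z" .
qed

text \<open>Passing through the chain of level sets of \<open>z\<close>, which is adapted to both enumerations,
  shows that the glueing identifies all points with the same coordinates.\<close>

lemma cat_glue_if_coords_eq: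
  assumes C: "chain_on P n C" "x \<in> topspace (fibre P Q (C 0))" "t \<in> standard_simplex n"
    and C': "chain_on P n' C'" "x \<in> topspace (fibre P Q (C' 0))" "t' \<in> standard_simplex n'"
    and eq: "chain_comb n C t = chain_comb n' C' t'"
  shows "(chain_point n C x t, chain_point n' C' x t') \<in> cat_glue P Q"
proof -
  define z where "z = chain_comb n C t"
  have z': "z = chain_comb n' C' t'" by (simp add: z_def eq)
  obtain e where e: "distinct e" "set e = C 0" "\<And>i. i \<le> n \<Longrightarrow> C i = set (take (card (C i)) e)"
    by (rule adapted_list_exists[OF C(1)]) blast
  obtain e' where e': "distinct e'" "set e' = C' 0" "\<And>i. i \<le> n' \<Longrightarrow> C' i = set (take (card (C' i)) e')"
    by (rule adapted_list_exists[OF C'(1)]) blast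
  have K: "e \<noteq> []" "set e \<in> row_complex P" "e' \<noteq> []" "set e' \<in> row_complex P"
    using chain_onD(2,3)[OF C(1), of 0] chain_onD(2,3)[OF C'(1), of 0] e(2) e'(2) by auto
  have zs: "z \<in> closed_simplex (set e)" "z \<in> closed_simplex (set e')"
    using chain_comb_in_simplex[OF C(1,3)] chain_comb_in_simplex[OF C'(1,3)] e(2) e'(2) z_def z' by auto
  have nn: "0 \<le> t i" "0 \<le> t' i" for i
    using C(3) C'(3) by (auto simp: standard_simplex_def)
  have so1: "sorted_wrt (\<lambda>u v. z v \<le> z u) e"
    unfolding z_def by (rule sorted_chain_comb[OF e(1,3) nn(1)])
  have so2: "sorted_wrt (\<lambda>u v. z v \<le> z u) e'"
    unfolding z' by (rule sorted_chain_comb[OF e'(1,3) nn(2)])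
  let ?N = "length e - 1" and ?N' = "length e' - 1" and ?T = "flag_coord e z"
  define L where "L = (\<lambda>i. {v. 0 < z v \<and> z (e ! (length e - 1 - i)) \<le> z v})"
  note L = level_chain[OF e(1) K(1,2) so1 zs(1), folded L_def]
  have Li: "L i = {v \<in> set d. 0 < z v \<and> z (e ! (length e - 1 - i)) \<le> z v}"
    if "z \<in> closed_simplex (set d)" for i d
    using that by (fastforce simp: L_def closed_simplex_def)
  have Ladapt: "L i = set (take (card (L i)) d)"
    if "z \<in> closed_simplex (set d)" "distinct d" "sorted_wrt (\<lambda>u v. z v \<le> z u) d" for i d
    unfolding Li[OF that(1)] by (rule sorted_upper_initial[OF that(2,3)]) auto
  note r1 = chain_point_refine_flag[OF e(1) K(1,2) C(1) e(3) _ C(3), of x Q, folded z_def]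
  have x: "x \<in> topspace (fibre P Q (set e))" "x \<in> topspace (fibre P Q (set e'))"
    using C(2) C'(2) e(2) e'(2) by auto
  have T: "?T \<in> standard_simplex ?N" using r1(2)[OF _ x(1)] by simp
  note r2 = chain_point_refine_flag[OF e(1) K(1,2) L(1) _ x(1) T, unfolded L(2)]
  note r3 = chain_point_refine_flag[OF e'(1) K(3,4) L(1) _ x(2) T, unfolded L(2)]
  note r4 = chain_point_refine_flag[OF e'(1) K(3,4) C'(1) e'(3) x(2) C'(3), folded z']
  have 1: "(chain_point n C x t, chain_point ?N (flag e) x ?T) \<in> cat_glue P Q"
    using r1(1) x by blast
  have 2: "(chain_point ?N L x ?T, chain_point ?N (flag e) x ?T) \<in> cat_glue P Q"
    using r2(1) Ladapt[OF zs(1) e(1) so1] by blast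
  have 3: "(chain_point ?N L x ?T, chain_point ?N' (flag e') x (flag_coord e' z)) \<in> cat_glue P Q"
    using r3(1) Ladapt[OF zs(2) e'(1) so2] by blast
  have 4: "(chain_point n' C' x t', chain_point ?N' (flag e') x (flag_coord e' z)) \<in> cat_glue P Q"
    using r4(1) by blast
  show ?thesis
    using 1 2 3 4 cat_glue_sym cat_glue_trans by metis
qed

section \<open>Glueing classes and linked pairs of coordinates\<close>

definition coord_class where
  "coord_class P Q x z = {p. realization_point P Q p \<and> fibre_coord p = x \<and> base_coord p = z}"

lemma realization_point_chain_point:
  "chain_on P n C \<Longrightarrow> x \<in> topspace (fibre P Q (C 0)) \<Longrightarrow> t \<in> standard_simplex n \<Longrightarrow>
    realization_point P Q (chain_point n C x t)"
  unfolding realization_point_def by blast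

lemma cat_glue_class:
  assumes "realization_point P Q p"
  shows "cat_glue P Q `` {p} = coord_class P Q (fibre_coord p) (base_coord p)"
proof
  show "cat_glue P Q `` {p} \<subseteq> coord_class P Q (fibre_coord p) (base_coord p)"
    using cat_glue_invariant[OF _ assms] by (auto simp: coord_class_def)
  show "coord_class P Q (fibre_coord p) (base_coord p) \<subseteq> cat_glue P Q `` {p}"
    using assms unfolding coord_class_def realization_point_def
    by clarsimp (metis cat_glue_if_coords_eq)
qed

lemma cat_glue_class_chain_point:
  assumes "chain_on P n C" "x \<in> topspace (fibre P Q (C 0))" "t \<in> standard_simplex n"
  shows "cat_glue P Q `` {chain_point n C x t} = coord_class P Q x (chain_comb n C t)"
  using cat_glue_class[OF realization_point_chain_point[OF assms]] by simp

lemma topspace_classifying_space: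
  "c \<in> topspace (classifying_space (rel_cat P Q)) \<longleftrightarrow>
    (\<exists>n C x t. chain_on P n C \<and> x \<in> topspace (fibre P Q (C 0)) \<and> t \<in> standard_simplex n \<and>
      c = coord_class P Q x (chain_comb n C t))"
proof -
  have "c \<in> topspace (classifying_space (rel_cat P Q)) \<longleftrightarrow>
      (\<exists>p. realization_point P Q p \<and> c = cat_glue P Q `` {p})"
    unfolding classifying_space_eq topspace_quotient_space quotient_def UN_iff singleton_iff Bex_def
      realization_point_iff ..
  also have "\<dots> \<longleftrightarrow> (\<exists>n C x t. chain_on P n C \<and> x \<in> topspace (fibre P Q (C 0)) \<and> t \<in> standard_simplex n \<and>
      c = coord_class P Q x (chain_comb n C t))"
    unfolding realization_point_def by (metis cat_glue_class_chain_point)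
  finally show ?thesis .
qed

text \<open>These are the pairs that occur as coordinates: a chain gives one with
  \<open>\<kappa> = C 0\<close>, and \<open>linked_class_nonempty\<close> is the converse. The same
  \<open>\<kappa>\<close> has to serve both coordinates.\<close>

definition linked where
  "linked P Q x z \<longleftrightarrow> (\<exists>\<kappa>\<in>row_complex P. z \<in> closed_simplex \<kappa> \<and> x \<in> topspace (fibre P Q \<kappa>))"

text \<open>A representative of the class that varies continuously while \<open>e\<close> is fixed:
  order a simplex containing \<open>z\<close> by decreasing weight and use its flag. The order makes
  the weights nonnegative.\<close>

lemma coord_class_flag:
  assumes e: "distinct e" "set e \<in> row_complex P" and so: "sorted_wrt (\<lambda>u v. z v \<le> z u) e"
    and z: "z \<in> closed_simplex (set e)" and x: "x \<in> topspace (fibre P Q (set e))"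
  shows "flag_coord e z \<in> standard_simplex (length e - 1)"
    and "coord_class P Q x z = cat_glue P Q `` {chain_point (length e - 1) (flag e) x (flag_coord e z)}"
proof -
  have ne: "e \<noteq> []" using e(2) by (auto dest: row_complexD)
  let ?t = "flag_coord e z" and ?N = "length e - 1"
  have nn: "0 \<le> z v" for v using z by (simp add: closed_simplex_def)
  have cc: "chain_comb ?N (flag e) ?t = z"
    using z by (intro chain_comb_flag_coord e ne) (auto simp: closed_simplex_def)
  have pos: "0 \<le> ?t j" for j
  proof (cases "j < length e")
    case True
    have "z (e ! (length e - j)) \<le> z (e ! (?N - j))" if "j \<noteq> 0"
    proof -
      have "?N - j < length e - j" "length e - j < length e" using True that by auto
      with so show ?thesis unfolding sorted_wrt_iff_nth_less by blast
    qed
    then show ?thesis using nn by (auto simp: flag_coord_def)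
  qed (simp add: flag_coord_def)
  \<comment> \<open>Every barycentre has total 1, so the weights of the flag have the same total as
    \<open>z\<close>.\<close>
  have "sum z (set e) = (\<Sum>v\<in>set e. \<Sum>i\<le>?N. ?t i * barycentre (flag e i) v)"
    by (subst cc[symmetric]) (simp add: chain_comb_def)
  also have "\<dots> = (\<Sum>i\<le>?N. ?t i * sum (barycentre (flag e i)) (set e))"
    unfolding sum_distrib_left by (rule sum.swap)
  also have "\<dots> = (\<Sum>i\<le>?N. ?t i)"
  proof (rule sum.cong[OF HOL.refl])
    fix i assume i: "i \<in> {..?N}"
    note ch = chain_flag[OF e(1) ne e(2)]
    have "sum (barycentre (flag e i)) (set e) = sum (barycentre (flag e i)) (flag e i)"
      using set_take_subset[of _ e]
      by (intro sum.mono_neutral_right) (auto simp: barycentre_def flag_def)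
    also have "\<dots> = 1" using chain_onD[OF ch, of i] i by (simp add: barycentre_def)
    finally show "?t i * sum (barycentre (flag e i)) (set e) = ?t i" by simp
  qed
  finally have s: "(\<Sum>i\<le>?N. ?t i) = 1" using z by (simp add: closed_simplex_def)
  have z0: "?t j = 0" if "j > ?N" for j using that by (auto simp: flag_coord_def)
  have "?t j \<le> 1" for j
    using member_le_sum[of j "{..?N}" ?t] pos s z0[of j] by (cases "j \<le> ?N") auto
  with s pos z0 show t: "?t \<in> standard_simplex ?N" by (simp add: standard_simplex_def)
  show "coord_class P Q x z = cat_glue P Q `` {chain_point ?N (flag e) x ?t}"
    using cat_glue_class_chain_point[OF chain_flag[OF e(1) ne e(2)] _ t, of x Q] x cc by simp
qed

lemma sorted_list_exists:
  fixes z :: "'v \<Rightarrow> real"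
  assumes "finite S"
  obtains e where "distinct e" "set e = S" "sorted_wrt (\<lambda>u v. z v \<le> z u) e"
proof -
  obtain d where d: "distinct d" "set d = S" using assms finite_distinct_list by blast
  let ?e = "sort_key (\<lambda>v. - z v) d"
  have "sorted (map (\<lambda>v. - z v) ?e)" by simp
  then have "sorted_wrt (\<lambda>u v. z v \<le> z u) ?e" by (simp add: sorted_map)
  with d show thesis by (intro that[of ?e]) simp_all
qed

lemma coord_class_coords:
  "p \<in> coord_class P Q x z \<Longrightarrow> fibre_coord p = x \<and> base_coord p = z"
  by (simp add: coord_class_def)

lemma coord_class_nonempty:
  assumes "chain_on P n C" "x \<in> topspace (fibre P Q (C 0))" "t \<in> standard_simplex n"
  shows "chain_point n C x t \<in> coord_class P Q x (chain_comb n C t)"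
  using realization_point_chain_point[OF assms] by (simp add: coord_class_def)

section \<open>Maps into and out of the classifying space\<close>

lemma compact_space_standard_simplex: "compact_space (top_of_set (standard_simplex n))"
  using compactin_standard_simplex[of n]
  by (simp add: compact_space_subtopology powertop_real_eq)

lemma closed_sorted: "closed {z :: 'v \<Rightarrow> real. sorted_wrt (\<lambda>u v. z v \<le> z u) e}"
proof -
  have "{z :: 'v \<Rightarrow> real. sorted_wrt (\<lambda>u v. z v \<le> z u) e} =
      (\<Inter>i. \<Inter>j\<in>{j. i < j \<and> j < length e}. {z. z (e ! j) \<le> z (e ! i)})"
    by (auto simp: sorted_wrt_iff_nth_less)
  also have "closed \<dots>"
    by (intro closed_INT ballI closed_Collect_le continuous_on_product_coordinates)
  finally show ?thesis .
qed

text \<open>Both coordinates can be placed on their supports, since removing base vertices only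
  enlarges the fibre.\<close>

lemma linked_simplices:
  assumes "linked P Q x z"
  obtains e where "distinct e" "set e = {v. z v \<noteq> 0}" "set e \<in> row_complex P"
    "sorted_wrt (\<lambda>u v. z v \<le> z u) e" "z \<in> closed_simplex (set e)"
    "{v. x v \<noteq> 0} \<in> fibre_complex P Q (set e)" "x \<in> closed_simplex {v. x v \<noteq> 0}"
proof -
  obtain \<kappa> S where \<kappa>: "\<kappa> \<in> row_complex P" "z \<in> closed_simplex \<kappa>"
    and S: "S \<in> fibre_complex P Q \<kappa>" "x \<in> closed_simplex S"
    using assms by (auto simp: linked_def fibre_eq in_realization_iff)
  have sub: "{v. z v \<noteq> 0} \<subseteq> \<kappa>" by (rule closed_simplex_support_subset[OF \<kappa>(2)])
  have fin: "finite {v. z v \<noteq> 0}"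
    using finite_subset[OF sub] \<kappa>(1) by (auto dest: row_complexD)
  obtain e where e: "distinct e" "set e = {v. z v \<noteq> 0}" "sorted_wrt (\<lambda>u v. z v \<le> z u) e"
    by (rule sorted_list_exists[OF fin])
  show thesis
  proof (rule that[OF e(1,2) _ e(3)])
    show "set e \<in> row_complex P"
      unfolding e(2) by (rule down_closedD[OF down_closed_row_complex \<kappa>(1) sub closed_simplex_nonempty[OF \<kappa>(2)]])
    show "z \<in> closed_simplex (set e)"
      unfolding e(2) by (rule closed_simplex_support[OF \<kappa>(2)])
    show "{v. x v \<noteq> 0} \<in> fibre_complex P Q (set e)"
      using down_closedD[OF down_closed_fibre_complex S(1) closed_simplex_support_subset[OF S(2)]
          closed_simplex_nonempty[OF S(2)]] fibre_complex_antimono[of "set e" \<kappa> P Q] sub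
      unfolding e(2) by blast
    show "x \<in> closed_simplex {v. x v \<noteq> 0}"
      by (rule closed_simplex_support[OF S(2)])
  qed
qed

lemma continuous_map_chain_simplex:
  assumes C: "chain_on P n C" and f: "continuous_map X (fibre P Q (C 0)) f"
  shows "continuous_map X (nerve (rel_cat P Q) n) (\<lambda>p. chain_simplex n C (f p))"
proof -
  have into: "f p \<in> topspace (fibre P Q (C 0))" if "p \<in> topspace X" for p
    using f that by (auto dest: continuous_map_funspace)
  have fi: "continuous_map X (fibre P Q (C i)) f" if "i \<le> n" for i
  proof -
    have "continuous_map (fibre P Q (C 0)) (fibre P Q (C i)) (\<lambda>x. x)"
      unfolding fibre_eq
      using fibre_complex_antimono[OF chain_on_subset[OF C that], of P Q]
      by (intro continuous_map_realization continuous_map_closed_simplex_realization) auto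
    from continuous_map_compose[OF f this] show ?thesis by (simp add: o_def)
  qed
  have "continuous_map X (product_topology (\<lambda>_. Ob (rel_cat P Q)) {..n}) (\<lambda>p. restrict (\<lambda>i. (C i, f p)) {..n})"
    unfolding continuous_map_componentwise
  proof (intro conjI ballI)
    fix i assume "i \<in> {..n}"
    then have i: "i \<le> n" "C i \<in> row_complex P" using C by (auto simp: chain_on_def)
    from continuous_map_compose[OF fi[OF i(1)] continuous_map_component_injection[OF i(2), of "fibre P Q"]]
    show "continuous_map X (Ob (rel_cat P Q)) (\<lambda>p. restrict (\<lambda>i. (C i, f p)) {..n} i)"
      using i(1) by (simp add: rel_cat_def o_def)
  qed auto
  moreover have "continuous_map X (product_topology (\<lambda>_. Mor (rel_cat P Q)) (poset_pairs n))
      (\<lambda>p. restrict (\<lambda>(i, j). ((C i, C j), f p)) (poset_pairs n))"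
    unfolding continuous_map_componentwise
  proof (intro conjI ballI)
    fix ij assume ij: "ij \<in> poset_pairs n"
    then obtain i j where [simp]: "ij = (i, j)" and i: "i \<le> j" "j \<le> n" by (auto simp: poset_pairs_def)
    have mem: "(C i, C j) \<in> {(\<sigma>0, \<sigma>1). \<sigma>0 \<in> row_complex P \<and> \<sigma>1 \<in> row_complex P \<and> \<sigma>1 \<subseteq> \<sigma>0}"
      using C i by (simp add: chain_on_def)
    have "continuous_map X ((\<lambda>(\<sigma>0, \<sigma>1). fibre P Q \<sigma>0) (C i, C j)) f" using fi[of i] i by simp
    from continuous_map_compose[OF this continuous_map_component_injection[OF mem, of "\<lambda>(\<sigma>0, \<sigma>1). fibre P Q \<sigma>0"]]
    show "continuous_map X (Mor (rel_cat P Q)) (\<lambda>p. restrict (\<lambda>(i, j). ((C i, C j), f p)) (poset_pairs n) ij)"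
      using ij by (simp add: rel_cat_def o_def)
  qed auto
  ultimately have "continuous_map X (prod_topology (product_topology (\<lambda>_. Ob (rel_cat P Q)) {..n})
      (product_topology (\<lambda>_. Mor (rel_cat P Q)) (poset_pairs n))) (\<lambda>p. chain_simplex n C (f p))"
    unfolding chain_simplex_def by (simp add: continuous_map_pairwise o_def)
  moreover have "is_functor (rel_cat P Q) n (chain_simplex n C (f p))" if "p \<in> topspace X" for p
    using chain_simplex_in_nerve[OF C into[OF that]] by (simp add: nerve_def)
  ultimately show ?thesis
    unfolding nerve_def by (auto simp: continuous_map_in_subtopology)
qed

lemma continuous_on_flag_coord:
  assumes "\<And>v. continuous_on Z (\<lambda>\<zeta>. z \<zeta> v)"
  shows "continuous_on Z (\<lambda>\<zeta>. flag_coord e (z \<zeta>))"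
proof (rule continuous_on_coordinatewise_then_product)
  fix j
  show "continuous_on Z (\<lambda>\<zeta>. flag_coord e (z \<zeta>) j)"
    unfolding flag_coord_def by (cases "j < length e"; cases "j = 0") (auto intro!: continuous_intros assms)
qed

text \<open>Fix a simplex for \<open>x\<close> and an enumeration of a simplex for \<open>z\<close>
  in which \<open>z\<close> decreases. On the region of such parameters the class is represented as
  in \<open>coord_class_flag\<close>, hence continuous. The regions are closed, and the finite sets
  \<open>V\<close> and \<open>W\<close> leave only finitely many of them.\<close>

lemma continuous_map_coord_class:
  fixes x :: "'z::topological_space \<Rightarrow> 't \<Rightarrow> real" and z :: "'z \<Rightarrow> 's \<Rightarrow> real"
  assumes V: "finite V" "\<And>\<zeta>. \<zeta> \<in> Z \<Longrightarrow> {v. x \<zeta> v \<noteq> 0} \<subseteq> V"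
    and W: "finite W" "\<And>\<zeta>. \<zeta> \<in> Z \<Longrightarrow> {v. z \<zeta> v \<noteq> 0} \<subseteq> W"
    and linked: "\<And>\<zeta>. \<zeta> \<in> Z \<Longrightarrow> linked P Q (x \<zeta>) (z \<zeta>)"
    and cont: "\<And>v. continuous_on Z (\<lambda>\<zeta>. x \<zeta> v)" "\<And>v. continuous_on Z (\<lambda>\<zeta>. z \<zeta> v)"
  shows "continuous_map (top_of_set Z) (classifying_space (rel_cat P Q)) (\<lambda>\<zeta>. coord_class P Q (x \<zeta>) (z \<zeta>))"
proof -
  define I where "I = {(S, e). S \<subseteq> V \<and> set e \<subseteq> W \<and> distinct e \<and> set e \<in> row_complex P \<and> S \<in> fibre_complex P Q (set e)}"
  define T where "T = (\<lambda>(S, e). (Z \<inter> x -` closed_simplex S) \<inter> (Z \<inter> z -` closed_simplex (set e)) \<inter>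
    (Z \<inter> z -` {z. sorted_wrt (\<lambda>u v. z v \<le> z u) e}))"
  have xc: "continuous_on Z x" and zc: "continuous_on Z z"
    using cont by (auto intro: continuous_on_coordinatewise_then_product)
  show ?thesis
  proof (rule pasting_lemma_closed[where I = I and T = T and f = "\<lambda>_ \<zeta>. coord_class P Q (x \<zeta>) (z \<zeta>)"])
    have "I \<subseteq> Pow V \<times> {e. set e \<subseteq> W \<and> distinct e}" by (auto simp: I_def)
    then show "finite I"
      using V(1) finite_subset_distinct[OF W(1)] by (meson finite_Pow_iff finite_SigmaI finite_subset)
  next
    fix i assume "i \<in> I"
    show "closedin (top_of_set Z) (T i)"
      unfolding T_def case_prod_unfold
      by (intro closedin_Int continuous_closedin_preimage xc zc closed_closed_simplex closed_sorted)
  next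
    fix i assume i: "i \<in> I"
    obtain S e where [simp]: "i = (S, e)" by (cases i)
    have e: "distinct e" "set e \<in> row_complex P" "S \<in> fibre_complex P Q (set e)" and "S \<subseteq> V"
      using i by (auto simp: I_def)
    have T: "x \<zeta> \<in> closed_simplex S" "z \<zeta> \<in> closed_simplex (set e)"
      "sorted_wrt (\<lambda>u v. z \<zeta> v \<le> z \<zeta> u) e" if "\<zeta> \<in> T i" for \<zeta>
      using that by (auto simp: T_def)
    have TZ: "T i \<subseteq> Z" by (auto simp: T_def)
    have fib: "x \<zeta> \<in> topspace (fibre P Q (set e))" if "\<zeta> \<in> T i" for \<zeta>
      using T(1)[OF that] e(3) by (auto simp: fibre_eq in_realization_iff)
    have ne: "e \<noteq> []" using e(2) by (auto dest: row_complexD)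
    have "continuous_map (top_of_set (T i)) (fibre P Q (flag e 0)) x"
    proof -
      have "continuous_map (top_of_set (T i)) (top_of_set (closed_simplex S)) x"
        using xc TZ T(1) by (auto simp: continuous_map_in_subtopology intro: continuous_on_subset)
      from continuous_map_compose[OF this continuous_map_closed_simplex_realization[OF e(3)]]
      show ?thesis by (simp add: fibre_eq o_def)
    qed
    from continuous_map_chain_simplex[OF chain_flag[OF e(1) ne e(2)] this]
    have 1: "continuous_map (top_of_set (T i)) (nerve (rel_cat P Q) (length e - 1))
        (\<lambda>\<zeta>. chain_simplex (length e - 1) (flag e) (x \<zeta>))" .
    have "continuous_on (T i) (\<lambda>\<zeta>. flag_coord e (z \<zeta>))"
      using TZ by (intro continuous_on_flag_coord continuous_on_subset[OF cont(2)])
    then have 2: "continuous_map (top_of_set (T i)) (subtopology (powertop_real UNIV) (standard_simplex (length e - 1)))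
        (\<lambda>\<zeta>. flag_coord e (z \<zeta>))"
      using coord_class_flag(1)[OF e(1,2) T(3) T(2) fib]
      by (auto simp: continuous_map_in_subtopology powertop_real_eq)
    have "continuous_map (top_of_set (T i)) (presheaf_sum P Q)
        (\<lambda>\<zeta>. (length e - 1, (chain_simplex (length e - 1) (flag e) (x \<zeta>), flag_coord e (z \<zeta>))))"
      using continuous_map_compose[OF _ continuous_map_component_injection[OF UNIV_I],
          of "top_of_set (T i)" "\<lambda>n. prod_topology (nerve (rel_cat P Q) n) (subtopology (powertop_real UNIV) (standard_simplex n))"
            "length e - 1" "\<lambda>\<zeta>. (chain_simplex (length e - 1) (flag e) (x \<zeta>), flag_coord e (z \<zeta>))"] 1 2
      by (simp add: continuous_map_pairwise o_def)
    from continuous_map_compose[OF this quotient_imp_continuous_map[OF quotient_map_quotient_space[of _ "cat_glue P Q"]]]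
    have "continuous_map (top_of_set (T i)) (classifying_space (rel_cat P Q))
        (\<lambda>\<zeta>. cat_glue P Q `` {chain_point (length e - 1) (flag e) (x \<zeta>) (flag_coord e (z \<zeta>))})"
      by (simp add: classifying_space_eq chain_point_def o_def)
    then have "continuous_map (top_of_set (T i)) (classifying_space (rel_cat P Q)) (\<lambda>\<zeta>. coord_class P Q (x \<zeta>) (z \<zeta>))"
      by (rule continuous_map_eq) (use coord_class_flag(2)[OF e(1,2) T(3) T(2) fib] in auto)
    then show "continuous_map (subtopology (top_of_set Z) (T i)) (classifying_space (rel_cat P Q))
        (\<lambda>\<zeta>. coord_class P Q (x \<zeta>) (z \<zeta>))"
      using TZ by (simp add: subtopology_subtopology inf.absorb2)
  next
    fix \<zeta> assume "\<zeta> \<in> topspace (top_of_set Z)"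
    then have \<zeta>: "\<zeta> \<in> Z" by simp
    obtain e where e: "distinct e" "set e = {v. z \<zeta> v \<noteq> 0}" "set e \<in> row_complex P"
      "sorted_wrt (\<lambda>u v. z \<zeta> v \<le> z \<zeta> u) e" "z \<zeta> \<in> closed_simplex (set e)"
      "{v. x \<zeta> v \<noteq> 0} \<in> fibre_complex P Q (set e)" "x \<zeta> \<in> closed_simplex {v. x \<zeta> v \<noteq> 0}"
      by (rule linked_simplices[OF linked[OF \<zeta>]])
    have "({v. x \<zeta> v \<noteq> 0}, e) \<in> I"
      unfolding I_def using e V(2)[OF \<zeta>] W(2)[OF \<zeta>] by simp
    moreover have "\<zeta> \<in> T ({v. x \<zeta> v \<noteq> 0}, e)"
      unfolding T_def using e \<zeta> by simp
    ultimately show "\<exists>j. j \<in> I \<and> \<zeta> \<in> T j \<and> coord_class P Q (x \<zeta>) (z \<zeta>) = coord_class P Q (x \<zeta>) (z \<zeta>)"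
      by blast
  qed simp
qed

text \<open>The index simplices form a discrete set, so the nerve is a disjoint union of open
  pieces, one for each chain \<open>C\<close>, and each piece is parametrized by the fibre over
  \<open>C 0\<close>. There continuity can be tested on closed simplices, because times and weights
  range over a compact space.\<close>

lemma continuous_map_from_nerve_prod:
  assumes h: "\<And>C S. chain_on P n C \<Longrightarrow> S \<in> fibre_complex P Q (C 0) \<Longrightarrow>
      continuous_map (top_of_set ({0..1} \<times> closed_simplex S \<times> standard_simplex n)) Y
        (\<lambda>(s, x, t). h (s, coord_class P Q x (chain_comb n C t)))"
  shows "continuous_map (prod_topology unit_interval
      (prod_topology (nerve (rel_cat P Q) n) (subtopology (powertop_real UNIV) (standard_simplex n)))) Y
      (\<lambda>(s, p). h (s, cat_glue P Q `` {(n, p)}))"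
    (is "continuous_map (prod_topology _ (prod_topology ?N ?D)) Y ?f")
proof -
  define U where "U C = {F \<in> topspace ?N. \<forall>i\<le>n. fst (fst F i) = C i}" for C :: "nat \<Rightarrow> 'a set"
  have proj: "continuous_map ?N (sum_topology (fibre P Q) (row_complex P)) (\<lambda>F. fst F i)" if "i \<le> n" for i
  proof -
    have "continuous_map ?N (product_topology (\<lambda>_. Ob (rel_cat P Q)) {..n}) fst"
      unfolding nerve_def by (intro continuous_map_from_subtopology continuous_map_fst)
    from continuous_map_compose[OF this continuous_map_product_projection[of i]] that
    show ?thesis by (simp add: o_def rel_cat_def)
  qed
  show ?thesis
  proof (rule pasting_lemma[where I = "{C. chain_on P n C}" and f = "\<lambda>_. ?f"
        and T = "\<lambda>C. topspace unit_interval \<times> (U C \<times> topspace ?D)"])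
    fix C assume "C \<in> {C. chain_on P n C}"
    then have C: "chain_on P n C" by simp
    have Umem: "fst F i \<in> {C i} \<times> topspace (fibre P Q (C i))" if F: "F \<in> U C" and i: "i \<le> n" for F i
    proof -
      have "F \<in> topspace ?N" using F by (simp add: U_def)
      from funcset_mem[OF continuous_map_funspace[OF proj[OF i]] this]
      have "fst F i \<in> Sigma (row_complex P) (topspace \<circ> fibre P Q)" by simp
      moreover have "fst (fst F i) = C i" using F i by (simp add: U_def)
      ultimately show ?thesis by (cases "fst F i") simp
    qed
    have "U C = (\<Inter>i\<in>{..n}. {F \<in> topspace ?N. fst F i \<in> {C i} \<times> topspace (fibre P Q (C i))})"
    proof
      show "U C \<subseteq> (\<Inter>i\<in>{..n}. {F \<in> topspace ?N. fst F i \<in> {C i} \<times> topspace (fibre P Q (C i))})"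
      proof (intro subsetI INT_I CollectI conjI)
        fix F i assume "F \<in> U C" "i \<in> {..n}"
        then show "F \<in> topspace ?N" "fst F i \<in> {C i} \<times> topspace (fibre P Q (C i))"
          using Umem by (auto simp: U_def)
      qed
      show "(\<Inter>i\<in>{..n}. {F \<in> topspace ?N. fst F i \<in> {C i} \<times> topspace (fibre P Q (C i))}) \<subseteq> U C"
      proof
        fix F assume F: "F \<in> (\<Inter>i\<in>{..n}. {F \<in> topspace ?N. fst F i \<in> {C i} \<times> topspace (fibre P Q (C i))})"
        then have "F \<in> topspace ?N" by blast
        moreover have "fst (fst F i) = C i" if "i \<le> n" for i
        proof -
          have "fst F i \<in> {C i} \<times> topspace (fibre P Q (C i))" using F that by blast
          then show ?thesis by (simp add: mem_Times_iff)
        qed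
        ultimately show "F \<in> U C" by (simp add: U_def)
      qed
    qed
    moreover have "openin ?N {F \<in> topspace ?N. fst F i \<in> {C i} \<times> topspace (fibre P Q (C i))}" if "i \<le> n" for i
      using openin_continuous_map_preimage[OF proj[OF that] openin_sum_topology_summand[OF chain_onD(3)[OF C that], of "fibre P Q"]] .
    ultimately have opU: "openin ?N (U C)"
      by (auto intro!: openin_INT2)
    show "openin (prod_topology unit_interval (prod_topology ?N ?D)) (topspace unit_interval \<times> (U C \<times> topspace ?D))"
      using opU by (intro openin_prod_Times_iff[THEN iffD2] disjI2 conjI openin_topspace)
    let ?S = "subtopology (prod_topology unit_interval (prod_topology ?N ?D)) (topspace unit_interval \<times> (U C \<times> topspace ?D))"
    have S: "?S = prod_topology unit_interval (prod_topology (subtopology ?N (U C)) ?D)"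
      unfolding prod_topology_subtopology(1)[of ?N "U C" ?D]
        prod_topology_subtopology(2)[of unit_interval "prod_topology ?N ?D"] ..
    \<comment> \<open>The arguments are regrouped so that the compact factors come first, as in
      \<open>continuous_map_prod_realization\<close>.\<close>
    define k where "k = (\<lambda>(q, x). h (fst q, coord_class P Q x (chain_comb n C (snd q))))"
    have "continuous_map (prod_topology (top_of_set ({0..1} \<times> standard_simplex n)) (fibre P Q (C 0))) Y k"
      unfolding fibre_eq
    proof (rule continuous_map_prod_realization)
      show "compact_space (top_of_set ({0..1::real} \<times> standard_simplex n))"
        unfolding prod_topology_subtopology_eu[symmetric] compact_space_prod_topology
        by (simp add: compact_space_standard_simplex compact_space_subtopology)
      fix S assume S: "S \<in> fibre_complex P Q (C 0)"
      have "continuous_map (top_of_set (({0..1} \<times> standard_simplex n) \<times> closed_simplex S))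
          (top_of_set ({0..1::real} \<times> closed_simplex S \<times> standard_simplex n)) (\<lambda>((s, t), x). (s, x, t))"
        by (auto simp: continuous_map_in_subtopology case_prod_unfold
            intro!: continuous_on_Pair continuous_on_fst continuous_on_snd continuous_on_id)
      from continuous_map_compose[OF this h[OF C S]]
      show "continuous_map (prod_topology (top_of_set ({0..1} \<times> standard_simplex n)) (top_of_set (closed_simplex S))) Y k"
        by (simp add: o_def k_def case_prod_unfold)
    qed (simp add: Hausdorff_space_subtopology Hausdorff_space_euclidean)
    moreover have "continuous_map ?S (prod_topology (top_of_set ({0..1} \<times> standard_simplex n)) (fibre P Q (C 0)))
        (\<lambda>p. ((fst p, snd (snd p)), snd (fst (fst (snd p)) 0)))"
    proof -
      have "continuous_map (subtopology ?N (U C)) (subtopology (sum_topology (fibre P Q) (row_complex P)) ({C 0} \<times> topspace (fibre P Q (C 0)))) (\<lambda>F. fst F 0)"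
        unfolding continuous_map_in_subtopology
      proof (intro conjI)
        show "continuous_map (subtopology ?N (U C)) (sum_topology (fibre P Q) (row_complex P)) (\<lambda>F. fst F 0)"
          by (rule continuous_map_from_subtopology[OF proj]) simp
        show "(\<lambda>F. fst F 0) \<in> topspace (subtopology ?N (U C)) \<rightarrow> {C 0} \<times> topspace (fibre P Q (C 0))"
          using Umem[of _ 0] by auto
      qed
      from continuous_map_compose[OF this continuous_map_sum_topology_snd] chain_onD(3)[OF C, of 0]
      have c0: "continuous_map (subtopology ?N (U C)) (fibre P Q (C 0)) (\<lambda>F. snd (fst F 0))"
        by (simp add: o_def)
      have c1: "continuous_map ?S (fibre P Q (C 0)) (\<lambda>p. snd (fst (fst (snd p)) 0))"
        unfolding S using continuous_map_compose[OF continuous_map_compose[OF continuous_map_snd continuous_map_fst] c0, of unit_interval ?D]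
        by (simp add: o_def)
      have c2: "continuous_map ?S unit_interval fst"
        unfolding S by (rule continuous_map_fst)
      have c3: "continuous_map ?S (top_of_set (standard_simplex n)) (\<lambda>p. snd (snd p))"
      proof -
        have "continuous_map ?S ?D (\<lambda>p. snd (snd p))"
          unfolding S using continuous_map_compose[OF continuous_map_snd continuous_map_snd, of unit_interval "subtopology ?N (U C)" ?D]
          by (simp only: o_def)
        then show ?thesis unfolding powertop_real_eq .
      qed
      show ?thesis
        unfolding prod_topology_subtopology_eu[symmetric] continuous_map_pairwise o_def fst_conv snd_conv
        using c1 c2 c3 by blast
    qed
    ultimately have "continuous_map ?S Y (k \<circ> (\<lambda>p. ((fst p, snd (snd p)), snd (fst (fst (snd p)) 0))))"
      by (rule continuous_map_compose[rotated])
    then show "continuous_map ?S Y ?f"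
    proof (rule continuous_map_eq)
      fix p assume "p \<in> topspace ?S"
      then obtain s F t where p: "p = (s, (F, t))" and F: "F \<in> U C" and t: "t \<in> standard_simplex n"
        by auto
      from F have "F \<in> topspace ?N" by (simp add: U_def)
      then obtain C' x where C': "chain_on P n C'" "x \<in> topspace (fibre P Q (C' 0))" "F = chain_simplex n C' x"
        by (rule topspace_nerve_subset)
      have CC': "C' i = C i" if "i \<le> n" for i
        using F that C'(3) by (auto simp: U_def chain_simplex_def)
      have FC: "F = chain_simplex n C x"
        unfolding C'(3) using CC' by (rule chain_simplex_cong)
      have x: "x \<in> topspace (fibre P Q (C 0))" using C'(2) CC'[of 0] by simp
      show "(k \<circ> (\<lambda>p. ((fst p, snd (snd p)), snd (fst (fst (snd p)) 0)))) p = ?f p"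
        using cat_glue_class_chain_point[OF C x t] unfolding p
        by (simp add: k_def FC chain_point_def) (simp add: chain_simplex_def)
    qed
  next
    fix p assume "p \<in> topspace (prod_topology unit_interval (prod_topology ?N ?D))"
    then obtain s F t where p: "p = (s, (F, t))" "s \<in> topspace unit_interval" "F \<in> topspace ?N" "t \<in> topspace ?D"
      by auto
    from p(3) obtain C x where C: "chain_on P n C" "F = chain_simplex n C x"
      by (rule topspace_nerve_subset)
    have "F \<in> U C" using p(3) C(2) by (auto simp: U_def chain_simplex_def)
    with p C show "\<exists>C. C \<in> {C. chain_on P n C} \<and> p \<in> topspace unit_interval \<times> (U C \<times> topspace ?D) \<and> ?f p = ?f p"
      by blast
  qed simp
qed

lemma continuous_map_prod_classifying_space:
  assumes "\<And>n C S. chain_on P n C \<Longrightarrow> S \<in> fibre_complex P Q (C 0) \<Longrightarrow>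
      continuous_map (top_of_set ({0..1} \<times> closed_simplex S \<times> standard_simplex n)) Y
        (\<lambda>(s, x, t). h (s, coord_class P Q x (chain_comb n C t)))"
  shows "continuous_map (prod_topology unit_interval (classifying_space (rel_cat P Q))) Y h"
proof -
  have "compact_space unit_interval" by (simp add: compact_space_subtopology)
  then have "quotient_map (prod_topology unit_interval (presheaf_sum P Q))
      (prod_topology unit_interval (classifying_space (rel_cat P Q))) (\<lambda>(s, p). (s, cat_glue P Q `` {p}))"
    unfolding classifying_space_eq
    by (intro quotient_map_prod_right quotient_map_quotient_space)
       (auto simp: compact_imp_locally_compact_space Hausdorff_space_subtopology Hausdorff_space_euclidean)
  moreover have "continuous_map (prod_topology unit_interval (presheaf_sum P Q)) Y (h \<circ> (\<lambda>(s, p). (s, cat_glue P Q `` {p})))"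
  proof (rule continuous_map_prod_sum_topology)
    fix n :: nat
    show "continuous_map (prod_topology unit_interval
      (prod_topology (nerve (rel_cat P Q) n) (subtopology (powertop_real UNIV) (standard_simplex n)))) Y
      (\<lambda>(s, p). (h \<circ> (\<lambda>(s, p). (s, cat_glue P Q `` {p}))) (s, (n, p)))"
      using continuous_map_from_nerve_prod[OF assms] by (simp add: case_prod_unfold o_def)
  qed
  ultimately show ?thesis by (rule continuous_compose_quotient_map)
qed

text \<open>A map is a homotopy constant in time, restricted to time 0.\<close>

lemma continuous_map_classifying_space:
  assumes "\<And>n C S. chain_on P n C \<Longrightarrow> S \<in> fibre_complex P Q (C 0) \<Longrightarrow>
      continuous_map (top_of_set ({0..1::real} \<times> closed_simplex S \<times> standard_simplex n)) Y
        (\<lambda>(s, x, t). h (coord_class P Q x (chain_comb n C t)))"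
  shows "continuous_map (classifying_space (rel_cat P Q)) Y h"
proof -
  have "continuous_map (prod_topology unit_interval (classifying_space (rel_cat P Q))) Y (\<lambda>p. h (snd p))"
    using assms by (intro continuous_map_prod_classifying_space) simp
  from continuous_map_o_Pair[OF this, of 0] show ?thesis by (simp add: o_def)
qed

section \<open>Pushing a point forward along a random subset of its support\<close>

definition support :: "('v \<Rightarrow> real) \<Rightarrow> 'v set" where
  "support x = {v. x v \<noteq> 0}"

text \<open>As the weights sum to 1, \<open>square_mass x\<close> is at most the largest weight. It serves as a
  continuous substitute for the maximum.\<close>

definition square_mass :: "('v \<Rightarrow> real) \<Rightarrow> real" where
  "square_mass x = (\<Sum>v\<in>support x. (x v)\<^sup>2)"

text \<open>For a point of a simplex, inclusion is certain on the core and impossible off the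
  support; in between, the probability is proportional to the weight.\<close>

definition accept :: "('v \<Rightarrow> real) \<Rightarrow> 'v \<Rightarrow> real" where
  "accept x v = min 1 (2 * x v / square_mass x)"

text \<open>The factor 2 leaves room: some vertex has weight at least \<open>square_mass x\<close>
  and satisfies the inequality strictly, so the excess used in \<open>core_part\<close> has positive
  total. Any factor above 1 would do.\<close>

definition core :: "('v \<Rightarrow> real) \<Rightarrow> 'v set" where
  "core x = {v. square_mass x \<le> 2 * x v}"

text \<open>The law of \<open>\<mu> T\<close>, where \<open>T\<close> contains each vertex \<open>v\<close> independently with probability
  \<open>accept x v\<close>. Such a \<open>T\<close> always satisfies \<open>core x \<subseteq> T \<subseteq> support x\<close>.\<close>

definition random_image :: "('v set \<Rightarrow> 'w) \<Rightarrow> ('v \<Rightarrow> real) \<Rightarrow> 'w \<Rightarrow> real" where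
  "random_image \<mu> x w = (\<Sum>T | T \<in> Pow (support x) \<and> \<mu> T = w.
    (\<Prod>v\<in>T. accept x v) * (\<Prod>v\<in>support x - T. 1 - accept x v))"

text \<open>For a point of a simplex this contains every value of positive probability. It involves
  only the two bounds on \<open>T\<close>, which is the form needed for polar sets.\<close>

definition random_range :: "('v set \<Rightarrow> 'w) \<Rightarrow> ('v \<Rightarrow> real) \<Rightarrow> 'w set" where
  "random_range \<mu> x = \<mu> ` {T. core x \<subseteq> T \<and> T \<subseteq> support x}"

text \<open>The core jumps when a vertex enters it, but the excess of that vertex over the threshold
  is then 0. So the normalized excess is a continuous choice of a point in the simplex on the
  core.\<close>

definition core_part :: "('v \<Rightarrow> real) \<Rightarrow> 'v \<Rightarrow> real" where
  "core_part x v = max 0 (2 * x v - square_mass x) / (\<Sum>v\<in>support x. max 0 (2 * x v - square_mass x))"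

lemma square_mass_eq:
  assumes "finite V" "support x \<subseteq> V" shows "square_mass x = (\<Sum>v\<in>V. (x v)\<^sup>2)"
  unfolding square_mass_def using assms by (intro sum.mono_neutral_left) (auto simp: support_def)

context
  fixes x :: "'v \<Rightarrow> real" and S :: "'v set"
  assumes x: "x \<in> closed_simplex S"
begin

lemma support_finite: "finite (support x)"
  using closed_simplex_support[OF x] closed_simplex_finite unfolding support_def by blast

lemma support_subset: "support x \<subseteq> S"
  unfolding support_def by (rule closed_simplex_support_subset[OF x])

lemma simplex_nonneg: "0 \<le> x v"
  using x by (simp add: closed_simplex_def)

lemma simplex_sum: "sum x (support x) = 1"
  using x by (simp add: closed_simplex_iff support_def)

lemma square_mass_pos: "0 < square_mass x"
  unfolding square_mass_def
proof (rule sum_pos[OF support_finite])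
  show "support x \<noteq> {}" using closed_simplex_nonempty[OF x] by (simp add: support_def)
qed (simp add: support_def)

lemma square_mass_le: "\<exists>v\<in>support x. square_mass x \<le> x v"
proof (rule ccontr)
  assume "\<not> ?thesis"
  then have lt: "x v < square_mass x" if "v \<in> support x" for v using that by force
  have "square_mass x = (\<Sum>v\<in>support x. x v * x v)"
    by (simp add: square_mass_def power2_eq_square)
  also have "\<dots> < (\<Sum>v\<in>support x. x v * square_mass x)"
  proof (rule sum_strict_mono[OF support_finite])
    show "support x \<noteq> {}" using closed_simplex_nonempty[OF x] by (simp add: support_def)
    fix v assume v: "v \<in> support x"
    then have "0 < x v" using simplex_nonneg[of v] by (simp add: support_def)
    then show "x v * x v < x v * square_mass x" using lt[OF v] by simp
  qed
  also have "\<dots> = square_mass x"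
    using simplex_sum by (simp add: sum_distrib_right[symmetric])
  finally show False by simp
qed

lemma core_subset: "core x \<subseteq> support x"
  using square_mass_pos by (auto simp: core_def support_def)

lemma core_nonempty: "core x \<noteq> {}"
proof -
  obtain v where "square_mass x \<le> x v" using square_mass_le by blast
  then have "v \<in> core x" using square_mass_pos by (simp add: core_def)
  then show ?thesis by blast
qed

lemma core_part_in_core: "core_part x \<in> closed_simplex (core x)"
proof -
  let ?b = "\<lambda>v. max 0 (2 * x v - square_mass x)"
  obtain v where "v \<in> support x" "square_mass x \<le> x v" using square_mass_le by blast
  then have "0 < sum ?b (support x)"
    using square_mass_pos by (intro sum_pos2[OF support_finite]) auto
  moreover have "sum ?b (core x) = sum ?b (support x)"
    using core_subset support_finite by (intro sum.mono_neutral_left) (auto simp: core_def)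
  ultimately have "sum (core_part x) (core x) = 1"
    unfolding core_part_def by (simp add: sum_divide_distrib[symmetric])
  moreover have "0 \<le> core_part x v" for v
    unfolding core_part_def by (intro divide_nonneg_nonneg sum_nonneg) auto
  moreover have "core_part x v = 0" if "v \<notin> core x" for v
    using that by (simp add: core_part_def core_def)
  ultimately show ?thesis by (auto simp: closed_simplex_def)
qed

lemma accept_range: "0 \<le> accept x v" "accept x v \<le> 1"
  using simplex_nonneg square_mass_pos by (auto simp: accept_def)

lemma accept_core: "v \<in> core x \<Longrightarrow> accept x v = 1"
  using square_mass_pos by (simp add: accept_def core_def field_simps min_def)

lemma accept_zero: "x v = 0 \<Longrightarrow> accept x v = 0"
  by (simp add: accept_def)

lemma random_range_finite: "finite (random_range \<mu> x)"
  unfolding random_range_def using support_finite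
  by (auto intro: finite_subset[of _ "Pow (support x)"])

lemma random_range_nonempty: "random_range \<mu> x \<noteq> {}"
  unfolding random_range_def using core_subset by auto

text \<open>A subset missing a core vertex has probability 0, because of a factor
  \<open>1 - accept x v = 0\<close>. The probabilities of all subsets add up to the expanded product
  of the factors \<open>accept x v + (1 - accept x v)\<close>.\<close>

lemma random_image_in_range: "random_image \<mu> x \<in> closed_simplex (random_range \<mu> x)"
proof -
  let ?w = "\<lambda>T. (\<Prod>v\<in>T. accept x v) * (\<Prod>v\<in>support x - T. 1 - accept x v)"
  have nn: "0 \<le> ?w T" for T
    using accept_range by (intro mult_nonneg_nonneg prod_nonneg) auto
  have zero: "random_image \<mu> x w = 0" if "w \<notin> random_range \<mu> x" for w
    unfolding random_image_def
  proof (rule sum.neutral, clarify)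
    fix T assume T: "T \<subseteq> support x" "w = \<mu> T"
    then have "\<not> core x \<subseteq> T" using that by (auto simp: random_range_def)
    then obtain v where "v \<in> core x" "v \<notin> T" by blast
    then have "v \<in> support x - T" "1 - accept x v = 0" using core_subset accept_core by auto
    then have "(\<Prod>v\<in>support x - T. 1 - accept x v) = 0"
      using support_finite by (auto intro: prod_zero)
    then show "?w T = 0" by simp
  qed
  have sub: "random_range \<mu> x \<subseteq> \<mu> ` Pow (support x)" by (auto simp: random_range_def)
  have "sum (random_image \<mu> x) (random_range \<mu> x) = sum (random_image \<mu> x) (\<mu> ` Pow (support x))"
    using zero sub support_finite by (intro sum.mono_neutral_left) auto
  also have "\<dots> = (\<Sum>T\<in>Pow (support x). ?w T)"
    unfolding random_image_def by (rule sum.group) (use support_finite in auto)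
  also have "\<dots> = (\<Prod>v\<in>support x. accept x v + (1 - accept x v))"
    by (rule prod_add[symmetric]) (rule support_finite)
  also have "\<dots> = 1" by simp
  finally show ?thesis
    using zero nn by (auto simp: closed_simplex_def random_image_def intro!: sum_nonneg)
qed

lemma random_image_in_simplex: "random_image \<mu> x \<in> closed_simplex (\<mu> ` Pow S)"
proof -
  have "random_range \<mu> x \<subseteq> \<mu> ` Pow S"
    using support_subset by (auto simp: random_range_def)
  moreover have "finite (\<mu> ` Pow S)" using closed_simplex_finite[OF x] by simp
  ultimately show ?thesis using random_image_in_range closed_simplex_mono by blast
qed

text \<open>Vertices outside the support are never accepted, so a fixed finite set can replace the
  support. The index set of the sum then no longer depends on \<open>x\<close>, which is what
  continuity needs.\<close>

lemma random_image_eq: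
  assumes V: "finite V" "support x \<subseteq> V"
  shows "random_image \<mu> x w = (\<Sum>T | T \<in> Pow V \<and> \<mu> T = w. (\<Prod>v\<in>T. accept x v) * (\<Prod>v\<in>V - T. 1 - accept x v))"
  unfolding random_image_def
proof (rule sum.mono_neutral_cong_left)
  show "finite {T. T \<in> Pow V \<and> \<mu> T = w}" using V by simp
  show "{T. T \<in> Pow (support x) \<and> \<mu> T = w} \<subseteq> {T. T \<in> Pow V \<and> \<mu> T = w}" using V by auto
  show "\<forall>T\<in>{T. T \<in> Pow V \<and> \<mu> T = w} - {T. T \<in> Pow (support x) \<and> \<mu> T = w}.
      (\<Prod>v\<in>T. accept x v) * (\<Prod>v\<in>V - T. 1 - accept x v) = 0"
  proof
    fix T assume "T \<in> {T. T \<in> Pow V \<and> \<mu> T = w} - {T. T \<in> Pow (support x) \<and> \<mu> T = w}"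
    then obtain v where "T \<subseteq> V" "v \<in> T" "v \<notin> support x" by auto
    then have "prod (accept x) T = 0"
      using V(1) by (intro prod_zero) (auto intro: finite_subset simp: support_def accept_zero intro!: bexI[of _ v])
    then show "(\<Prod>v\<in>T. accept x v) * (\<Prod>v\<in>V - T. 1 - accept x v) = 0" by simp
  qed
  fix T
  have "(\<Prod>v\<in>support x - T. 1 - accept x v) = (\<Prod>v\<in>V - T. 1 - accept x v)"
    using V by (intro prod.mono_neutral_left) (auto simp: support_def accept_zero)
  then show "(\<Prod>v\<in>T. accept x v) * (\<Prod>v\<in>support x - T. 1 - accept x v)
      = (\<Prod>v\<in>T. accept x v) * (\<Prod>v\<in>V - T. 1 - accept x v)" by simp
qed

lemma core_part_eq:
  assumes V: "finite V" "support x \<subseteq> V"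
  shows "core_part x v = max 0 (2 * x v - square_mass x) / (\<Sum>v\<in>V. max 0 (2 * x v - square_mass x))"
proof -
  have "(\<Sum>v\<in>support x. max 0 (2 * x v - square_mass x)) = (\<Sum>v\<in>V. max 0 (2 * x v - square_mass x))"
    using V square_mass_pos by (intro sum.mono_neutral_left) (auto simp: support_def)
  then show ?thesis by (simp add: core_part_def)
qed

lemma core_part_denominator_pos:
  assumes V: "finite V" "support x \<subseteq> V"
  shows "0 < (\<Sum>v\<in>V. max 0 (2 * x v - square_mass x))"
proof -
  obtain v where "v \<in> support x" "square_mass x \<le> x v" using square_mass_le by blast
  then show ?thesis
    using square_mass_pos V by (intro sum_pos2[OF V(1), of v]) auto
qed

end

context
  fixes f :: "'z::topological_space \<Rightarrow> 'v \<Rightarrow> real" and Z :: "'z set" and V :: "'v set"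
  assumes V: "finite V" and f: "\<And>z. z \<in> Z \<Longrightarrow> f z \<in> closed_simplex V"
    and cont: "\<And>v. continuous_on Z (\<lambda>z. f z v)"
begin

lemma continuous_on_square_mass: "continuous_on Z (\<lambda>z. square_mass (f z))"
proof -
  have "continuous_on Z (\<lambda>z. \<Sum>v\<in>V. (f z v)\<^sup>2)"
    by (intro continuous_intros cont)
  then show ?thesis
    by (rule continuous_on_eq) (rule square_mass_eq[OF V support_subset[OF f], symmetric])
qed

lemma continuous_on_accept: "continuous_on Z (\<lambda>z. accept (f z) v)"
  unfolding accept_def using square_mass_pos[OF f]
  by (intro continuous_intros cont continuous_on_square_mass) (force)

lemma continuous_on_random_image: "continuous_on Z (\<lambda>z. random_image \<mu> (f z) w)"
proof -
  have "continuous_on Z (\<lambda>z. \<Sum>T | T \<in> Pow V \<and> \<mu> T = w.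
      (\<Prod>v\<in>T. accept (f z) v) * (\<Prod>v\<in>V - T. 1 - accept (f z) v))"
    by (intro continuous_intros continuous_on_accept)
  then show ?thesis
    by (rule continuous_on_eq) (rule random_image_eq[OF f V support_subset[OF f], symmetric])
qed

lemma continuous_on_core_part: "continuous_on Z (\<lambda>z. core_part (f z) v)"
proof -
  have "continuous_on Z (\<lambda>z. max 0 (2 * f z v - square_mass (f z)) /
      (\<Sum>v\<in>V. max 0 (2 * f z v - square_mass (f z))))"
    using core_part_denominator_pos[OF f V support_subset[OF f]]
    by (intro continuous_intros cont continuous_on_square_mass) (force)
  then show ?thesis
    by (rule continuous_on_eq) (rule core_part_eq[OF f V support_subset[OF f], symmetric])
qed

end

lemma closed_simplex_convex:
  assumes "x \<in> closed_simplex S" "y \<in> closed_simplex S" "s \<in> {0..1}"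
  shows "(\<lambda>v. (1 - s) * x v + s * y v) \<in> closed_simplex S"
proof -
  have "x v = 0 \<and> y v = 0" if "v \<notin> S" for v
    using assms(1,2) that unfolding closed_simplex_iff by blast
  then have "(1 - s) * x v + s * y v = 0" if "v \<notin> S" for v using that by simp
  then have "{v. (1 - s) * x v + s * y v \<noteq> 0} \<subseteq> S" by blast
  moreover have "0 \<le> (1 - s) * x v + s * y v" for v
    using assms by (auto simp: closed_simplex_def)
  moreover have "(\<Sum>v\<in>S. (1 - s) * x v + s * y v) = 1"
    using assms by (simp add: closed_simplex_def sum.distrib sum_distrib_left[symmetric])
  ultimately show ?thesis by (simp add: closed_simplex_def)
qed

lemma closed_simplex_convex_Un:
  assumes "x \<in> closed_simplex S" "y \<in> closed_simplex T" "s \<in> {0..1}"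
  shows "(\<lambda>v. (1 - s) * x v + s * y v) \<in> closed_simplex (S \<union> T)"
proof (rule closed_simplex_convex[OF _ _ assms(3)])
  have fin: "finite (S \<union> T)"
    using closed_simplex_finite[OF assms(1)] closed_simplex_finite[OF assms(2)] by simp
  show "x \<in> closed_simplex (S \<union> T)"
    by (rule subsetD[OF closed_simplex_mono[OF Un_upper1 fin] assms(1)])
  show "y \<in> closed_simplex (S \<union> T)"
    by (rule subsetD[OF closed_simplex_mono[OF Un_upper2 fin] assms(2)])
qed

section \<open>Polar sets of a relation\<close>

definition row_polar :: "('i, 'j) relation \<Rightarrow> 'j set set \<Rightarrow> 'i set" where
  "row_polar A S = {i \<in> rows A. \<forall>\<tau>\<in>S. \<forall>j\<in>\<tau>. holds A i j}"

definition col_polar :: "('i, 'j) relation \<Rightarrow> 'i set set \<Rightarrow> 'j set" where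
  "col_polar A X = {j \<in> cols A. \<forall>\<sigma>\<in>X. \<forall>i\<in>\<sigma>. holds A i j}"

abbreviation multi_fibre :: "('i, 'j) relation \<Rightarrow> nat \<Rightarrow> nat \<Rightarrow> 'i set set \<Rightarrow> 'j set set set" where
  "multi_fibre A k l \<equiv> fibre_complex (multi_rel A k 1) (transp_rel (multi_rel A k l))"

lemma subsets_ge_mono: "\<sigma> \<in> subsets_ge n R \<Longrightarrow> \<sigma> \<subseteq> \<sigma>' \<Longrightarrow> \<sigma>' \<subseteq> R \<Longrightarrow> \<sigma>' \<in> subsets_ge n R"
  unfolding subsets_ge_def mem_Collect_eq
  by (meson card_mono finite_subset order_trans)

lemma subsets_ge_le: "m \<le> n \<Longrightarrow> subsets_ge n R \<subseteq> subsets_ge m R"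
  by (auto simp: subsets_ge_def)

lemma subsets_ge_subset: "\<sigma> \<in> subsets_ge n R \<Longrightarrow> \<sigma> \<subseteq> R"
  by (simp add: subsets_ge_def)

lemma row_polar_subset: "row_polar A S \<subseteq> rows A"
  by (auto simp: row_polar_def)

lemma col_polar_subset: "col_polar A X \<subseteq> cols A"
  by (auto simp: col_polar_def)

text \<open>Having at least \<open>k\<close> elements is preserved under enlargement, so it suffices
  to test the largest possible witness, the polar set.\<close>

lemma multi_complex_iff:
  "X \<in> row_complex (multi_rel A k l) \<longleftrightarrow>
    X \<noteq> {} \<and> finite X \<and> X \<subseteq> subsets_ge l (rows A) \<and> col_polar A X \<in> subsets_ge k (cols A)"
proof -
  have "(\<exists>\<tau>\<in>subsets_ge k (cols A). \<forall>\<sigma>\<in>X. \<forall>i\<in>\<sigma>. \<forall>j\<in>\<tau>. holds A i j) \<longleftrightarrow>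
      col_polar A X \<in> subsets_ge k (cols A)"
  proof
    assume "\<exists>\<tau>\<in>subsets_ge k (cols A). \<forall>\<sigma>\<in>X. \<forall>i\<in>\<sigma>. \<forall>j\<in>\<tau>. holds A i j"
    then obtain \<tau> where \<tau>: "\<tau> \<in> subsets_ge k (cols A)" "\<forall>\<sigma>\<in>X. \<forall>i\<in>\<sigma>. \<forall>j\<in>\<tau>. holds A i j" by blast
    then have "\<tau> \<subseteq> col_polar A X" using subsets_ge_subset by (fastforce simp: col_polar_def)
    then show "col_polar A X \<in> subsets_ge k (cols A)"
      by (rule subsets_ge_mono[OF \<tau>(1) _ col_polar_subset])
  next
    assume "col_polar A X \<in> subsets_ge k (cols A)"
    then show "\<exists>\<tau>\<in>subsets_ge k (cols A). \<forall>\<sigma>\<in>X. \<forall>i\<in>\<sigma>. \<forall>j\<in>\<tau>. holds A i j"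
      by (rule bexI[rotated]) (simp add: col_polar_def)
  qed
  then show ?thesis unfolding row_complex_def multi_rel_def by simp
qed

text \<open>The same reduction for the transposed relation; the condition relating \<open>S\<close>
  and \<open>X\<close> comes from \<open>common_cols\<close>.\<close>

lemma multi_fibre_iff:
  "S \<in> multi_fibre A k l X \<longleftrightarrow>
    S \<noteq> {} \<and> finite S \<and> S \<subseteq> subsets_ge k (cols A) \<and>
    (\<forall>\<tau>\<in>S. \<forall>\<sigma>\<in>X. \<forall>i\<in>\<sigma>. \<forall>j\<in>\<tau>. holds A i j) \<and> row_polar A S \<in> subsets_ge l (rows A)"
proof -
  have "(\<exists>\<sigma>\<in>subsets_ge l (rows A). \<forall>\<tau>\<in>S. \<forall>i\<in>\<sigma>. \<forall>j\<in>\<tau>. holds A i j) \<longleftrightarrow>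
      row_polar A S \<in> subsets_ge l (rows A)"
  proof
    assume "\<exists>\<sigma>\<in>subsets_ge l (rows A). \<forall>\<tau>\<in>S. \<forall>i\<in>\<sigma>. \<forall>j\<in>\<tau>. holds A i j"
    then obtain \<sigma> where \<sigma>: "\<sigma> \<in> subsets_ge l (rows A)" "\<forall>\<tau>\<in>S. \<forall>i\<in>\<sigma>. \<forall>j\<in>\<tau>. holds A i j" by blast
    then have "\<sigma> \<subseteq> row_polar A S" using subsets_ge_subset by (fastforce simp: row_polar_def)
    then show "row_polar A S \<in> subsets_ge l (rows A)"
      by (rule subsets_ge_mono[OF \<sigma>(1) _ row_polar_subset])
  next
    assume "row_polar A S \<in> subsets_ge l (rows A)"
    then show "\<exists>\<sigma>\<in>subsets_ge l (rows A). \<forall>\<tau>\<in>S. \<forall>i\<in>\<sigma>. \<forall>j\<in>\<tau>. holds A i j"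
      by (rule bexI[rotated]) (simp add: row_polar_def)
  qed
  then show ?thesis
    unfolding fibre_complex_def row_complex_def multi_rel_def transp_rel_def common_cols_def
    by (auto simp: subset_iff)
qed

section \<open>From the row complex to the category\<close>

context
  fixes A :: "('i, 'j) relation" and k l :: nat and X :: "'i set set" and w :: "'i set \<Rightarrow> real"
  assumes l: "1 \<le> l" and X: "X \<in> row_complex (multi_rel A k l)" and w: "w \<in> closed_simplex X"
begin

text \<open>Polar maps reverse inclusion: the bound of the random set by the support makes
  \<open>\<tau>\<close> large, and its containing the core makes \<open>\<tau>\<close> related to
  the core.\<close>

lemma col_range_element:
  assumes "\<tau> \<in> random_range (col_polar A) w"
  shows "\<tau> \<in> subsets_ge k (cols A)" "col_polar A X \<subseteq> \<tau>"
    "\<sigma> \<in> core w \<Longrightarrow> i \<in> \<sigma> \<Longrightarrow> j \<in> \<tau> \<Longrightarrow> holds A i j"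
proof -
  obtain T where T: "core w \<subseteq> T" "T \<subseteq> support w" "\<tau> = col_polar A T"
    using assms by (auto simp: random_range_def)
  show "col_polar A X \<subseteq> \<tau>"
    using T(2) support_subset[OF w] unfolding T(3) by (auto simp: col_polar_def)
  moreover have "col_polar A X \<in> subsets_ge k (cols A)"
    using X by (simp add: multi_complex_iff)
  ultimately show "\<tau> \<in> subsets_ge k (cols A)"
    unfolding T(3) by (rule subsets_ge_mono[OF _ _ col_polar_subset, rotated])
  show "\<sigma> \<in> core w \<Longrightarrow> i \<in> \<sigma> \<Longrightarrow> j \<in> \<tau> \<Longrightarrow> holds A i j"
    using T by (auto simp: col_polar_def)
qed

lemma core_in_multi_complex: "core w \<in> row_complex (multi_rel A k 1)"
proof -
  have sub: "core w \<subseteq> X" using core_subset[OF w] support_subset[OF w] by blast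
  have "core w \<in> row_complex (multi_rel A k l)"
    by (rule down_closedD[OF down_closed_row_complex X sub core_nonempty[OF w]])
  then show ?thesis
    using subsets_ge_le[OF l] unfolding multi_complex_iff by blast
qed

text \<open>A single member of the core is related to the whole range and already has at least
  \<open>l\<close> elements.\<close>

lemma row_polar_col_range: "row_polar A (random_range (col_polar A) w) \<in> subsets_ge l (rows A)"
proof -
  obtain \<sigma> where \<sigma>: "\<sigma> \<in> core w" using core_nonempty[OF w] by blast
  then have "\<sigma> \<in> X" using core_subset[OF w] support_subset[OF w] by blast
  then have s: "\<sigma> \<in> subsets_ge l (rows A)"
    using X by (auto simp: multi_complex_iff)
  have "\<sigma> \<subseteq> row_polar A (random_range (col_polar A) w)"
  proof
    fix i assume i: "i \<in> \<sigma>"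
    have "holds A i j" if "\<tau> \<in> random_range (col_polar A) w" "j \<in> \<tau>" for \<tau> j
      by (rule col_range_element(3)[OF that(1) \<sigma> i that(2)])
    then show "i \<in> row_polar A (random_range (col_polar A) w)"
      using subsetD[OF subsets_ge_subset[OF s] i] by (simp add: row_polar_def)
  qed
  then show ?thesis by (rule subsets_ge_mono[OF s _ row_polar_subset])
qed

text \<open>\<open>Y\<close> is kept general for two uses: the core alone for
  \<open>row_to_cat\<close>, and the core together with an old base simplex for the homotopy that
  moves the base coordinate.\<close>

lemma col_range_in_fibre:
  assumes "\<And>\<tau> \<sigma> i j. \<tau> \<in> random_range (col_polar A) w \<Longrightarrow> \<sigma> \<in> Y \<Longrightarrow> i \<in> \<sigma> \<Longrightarrow> j \<in> \<tau> \<Longrightarrow> holds A i j"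
  shows "random_range (col_polar A) w \<in> multi_fibre A k l Y"
  unfolding multi_fibre_iff
proof (intro conjI ballI)
  show "random_range (col_polar A) w \<subseteq> subsets_ge k (cols A)"
    by (rule subsetI) (rule col_range_element(1))
qed (rule random_range_nonempty[OF w] random_range_finite[OF w] row_polar_col_range assms; assumption)+

text \<open>The point \<open>w\<close> and its image under the two polar maps lie in a common simplex, because both
  are related to \<open>col_polar A X\<close>.\<close>

lemma row_col_range_Un:
  assumes y: "y \<in> closed_simplex (random_range (col_polar A) w)"
  shows "random_range (row_polar A) y \<union> X \<in> row_complex (multi_rel A k l)"
proof -
  let ?R = "random_range (row_polar A) y"
  have el: "\<sigma> \<in> subsets_ge l (rows A) \<and> (\<forall>i\<in>\<sigma>. \<forall>j\<in>col_polar A X. holds A i j)" if \<sigma>: "\<sigma> \<in> ?R" for \<sigma>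
  proof -
    obtain Y where Y: "core y \<subseteq> Y" "Y \<subseteq> support y" "\<sigma> = row_polar A Y"
      using \<sigma> by (auto simp: random_range_def)
    have sub: "Y \<subseteq> random_range (col_polar A) w" using Y(2) support_subset[OF y] by blast
    have "row_polar A (random_range (col_polar A) w) \<subseteq> \<sigma>"
      unfolding Y(3) using sub by (auto simp: row_polar_def)
    then have 1: "\<sigma> \<in> subsets_ge l (rows A)"
      unfolding Y(3) by (rule subsets_ge_mono[OF row_polar_col_range _ row_polar_subset])
    obtain \<tau> where \<tau>: "\<tau> \<in> Y" using Y(1) core_nonempty[OF y] by blast
    then have "col_polar A X \<subseteq> \<tau>" using sub col_range_element(2) by blast
    then have "\<forall>i\<in>\<sigma>. \<forall>j\<in>col_polar A X. holds A i j"
      unfolding Y(3) row_polar_def using \<tau> by blast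
    with 1 show ?thesis by blast
  qed
  have "col_polar A (?R \<union> X) = col_polar A X"
    using el unfolding col_polar_def by blast
  then show ?thesis
    using X el random_range_finite[OF y] unfolding multi_complex_iff by auto
qed

end

section \<open>From the category to the row complex and back\<close>

context
  fixes A :: "('i, 'j) relation" and k l :: nat and Y :: "'i set set" and S :: "'j set set"
    and x :: "'j set \<Rightarrow> real"
  assumes Y: "Y \<in> row_complex (multi_rel A k 1)" and S: "S \<in> multi_fibre A k l Y"
    and x: "x \<in> closed_simplex S"
begin

lemma row_range_element:
  assumes "\<sigma> \<in> random_range (row_polar A) x"
  shows "row_polar A S \<subseteq> \<sigma>" "\<sigma> \<in> subsets_ge l (rows A)"
    "\<tau> \<in> core x \<Longrightarrow> i \<in> \<sigma> \<Longrightarrow> j \<in> \<tau> \<Longrightarrow> holds A i j"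
proof -
  obtain T where T: "core x \<subseteq> T" "T \<subseteq> support x" "\<sigma> = row_polar A T"
    using assms by (auto simp: random_range_def)
  show "row_polar A S \<subseteq> \<sigma>"
    using T(2) support_subset[OF x] unfolding T(3) by (auto simp: row_polar_def)
  moreover have "row_polar A S \<in> subsets_ge l (rows A)"
    using S unfolding multi_fibre_iff by (elim conjE)
  ultimately show "\<sigma> \<in> subsets_ge l (rows A)"
    unfolding T(3) by (rule subsets_ge_mono[OF _ _ row_polar_subset, rotated])
  show "\<tau> \<in> core x \<Longrightarrow> i \<in> \<sigma> \<Longrightarrow> j \<in> \<tau> \<Longrightarrow> holds A i j"
    using T by (auto simp: row_polar_def)
qed

text \<open>One member of \<open>core x\<close> is a common witness for all sets in the range. This
  is why \<open>cat_to_row\<close> takes values in the row complex.\<close>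

lemma row_range_in_complex: "random_range (row_polar A) x \<in> row_complex (multi_rel A k l)"
proof -
  obtain \<tau> where \<tau>: "\<tau> \<in> core x" using core_nonempty[OF x] by blast
  then have "\<tau> \<in> S" using core_subset[OF x] support_subset[OF x] by blast
  then have t: "\<tau> \<in> subsets_ge k (cols A)"
    using S unfolding multi_fibre_iff by (elim conjE) (rule subsetD)
  have "\<tau> \<subseteq> col_polar A (random_range (row_polar A) x)"
  proof
    fix j assume j: "j \<in> \<tau>"
    have "holds A i j" if "\<sigma> \<in> random_range (row_polar A) x" "i \<in> \<sigma>" for \<sigma> i
      by (rule row_range_element(3)[OF that(1) \<tau> that(2) j])
    then show "j \<in> col_polar A (random_range (row_polar A) x)"
      using subsetD[OF subsets_ge_subset[OF t] j] by (simp add: col_polar_def)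
  qed
  then have "col_polar A (random_range (row_polar A) x) \<in> subsets_ge k (cols A)"
    by (rule subsets_ge_mono[OF t _ col_polar_subset])
  then show ?thesis
    unfolding multi_complex_iff
    using random_range_nonempty[OF x] random_range_finite[OF x] row_range_element(2) by blast
qed

context
  fixes y :: "'i set \<Rightarrow> real"
  assumes l: "1 \<le> l" and y: "y \<in> closed_simplex (random_range (row_polar A) x)"
begin

text \<open>All sets of the first range contain \<open>row_polar A S\<close>, and the second random
  set has a member because the core of \<open>y\<close> is nonempty. So after both polar maps the
  relation to \<open>row_polar A S\<close> survives; the homotopies depend on this.\<close>

lemma col_row_range_related:
  assumes "\<tau> \<in> random_range (col_polar A) y" "i \<in> row_polar A S" "j \<in> \<tau>"
  shows "holds A i j"
proof -
  obtain T where T: "core y \<subseteq> T" "T \<subseteq> support y" "\<tau> = col_polar A T"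
    using assms(1) by (auto simp: random_range_def)
  obtain \<sigma> where \<sigma>: "\<sigma> \<in> T" using core_nonempty[OF y] T(1) by blast
  then have "row_polar A S \<subseteq> \<sigma>"
    using T(2) support_subset[OF y] row_range_element(1) by blast
  then show ?thesis using assms(2,3) \<sigma> unfolding T(3) col_polar_def by blast
qed

lemma base_subset_row_polar: "\<sigma> \<in> Y \<Longrightarrow> \<sigma> \<subseteq> row_polar A S"
proof
  fix i assume i: "\<sigma> \<in> Y" "i \<in> \<sigma>"
  have "Y \<subseteq> subsets_ge 1 (rows A)" using Y unfolding multi_complex_iff by (elim conjE)
  then have "i \<in> rows A" using i subsets_ge_subset by blast
  moreover have "\<forall>\<tau>\<in>S. \<forall>\<sigma>\<in>Y. \<forall>i\<in>\<sigma>. \<forall>j\<in>\<tau>. holds A i j"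
    using S unfolding multi_fibre_iff by (elim conjE)
  ultimately show "i \<in> row_polar A S" using i by (simp add: row_polar_def)
qed

text \<open>The added sets are related to all of \<open>row_polar A S\<close>, so this polar set
  does not shrink. The fibre coordinate can thus be contracted over a fixed base simplex.\<close>

lemma col_row_range_Un: "random_range (col_polar A) y \<union> S \<in> multi_fibre A k l Y"
proof -
  let ?R = "random_range (col_polar A) y"
  have "row_polar A (?R \<union> S) = row_polar A S"
    using col_row_range_related unfolding row_polar_def by blast
  moreover have "?R \<subseteq> subsets_ge k (cols A)"
    using col_range_element(1)[OF l row_range_in_complex y] by blast
  moreover have "\<forall>\<tau>\<in>?R. \<forall>\<sigma>\<in>Y. \<forall>i\<in>\<sigma>. \<forall>j\<in>\<tau>. holds A i j"
    using col_row_range_related base_subset_row_polar by blast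
  ultimately show ?thesis
    using S random_range_finite[OF y] unfolding multi_fibre_iff by (simp add: ball_Un)
qed

text \<open>After the contraction the fibre coordinate lies over the old base simplex and the new
  one at once, so the base coordinate can move on a straight line.\<close>

lemma col_row_range_core:
  "random_range (col_polar A) y \<in> multi_fibre A k l (Y \<union> core y)"
proof (rule col_range_in_fibre[OF l row_range_in_complex y])
  fix \<tau> \<sigma> i j assume a: "\<tau> \<in> random_range (col_polar A) y" "\<sigma> \<in> Y \<union> core y" "i \<in> \<sigma>" "j \<in> \<tau>"
  show "holds A i j"
  proof (cases "\<sigma> \<in> Y")
    case True
    then show ?thesis using a col_row_range_related base_subset_row_polar by blast
  next
    case False
    then show ?thesis using a col_range_element(3)[OF l row_range_in_complex y] by blast
  qed
qed

lemma base_Un_core: "Y \<union> core y \<in> row_complex (multi_rel A k 1)"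
proof -
  let ?R = "random_range (col_polar A) y"
  note c = core_in_multi_complex[OF l row_range_in_complex y]
  obtain \<tau> where \<tau>: "\<tau> \<in> ?R" using random_range_nonempty[OF y, of "col_polar A"] by blast
  have t: "\<tau> \<in> subsets_ge k (cols A)" by (rule col_range_element(1)[OF l row_range_in_complex y \<tau>])
  have "\<tau> \<subseteq> col_polar A (Y \<union> core y)"
  proof
    fix j assume j: "j \<in> \<tau>"
    have "\<forall>\<tau>\<in>?R. \<forall>\<sigma>\<in>Y \<union> core y. \<forall>i\<in>\<sigma>. \<forall>j\<in>\<tau>. holds A i j"
      using col_row_range_core unfolding multi_fibre_iff by (elim conjE)
    then show "j \<in> col_polar A (Y \<union> core y)"
      using \<tau> j subsetD[OF subsets_ge_subset[OF t] j] by (simp add: col_polar_def)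
  qed
  then have "col_polar A (Y \<union> core y) \<in> subsets_ge k (cols A)"
    by (rule subsets_ge_mono[OF t _ col_polar_subset])
  then show ?thesis using Y c unfolding multi_complex_iff by simp
qed

end

end

section \<open>The comparison map\<close>

lemma homotopic_withI:
  assumes "continuous_map (prod_topology unit_interval X) Y h"
    and "\<And>x. x \<in> topspace X \<Longrightarrow> h (0, x) = f x"
    and "\<And>x. x \<in> topspace X \<Longrightarrow> h (1, x) = g x"
  shows "homotopic_with (\<lambda>_. True) X Y f g"
  using assms by (subst homotopic_with) auto

abbreviation multi_class where
  "multi_class A k l \<equiv> coord_class (multi_rel A k 1) (transp_rel (multi_rel A k l))"

abbreviation multi_linked where
  "multi_linked A k l \<equiv> linked (multi_rel A k 1) (transp_rel (multi_rel A k l))"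

abbreviation polar_image where
  "polar_image A x \<equiv> random_image (row_polar A) x"

abbreviation copolar_image where
  "copolar_image A w \<equiv> random_image (col_polar A) w"

text \<open>The coordinates are constant on a glueing class, so every choice gives the same value;
  see \<open>class_coords\<close>.\<close>

definition class_fibre_coord where
  "class_fibre_coord c = fibre_coord (SOME p. p \<in> c)"

definition class_base_coord where
  "class_base_coord c = base_coord (SOME p. p \<in> c)"

definition cat_to_row where
  "cat_to_row A c = polar_image A (class_fibre_coord c)"

definition row_to_cat where
  "row_to_cat A k l w = multi_class A k l (copolar_image A w) (core_part w)"

lemma class_coords:
  assumes "p \<in> coord_class P Q x z"
  shows "class_fibre_coord (coord_class P Q x z) = x" "class_base_coord (coord_class P Q x z) = z"
  unfolding class_fibre_coord_def class_base_coord_def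
  using coord_class_coords[OF someI[of "\<lambda>p. p \<in> coord_class P Q x z", OF assms]] by auto

lemma linked_class_nonempty:
  assumes "linked P Q x z" obtains p where "p \<in> coord_class P Q x z"
proof -
  obtain e where e: "distinct e" "set e \<in> row_complex P"
    "sorted_wrt (\<lambda>u v. z v \<le> z u) e" "z \<in> closed_simplex (set e)"
    "{v. x v \<noteq> 0} \<in> fibre_complex P Q (set e)" "x \<in> closed_simplex {v. x v \<noteq> 0}"
    by (rule linked_simplices[OF assms]) blast
  have "x \<in> topspace (fibre P Q (set e))"
    using e(5,6) by (auto simp: fibre_eq in_realization_iff)
  from coord_class_flag(2)[OF e(1-4) this] have
    "chain_point (length e - 1) (flag e) x (flag_coord e z) \<in> coord_class P Q x z"
    by (simp add: glue_equiv_def)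
  then show thesis by (rule that)
qed

lemma row_to_cat_linked:
  assumes "1 \<le> l" "X \<in> row_complex (multi_rel A k l)" "w \<in> closed_simplex X"
  shows "multi_linked A k l (copolar_image A w) (core_part w)"
  unfolding linked_def fibre_eq in_realization_iff
proof (intro bexI conjI)
  show "core_part w \<in> closed_simplex (core w)" by (rule core_part_in_core[OF assms(3)])
  show "copolar_image A w \<in> closed_simplex (random_range (col_polar A) w)"
    by (rule random_image_in_range[OF assms(3)])
  show "random_range (col_polar A) w \<in> multi_fibre A k l (core w)"
    by (rule col_range_in_fibre[OF assms]) (rule col_range_element(3)[OF assms])
  show "core w \<in> row_complex (multi_rel A k 1)" by (rule core_in_multi_complex[OF assms])
qed

lemma cat_to_row_row_to_cat:
  assumes "1 \<le> l" "X \<in> row_complex (multi_rel A k l)" "w \<in> closed_simplex X"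
  shows "cat_to_row A (row_to_cat A k l w) = polar_image A (copolar_image A w)"
proof -
  obtain p where "p \<in> multi_class A k l (copolar_image A w) (core_part w)"
    by (rule linked_class_nonempty[OF row_to_cat_linked[OF assms]])
  from class_coords(1)[OF this] show ?thesis by (simp only: cat_to_row_def row_to_cat_def)
qed

lemma finite_multi_fibre: "S \<in> fibre_complex P Q \<kappa> \<Longrightarrow> finite S"
  by (simp add: fibre_complex_def row_complex_def)

lemma continuous_on_chain_comb:
  assumes "continuous_on Z t"
  shows "continuous_on Z (\<lambda>\<zeta>. chain_comb n C (t \<zeta>) v)"
  unfolding chain_comb_def
  by (intro continuous_on_sum continuous_on_mult continuous_on_const continuous_on_eval[OF assms])

lemmas continuous_on_projections = continuous_on_fst continuous_on_snd continuous_on_id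

lemma class_coords_chain:
  assumes "chain_on P n C" "S \<in> fibre_complex P Q (C 0)" "x \<in> closed_simplex S" "t \<in> standard_simplex n"
  shows "class_fibre_coord (coord_class P Q x (chain_comb n C t)) = x"
    "class_base_coord (coord_class P Q x (chain_comb n C t)) = chain_comb n C t"
proof -
  have "x \<in> topspace (fibre P Q (C 0))" using assms by (auto simp: fibre_eq in_realization_iff)
  from coord_class_nonempty[OF assms(1) this assms(4)]
  show "class_fibre_coord (coord_class P Q x (chain_comb n C t)) = x"
    "class_base_coord (coord_class P Q x (chain_comb n C t)) = chain_comb n C t"
    by (rule class_coords)+
qed

lemma continuous_map_cat_to_row:
  "continuous_map (classifying_space (multi_cat A k l)) (realization (row_complex (multi_rel A k l))) (cat_to_row A)"
  unfolding multi_cat_def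
proof (rule continuous_map_classifying_space)
  fix n C S
  assume C: "chain_on (multi_rel A k 1) n C" and S: "S \<in> multi_fibre A k l (C 0)"
  let ?Z = "{0..1::real} \<times> closed_simplex S \<times> standard_simplex n"
  note fin = finite_multi_fibre[OF S]
  have x: "fst (snd \<zeta>) \<in> closed_simplex S" if "\<zeta> \<in> ?Z" for \<zeta> using that by auto
  have cx: "continuous_on ?Z (\<lambda>\<zeta>. fst (snd \<zeta>) v)" for v
    by (rule continuous_on_eval, intro continuous_on_projections)
  have "continuous_map (top_of_set ?Z) (realization (row_complex (multi_rel A k l)))
      (\<lambda>\<zeta>. polar_image A (fst (snd \<zeta>)))"
  proof (rule continuous_map_into_realization[OF down_closed_row_complex])
    show "finite (row_polar A ` Pow S)" using fin by simp
    fix \<zeta> assume \<zeta>: "\<zeta> \<in> ?Z"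
    show "{v. polar_image A (fst (snd \<zeta>)) v \<noteq> 0} \<subseteq> row_polar A ` Pow S"
      by (rule closed_simplex_support_subset[OF random_image_in_simplex[OF x[OF \<zeta>]]])
    show "polar_image A (fst (snd \<zeta>)) \<in> topspace (realization (row_complex (multi_rel A k l)))"
      unfolding in_realization_iff
      using row_range_in_complex[OF chain_onD(3)[OF C] S x[OF \<zeta>]] random_image_in_range[OF x[OF \<zeta>]] by blast
  next
    show "continuous_on ?Z (\<lambda>\<zeta>. polar_image A (fst (snd \<zeta>)) v)" for v
      by (rule continuous_on_random_image[OF fin x cx])
  qed
  then show "continuous_map (top_of_set ?Z) (realization (row_complex (multi_rel A k l)))
      (\<lambda>(s, x, t). cat_to_row A (multi_class A k l x (chain_comb n C t)))"
  proof (rule continuous_map_eq)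
    fix \<zeta> assume "\<zeta> \<in> topspace (top_of_set ?Z)"
    then show "polar_image A (fst (snd \<zeta>)) =
        (case \<zeta> of (s, x, t) \<Rightarrow> cat_to_row A (multi_class A k l x (chain_comb n C t)))"
      using class_coords_chain(1)[OF C S] by (auto simp: cat_to_row_def)
  qed
qed

lemma continuous_map_row_to_cat:
  assumes l: "1 \<le> l"
  shows "continuous_map (realization (row_complex (multi_rel A k l))) (classifying_space (multi_cat A k l)) (row_to_cat A k l)"
proof (rule continuous_map_realization)
  fix X assume X: "X \<in> row_complex (multi_rel A k l)"
  then have fin: "finite X" by (auto dest: row_complexD)
  have cw: "continuous_on (closed_simplex X) (\<lambda>w. w v)" for v
    by (rule continuous_on_eval, intro continuous_on_projections)
  show "continuous_map (top_of_set (closed_simplex X)) (classifying_space (multi_cat A k l)) (row_to_cat A k l)"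
    unfolding multi_cat_def row_to_cat_def
  proof (rule continuous_map_coord_class)
    show "finite (col_polar A ` Pow X)" "finite X" using fin by auto
    fix w assume w: "w \<in> closed_simplex X"
    show "{v. copolar_image A w v \<noteq> 0} \<subseteq> col_polar A ` Pow X"
      by (rule closed_simplex_support_subset[OF random_image_in_simplex[OF w]])
    show "{v. core_part w v \<noteq> 0} \<subseteq> X"
      using closed_simplex_support_subset[OF core_part_in_core[OF w]] core_subset[OF w] support_subset[OF w] by blast
    show "multi_linked A k l (copolar_image A w) (core_part w)"
      by (rule row_to_cat_linked[OF l X w])
  next
    show "continuous_on (closed_simplex X) (\<lambda>w. copolar_image A w v)" for v
      by (rule continuous_on_random_image[OF fin _ cw])
    show "continuous_on (closed_simplex X) (\<lambda>w. core_part w v)" for v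
      by (rule continuous_on_core_part[OF fin _ cw])
  qed
qed

lemma homotopic_row:
  assumes l: "1 \<le> l"
  shows "homotopic_with (\<lambda>_. True) (realization (row_complex (multi_rel A k l)))
    (realization (row_complex (multi_rel A k l))) (cat_to_row A \<circ> row_to_cat A k l) id"
proof (rule homotopic_withI)
  let ?K = "row_complex (multi_rel A k l)"
  let ?h = "\<lambda>p v. (1 - fst p) * polar_image A (copolar_image A (snd p)) v + fst p * snd p v"
  show "continuous_map (prod_topology unit_interval (realization ?K)) (realization ?K) ?h"
  proof (rule continuous_map_prod_realization)
    show "compact_space unit_interval" by (simp add: compact_space_subtopology)
    show "Hausdorff_space unit_interval" by (simp add: Hausdorff_space_subtopology Hausdorff_space_euclidean)
    fix X assume X: "X \<in> ?K"
    then have fin: "finite X" by (auto dest: row_complexD)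
    let ?Z = "{0..1::real} \<times> closed_simplex X"
    have w: "snd \<zeta> \<in> closed_simplex X" and s: "fst \<zeta> \<in> {0..1}" if "\<zeta> \<in> ?Z" for \<zeta> using that by auto
    have cw: "continuous_on ?Z (\<lambda>\<zeta>. snd \<zeta> v)" for v
      by (rule continuous_on_eval, intro continuous_on_projections)
    let ?V = "col_polar A ` Pow X"
    have finV: "finite ?V" using fin by simp
    note y = random_image_in_simplex[OF w, of _ "col_polar A"]
    note cy = continuous_on_random_image[OF fin w cw, of "col_polar A"]
    show "continuous_map (prod_topology unit_interval (top_of_set (closed_simplex X))) (realization ?K) ?h"
      unfolding prod_topology_subtopology_eu
    proof (rule continuous_map_into_realization[OF down_closed_row_complex])
      show "finite (row_polar A ` Pow ?V \<union> X)" using fin by simp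
      fix \<zeta> assume \<zeta>: "\<zeta> \<in> ?Z"
      show "{v. ?h \<zeta> v \<noteq> 0} \<subseteq> row_polar A ` Pow ?V \<union> X"
        by (rule closed_simplex_support_subset[OF closed_simplex_convex_Un[OF
              random_image_in_simplex[OF y[OF \<zeta>]] w[OF \<zeta>] s[OF \<zeta>]]])
      note yr = random_image_in_range[OF w[OF \<zeta>], of "col_polar A"]
      show "?h \<zeta> \<in> topspace (realization ?K)"
        unfolding in_realization_iff
        by (rule bexI, rule closed_simplex_convex_Un[OF random_image_in_range[OF yr] w[OF \<zeta>] s[OF \<zeta>]],
            rule row_col_range_Un[OF l X w[OF \<zeta>] yr])
    next
      show "continuous_on ?Z (\<lambda>\<zeta>. ?h \<zeta> v)" for v
        by (intro continuous_on_add continuous_on_mult continuous_on_diff continuous_on_const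
            continuous_on_projections cw continuous_on_random_image[OF finV y cy])
    qed
  qed
qed (auto simp: in_realization_iff cat_to_row_row_to_cat[OF l])

text \<open>First contract the fibre coordinate over a fixed base point, then move the base point.\<close>

lemma homotopic_cat:
  fixes A :: "('i, 'j) relation"
  assumes l: "1 \<le> l"
  shows "homotopic_with (\<lambda>_. True) (classifying_space (multi_cat A k l))
    (classifying_space (multi_cat A k l)) (row_to_cat A k l \<circ> cat_to_row A) id"
proof -
  let ?B = "classifying_space (multi_cat A k l)"
  let ?r = "\<lambda>x. copolar_image A (polar_image A x)" and ?c = "\<lambda>x. core_part (polar_image A x)"
  \<comment> \<open>Both homotopies are written in reverse: \<open>H1\<close> ends at the identity,
    \<open>H2\<close> starts at \<open>row_to_cat A k l \<circ> cat_to_row A\<close>, and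
    \<open>H2\<close> at time 1 is \<open>H1\<close> at time 0. The order matters: the core of the
    polar image need only be related to the core of the fibre coordinate, not to its whole support,
    so the base has to wait until the fibre coordinate has been contracted.\<close>
  define H1 where "H1 p = multi_class A k l
      (\<lambda>v. (1 - fst p) * ?r (class_fibre_coord (snd p)) v + fst p * class_fibre_coord (snd p) v)
      (class_base_coord (snd p))"
    for p :: "real \<times> ('i set set \<times> ('j set \<Rightarrow> real), ('i set set \<times> 'i set set) \<times> ('j set \<Rightarrow> real)) class_point"
  define H2 where "H2 p = multi_class A k l (?r (class_fibre_coord (snd p)))
      (\<lambda>v. (1 - fst p) * ?c (class_fibre_coord (snd p)) v + fst p * class_base_coord (snd p) v)"
    for p :: "real \<times> ('i set set \<times> ('j set \<Rightarrow> real), ('i set set \<times> 'i set set) \<times> ('j set \<Rightarrow> real)) class_point"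
  have cont: "continuous_map (prod_topology unit_interval ?B) ?B H1 \<and> continuous_map (prod_topology unit_interval ?B) ?B H2"
    unfolding multi_cat_def
  proof (intro conjI; rule continuous_map_prod_classifying_space)
    fix n C S
    assume C: "chain_on (multi_rel A k 1) n C" and S: "S \<in> multi_fibre A k l (C 0)"
    let ?B = "classifying_space (rel_cat (multi_rel A k 1) (transp_rel (multi_rel A k l)))"
    let ?Z = "{0..1::real} \<times> closed_simplex S \<times> standard_simplex n"
    note fin = finite_multi_fibre[OF S] and C0 = chain_onD(3)[OF C le0]
    have finC: "finite (C 0)" using chain_onD(1)[OF C] by simp
    have s: "fst \<zeta> \<in> {0..1}" and x: "fst (snd \<zeta>) \<in> closed_simplex S"
      and t: "snd (snd \<zeta>) \<in> standard_simplex n" if "\<zeta> \<in> ?Z" for \<zeta> using that by auto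
    note z = chain_comb_in_simplex[OF C t]
    have cx: "continuous_on ?Z (\<lambda>\<zeta>. fst (snd \<zeta>) v)" for v
      by (rule continuous_on_eval, intro continuous_on_projections)
    have cz: "continuous_on ?Z (\<lambda>\<zeta>. chain_comb n C (snd (snd \<zeta>)) v)" for v
      by (rule continuous_on_chain_comb, intro continuous_on_projections)
    let ?V = "row_polar A ` Pow S"
    have finV: "finite ?V" using fin by simp
    note y = random_image_in_simplex[OF x, of _ "row_polar A"]
    note cy = continuous_on_random_image[OF fin x cx, of "row_polar A"]
    let ?W = "col_polar A ` Pow ?V"
    have finW: "finite ?W" using finV by simp
    note x' = random_image_in_simplex[OF y, of _ "col_polar A"]
    note cx' = continuous_on_random_image[OF finV y cy, of "col_polar A"]
    note cc = continuous_on_core_part[OF finV y cy]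
    note yr = random_image_in_range[OF x, of _ "row_polar A"]
    note xr = random_image_in_range[OF yr, of _ "col_polar A"]
    note rc = row_range_in_complex[OF C0 S x]
    have co: "class_fibre_coord (multi_class A k l (fst (snd \<zeta>)) (chain_comb n C (snd (snd \<zeta>)))) = fst (snd \<zeta>)"
      "class_base_coord (multi_class A k l (fst (snd \<zeta>)) (chain_comb n C (snd (snd \<zeta>)))) = chain_comb n C (snd (snd \<zeta>))"
      if "\<zeta> \<in> ?Z" for \<zeta>
      using class_coords_chain[OF C S x[OF that] t[OF that]] by auto
    have "continuous_map (top_of_set ?Z) ?B
      (\<lambda>\<zeta>. multi_class A k l (\<lambda>v. (1 - fst \<zeta>) * ?r (fst (snd \<zeta>)) v + fst \<zeta> * fst (snd \<zeta>) v)
        (chain_comb n C (snd (snd \<zeta>))))"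
    proof (rule continuous_map_coord_class)
      show "finite (?W \<union> S)" "finite (C 0)" using fin finC by auto
      fix \<zeta> assume \<zeta>: "\<zeta> \<in> ?Z"
      show "{v. (1 - fst \<zeta>) * ?r (fst (snd \<zeta>)) v + fst \<zeta> * fst (snd \<zeta>) v \<noteq> 0} \<subseteq> ?W \<union> S"
        by (rule closed_simplex_support_subset[OF closed_simplex_convex_Un[OF x'[OF \<zeta>] x[OF \<zeta>] s[OF \<zeta>]]])
      show "{v. chain_comb n C (snd (snd \<zeta>)) v \<noteq> 0} \<subseteq> C 0"
        by (rule closed_simplex_support_subset[OF z[OF \<zeta>]])
      show "multi_linked A k l (\<lambda>v. (1 - fst \<zeta>) * ?r (fst (snd \<zeta>)) v + fst \<zeta> * fst (snd \<zeta>) v)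
          (chain_comb n C (snd (snd \<zeta>)))"
        unfolding linked_def fibre_eq in_realization_iff
        by (rule bexI[OF _ C0], rule conjI, rule z[OF \<zeta>], rule bexI,
            rule closed_simplex_convex_Un[OF xr[OF \<zeta>] x[OF \<zeta>] s[OF \<zeta>]],
            rule col_row_range_Un[OF C0 S x[OF \<zeta>] l yr[OF \<zeta>]])
    next
      show "continuous_on ?Z (\<lambda>\<zeta>. (1 - fst \<zeta>) * ?r (fst (snd \<zeta>)) v + fst \<zeta> * fst (snd \<zeta>) v)" for v
        by (intro continuous_on_add continuous_on_mult continuous_on_diff continuous_on_const
            continuous_on_fst[OF continuous_on_id] cx cx')
      show "continuous_on ?Z (\<lambda>\<zeta>. chain_comb n C (snd (snd \<zeta>)) v)" for v by (rule cz)
    qed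
    then show "continuous_map (top_of_set ?Z) ?B (\<lambda>(s, x, t). H1 (s, multi_class A k l x (chain_comb n C t)))"
    proof (rule continuous_map_eq)
      fix \<zeta> assume "\<zeta> \<in> topspace (top_of_set ?Z)"
      then have "\<zeta> \<in> ?Z" by simp
      from co[OF this] show "multi_class A k l (\<lambda>v. (1 - fst \<zeta>) * ?r (fst (snd \<zeta>)) v + fst \<zeta> * fst (snd \<zeta>) v)
        (chain_comb n C (snd (snd \<zeta>))) = (case \<zeta> of (s, x, t) \<Rightarrow> H1 (s, multi_class A k l x (chain_comb n C t)))"
        by (simp only: H1_def case_prod_unfold fst_conv snd_conv)
    qed
    have "continuous_map (top_of_set ?Z) ?B
      (\<lambda>\<zeta>. multi_class A k l (?r (fst (snd \<zeta>)))
        (\<lambda>v. (1 - fst \<zeta>) * ?c (fst (snd \<zeta>)) v + fst \<zeta> * chain_comb n C (snd (snd \<zeta>)) v))"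
    proof (rule continuous_map_coord_class)
      show "finite ?W" "finite (?V \<union> C 0)" using finW finV finC by auto
      fix \<zeta> assume \<zeta>: "\<zeta> \<in> ?Z"
      let ?y = "polar_image A (fst (snd \<zeta>))"
      show "{v. ?r (fst (snd \<zeta>)) v \<noteq> 0} \<subseteq> ?W"
        by (rule closed_simplex_support_subset[OF x'[OF \<zeta>]])
      note cp = core_part_in_core[OF yr[OF \<zeta>]]
      have "core ?y \<subseteq> ?V" using core_subset[OF y[OF \<zeta>]] support_subset[OF y[OF \<zeta>]] by blast
      then show "{v. (1 - fst \<zeta>) * ?c (fst (snd \<zeta>)) v + fst \<zeta> * chain_comb n C (snd (snd \<zeta>)) v \<noteq> 0} \<subseteq> ?V \<union> C 0"
        using closed_simplex_support_subset[OF closed_simplex_convex_Un[OF cp z[OF \<zeta>] s[OF \<zeta>]]] by blast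
      have "(\<lambda>v. (1 - fst \<zeta>) * ?c (fst (snd \<zeta>)) v + fst \<zeta> * chain_comb n C (snd (snd \<zeta>)) v)
          \<in> closed_simplex (C 0 \<union> core ?y)"
        using closed_simplex_convex_Un[OF cp z[OF \<zeta>] s[OF \<zeta>]] by (simp only: Un_commute)
      then show "multi_linked A k l (?r (fst (snd \<zeta>)))
          (\<lambda>v. (1 - fst \<zeta>) * ?c (fst (snd \<zeta>)) v + fst \<zeta> * chain_comb n C (snd (snd \<zeta>)) v)"
        unfolding linked_def fibre_eq in_realization_iff
        using col_row_range_core[OF C0 S x[OF \<zeta>] l yr[OF \<zeta>]] base_Un_core[OF C0 S x[OF \<zeta>] l yr[OF \<zeta>]] xr[OF \<zeta>]
        by blast
    next
      show "continuous_on ?Z (\<lambda>\<zeta>. (1 - fst \<zeta>) * ?c (fst (snd \<zeta>)) v + fst \<zeta> * chain_comb n C (snd (snd \<zeta>)) v)" for v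
        by (intro continuous_on_add continuous_on_mult continuous_on_diff continuous_on_const
            continuous_on_fst[OF continuous_on_id] cc cz)
      show "continuous_on ?Z (\<lambda>\<zeta>. ?r (fst (snd \<zeta>)) v)" for v by (rule cx')
    qed
    then show "continuous_map (top_of_set ?Z) ?B (\<lambda>(s, x, t). H2 (s, multi_class A k l x (chain_comb n C t)))"
    proof (rule continuous_map_eq)
      fix \<zeta> assume "\<zeta> \<in> topspace (top_of_set ?Z)"
      then have "\<zeta> \<in> ?Z" by simp
      from co[OF this] show "multi_class A k l (?r (fst (snd \<zeta>)))
        (\<lambda>v. (1 - fst \<zeta>) * ?c (fst (snd \<zeta>)) v + fst \<zeta> * chain_comb n C (snd (snd \<zeta>)) v) =
        (case \<zeta> of (s, x, t) \<Rightarrow> H2 (s, multi_class A k l x (chain_comb n C t)))"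
        by (simp only: H2_def case_prod_unfold fst_conv snd_conv)
    qed
  qed
  have "homotopic_with (\<lambda>_. True) ?B ?B (row_to_cat A k l \<circ> cat_to_row A) (\<lambda>c. H1 (0, c))"
    by (rule homotopic_withI[OF conjunct2[OF cont]]) (simp_all add: H1_def H2_def row_to_cat_def cat_to_row_def)
  moreover have "homotopic_with (\<lambda>_. True) ?B ?B (\<lambda>c. H1 (0, c)) id"
  proof (rule homotopic_withI[OF conjunct1[OF cont]])
    fix c assume "c \<in> topspace ?B"
    then obtain n C x t where C: "chain_on (multi_rel A k 1) n C"
      "x \<in> topspace (fibre (multi_rel A k 1) (transp_rel (multi_rel A k l)) (C 0))" "t \<in> standard_simplex n"
      and c: "c = multi_class A k l x (chain_comb n C t)"
      unfolding multi_cat_def topspace_classifying_space by blast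
    from class_coords[OF coord_class_nonempty[OF C]] show "H1 (1, c) = id c"
      unfolding H1_def c by simp
  qed simp
  ultimately show ?thesis by (rule homotopic_with_trans)
qed

text \<open>Zigzags need all spaces over one type of points, so the maps are carried over to the two
  copies. \<open>Inr \<circ> projr\<close> and \<open>Inl \<circ> projl\<close> are identities only
  on these, hence the appeal to \<open>homotopic_with_eq\<close>.\<close>

lemma weak_equivalence_summand_copies:
  fixes X :: "'b topology" and Y :: "'a topology"
  assumes f: "continuous_map X Y f" and g: "continuous_map Y X g"
    and gf: "homotopic_with (\<lambda>_. True) X X (g \<circ> f) id"
    and fg: "homotopic_with (\<lambda>_. True) Y Y (f \<circ> g) id"
  shows "weak_equivalence (pullback_topology (range Inr) projr X) (pullback_topology (range Inl) projl Y)
    (Inl \<circ> f \<circ> projr :: 'a + 'b \<Rightarrow> 'a + 'b)"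
proof -
  let ?X = "pullback_topology (range (Inr :: 'b \<Rightarrow> 'a + 'b)) projr X"
  let ?Y = "pullback_topology (range (Inl :: 'a \<Rightarrow> 'a + 'b)) projl Y"
  have pr: "continuous_map ?X X projr"
    using continuous_map_pullback[OF continuous_map_id[unfolded id_def], of "range Inr" projr X] by (simp add: o_def)
  have pl: "continuous_map ?Y Y projl"
    using continuous_map_pullback[OF continuous_map_id[unfolded id_def], of "range Inl" projl Y] by (simp add: o_def)
  have ir: "continuous_map X ?X Inr" by (rule continuous_map_pullback') (auto simp: o_def)
  have il: "continuous_map Y ?Y Inl" by (rule continuous_map_pullback') (auto simp: o_def)
  have X: "Inr (projr p) = p" if "p \<in> topspace ?X" for p
    using that by (auto simp: topspace_pullback_topology)
  have Y: "Inl (projl p) = p" if "p \<in> topspace ?Y" for p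
    using that by (auto simp: topspace_pullback_topology)
  show ?thesis
  proof (rule homotopy_equivalence_imp_weak_equivalence)
    show "continuous_map ?X ?Y (Inl \<circ> f \<circ> projr)"
      by (intro continuous_map_compose[OF pr] continuous_map_compose[OF f] il)
    show "continuous_map ?Y ?X (Inr \<circ> g \<circ> projl)"
      by (intro continuous_map_compose[OF pl] continuous_map_compose[OF g] ir)
    have "homotopic_with (\<lambda>_. True) ?X ?X (Inr \<circ> (g \<circ> f) \<circ> projr) (Inr \<circ> id \<circ> projr)"
      by (rule homotopic_with_compose_continuous_map_right[OF
            homotopic_with_compose_continuous_map_left[OF gf ir] pr]) auto
    then show "homotopic_with (\<lambda>_. True) ?X ?X ((Inr \<circ> g \<circ> projl) \<circ> (Inl \<circ> f \<circ> projr)) id"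
      by (rule homotopic_with_eq) (use X in \<open>auto simp: o_def\<close>)
    have "homotopic_with (\<lambda>_. True) ?Y ?Y (Inl \<circ> (f \<circ> g) \<circ> projl) (Inl \<circ> id \<circ> projl)"
      by (rule homotopic_with_compose_continuous_map_right[OF
            homotopic_with_compose_continuous_map_left[OF fg il] pl]) auto
    then show "homotopic_with (\<lambda>_. True) ?Y ?Y ((Inl \<circ> f \<circ> projr) \<circ> (Inr \<circ> g \<circ> projl)) id"
      by (rule homotopic_with_eq) (use Y in \<open>auto simp: o_def\<close>)
  qed
qed

definition comparison_map :: "('i, 'j) relation \<Rightarrow> ('i, 'j) points \<Rightarrow> ('i, 'j) points" where
  "comparison_map A = Inl \<circ> cat_to_row A \<circ> projr"

lemma weak_equivalence_comparison_map:
  assumes "1 \<le> l"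
  shows "weak_equivalence (cat_space A k l) (row_space A k l) (comparison_map A)"
  unfolding cat_space_def row_space_def comparison_map_def
  by (rule weak_equivalence_summand_copies[OF continuous_map_cat_to_row continuous_map_row_to_cat[OF assms]
        homotopic_cat[OF assms] homotopic_row[OF assms]])

section \<open>Naturality\<close>

text \<open>Append \<open>f'\<close> and its formal inverse, exchange \<open>f' \<circ> c\<close>
  for \<open>r \<circ> f\<close> in the middle, and cancel \<open>f\<close> against its formal
  inverse in front.\<close>

lemma ho_eq_square:
  assumes f: "weak_equivalence C R f" and f': "weak_equivalence C' R' f'"
    and c: "continuous_map C C' c" and r: "continuous_map R R' r"
    and comm: "\<And>p. p \<in> topspace C \<Longrightarrow> f' (c p) = r (f p)"
  shows "ho_eq R C' [Bwd R f C, Fwd C c C'] [Fwd R r R', Bwd R' f' C']"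
proof -
  have fc: "continuous_map C R f" "continuous_map C' R' f'"
    using f f' by (auto simp: weak_equivalence_def)
  have zB: "zigzag R [Bwd R f C] C" "zigzag R' [Bwd R' f' C'] C'"
    using f f' by (auto intro: zigzag.intros)
  have zc: "zigzag R [Bwd R f C, Fwd C c C'] C'" using f c by (auto intro: zigzag.intros)
  have zr: "zigzag R' [Bwd R' f' C'] C'" "zigzag R [Fwd R r R', Bwd R' f' C'] C'"
    using f' r by (auto intro: zigzag.intros)
  have hom: "homotopic_with (\<lambda>_. True) C R' (f' \<circ> c) (r \<circ> f)"
    using comm by (intro homotopic_with_equal) (auto intro: continuous_map_compose[OF c fc(2)])
  have 1: "ho_eq R C' [Bwd R f C, Fwd C c C'] [Bwd R f C, Fwd C c C', Fwd C' f' R', Bwd R' f' C']"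
    using ho_eq.cong[OF zc ho_eq.sym[OF ho_eq.inv_right[OF f']] zigzag.Nil] by simp
  have 2: "ho_eq C R' [Fwd C c C', Fwd C' f' R'] [Fwd C f R, Fwd R r R']"
    by (rule ho_eq.trans[OF ho_eq.comp[OF c fc(2)] ho_eq.trans[OF ho_eq.homotopic[OF hom]
          ho_eq.sym[OF ho_eq.comp[OF fc(1) r]]]])
  have 3: "ho_eq R C' [Bwd R f C, Fwd C c C', Fwd C' f' R', Bwd R' f' C']
      [Bwd R f C, Fwd C f R, Fwd R r R', Bwd R' f' C']"
    using ho_eq.cong[OF zB(1) 2 zr(1)] by simp
  have 4: "ho_eq R C' [Bwd R f C, Fwd C f R, Fwd R r R', Bwd R' f' C'] [Fwd R r R', Bwd R' f' C']"
    using ho_eq.cong[OF zigzag.Nil ho_eq.inv_left[OF f] zr(2)] by simp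
  show ?thesis by (rule ho_eq.trans[OF 1 ho_eq.trans[OF 3 4]])
qed

context
  fixes A :: "('i, 'j) relation" and k k' l l' :: nat
  assumes kk: "k' \<le> k" and ll: "l' \<le> l"
begin

lemma multi_complex_mono: "row_complex (multi_rel A k l) \<subseteq> row_complex (multi_rel A k' l')"
  using subsets_ge_le[OF kk, of "cols A"] subsets_ge_le[OF ll, of "rows A"]
  unfolding multi_complex_iff subset_iff[of "row_complex _"] by blast

lemma multi_fibre_mono: "multi_fibre A k l \<kappa> \<subseteq> multi_fibre A k' l' \<kappa>"
proof
  fix S assume "S \<in> multi_fibre A k l \<kappa>"
  then show "S \<in> multi_fibre A k' l' \<kappa>"
    unfolding multi_fibre_iff
    using subsets_ge_le[OF kk, of "cols A"] subsets_ge_le[OF ll, of "rows A"] by (elim conjE) blast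
qed

end

lemma realization_mono: "K \<subseteq> L \<Longrightarrow> x \<in> topspace (realization K) \<Longrightarrow> x \<in> topspace (realization L)"
  by (auto simp: in_realization_iff)

context
  fixes A :: "('i, 'j) relation" and k k' l l' :: nat
  assumes kk: "k' \<le> k" and ll: "l' \<le> l"
begin

lemma continuous_map_row_incl: "continuous_map (row_space A k l) (row_space A k' l') row_incl"
proof -
  have "continuous_map (realization (row_complex (multi_rel A k l))) (realization (row_complex (multi_rel A k' l'))) (\<lambda>x. x)"
    using multi_complex_mono[OF kk ll, of A]
    by (intro continuous_map_realization continuous_map_closed_simplex_realization) auto
  from continuous_map_pullback[OF this, of "range Inl" projl]
  show ?thesis
    unfolding row_space_def row_incl_def
    by (intro continuous_map_pullback') (auto simp: o_def topspace_pullback_topology)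
qed

lemma chain_on_mono: "chain_on (multi_rel A k 1) n C \<Longrightarrow> chain_on (multi_rel A k' 1) n C"
  using multi_complex_mono[OF kk order_refl, of A 1] by (auto simp: chain_on_def)

lemma multi_fibre_topspace_mono:
  "x \<in> topspace (fibre (multi_rel A k 1) (transp_rel (multi_rel A k l)) \<kappa>) \<Longrightarrow>
    x \<in> topspace (fibre (multi_rel A k' 1) (transp_rel (multi_rel A k' l')) \<kappa>)"
  unfolding fibre_eq by (rule realization_mono[OF multi_fibre_mono[OF kk ll]])

abbreviation (input) cat_functor_map where
  "cat_functor_map \<equiv> classifying_map (multi_cat A k' l') (\<lambda>(\<sigma>, x). (\<sigma>, x)) (\<lambda>((\<sigma>0, \<sigma>1), x). ((\<sigma>0, \<sigma>1), x))"

lemma nerve_map_chain_simplex: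
  "nerve_map (\<lambda>(\<sigma>, x). (\<sigma>, x)) (\<lambda>((\<sigma>0, \<sigma>1), x). ((\<sigma>0, \<sigma>1), x)) n (chain_simplex n C x) = chain_simplex n C x"
  unfolding nerve_map_def chain_simplex_def by (auto intro!: restrict_ext)

text \<open>\<open>class_map\<close> uses the image of the whole class, so every representative has
  to be followed. The functor fixes chain simplices and therefore the coordinates, which determine
  the class in the target.\<close>

lemma classifying_map_multi_class:
  assumes C: "chain_on (multi_rel A k 1) n C" "t \<in> standard_simplex n"
    and x: "x \<in> topspace (fibre (multi_rel A k 1) (transp_rel (multi_rel A k l)) (C 0))"
  shows "cat_functor_map (multi_class A k l x (chain_comb n C t)) = multi_class A k' l' x (chain_comb n C t)"
proof -
  let ?E = "cat_glue (multi_rel A k' 1) (transp_rel (multi_rel A k' l'))"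
  let ?g = "\<lambda>(n, F, t). (n, nerve_map (\<lambda>(\<sigma>, x). (\<sigma>, x)) (\<lambda>((\<sigma>0, \<sigma>1), x). ((\<sigma>0, \<sigma>1), x)) n F, t)"
  let ?c = "multi_class A k l x (chain_comb n C t)"
  have "?E `` {?g p} = multi_class A k' l' x (chain_comb n C t)" if "p \<in> ?c" for p
  proof -
    from that obtain m D y u where p: "p = chain_point m D y u" and D: "chain_on (multi_rel A k 1) m D"
      "y \<in> topspace (fibre (multi_rel A k 1) (transp_rel (multi_rel A k l)) (D 0))" "u \<in> standard_simplex m"
      and co: "y = x" "chain_comb m D u = chain_comb n C t"
      unfolding coord_class_def realization_point_def by auto
    have "?g p = chain_point m D y u"
      unfolding p chain_point_def by (simp only: case_prod_conv nerve_map_chain_simplex)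
    then show ?thesis
      using cat_glue_class_chain_point[OF chain_on_mono[OF D(1)] multi_fibre_topspace_mono[OF D(2)] D(3)]
      by (simp only: co)
  qed
  moreover have "chain_point n C x t \<in> ?c" by (rule coord_class_nonempty[OF C(1) x C(2)])
  ultimately have "(\<Union>p\<in>?c. ?E `` {?g p}) = multi_class A k' l' x (chain_comb n C t)" by blast
  moreover have "class_map ?E ?g ?c = (\<Union>p\<in>?c. ?E `` {?g p})" unfolding class_map_def by blast
  ultimately show ?thesis unfolding classifying_map_def multi_cat_def by simp
qed

lemma continuous_map_cat_functor_map:
  "continuous_map (classifying_space (multi_cat A k l)) (classifying_space (multi_cat A k' l')) cat_functor_map"
  unfolding multi_cat_def[of A k l]
proof (rule continuous_map_classifying_space)
  fix n C S
  assume C: "chain_on (multi_rel A k 1) n C" and S: "S \<in> multi_fibre A k l (C 0)"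
  let ?Z = "{0..1::real} \<times> closed_simplex S \<times> standard_simplex n"
  have x: "fst (snd \<zeta>) \<in> closed_simplex S" and t: "snd (snd \<zeta>) \<in> standard_simplex n" if "\<zeta> \<in> ?Z" for \<zeta>
    using that by auto
  have fib: "y \<in> topspace (fibre (multi_rel A k 1) (transp_rel (multi_rel A k l)) (C 0))"
    if "y \<in> closed_simplex S" for y
    using S that by (auto simp: fibre_eq in_realization_iff)
  have "continuous_map (top_of_set ?Z) (classifying_space (multi_cat A k' l'))
      (\<lambda>\<zeta>. multi_class A k' l' (fst (snd \<zeta>)) (chain_comb n C (snd (snd \<zeta>))))"
    unfolding multi_cat_def
  proof (rule continuous_map_coord_class)
    show "finite S" by (rule finite_multi_fibre[OF S])
    show "finite (C 0)" using chain_onD(1)[OF C] by simp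
    fix \<zeta> assume \<zeta>: "\<zeta> \<in> ?Z"
    show "{v. fst (snd \<zeta>) v \<noteq> 0} \<subseteq> S" by (rule closed_simplex_support_subset[OF x[OF \<zeta>]])
    show "{v. chain_comb n C (snd (snd \<zeta>)) v \<noteq> 0} \<subseteq> C 0"
      by (rule closed_simplex_support_subset[OF chain_comb_in_simplex[OF C t[OF \<zeta>]]])
    show "multi_linked A k' l' (fst (snd \<zeta>)) (chain_comb n C (snd (snd \<zeta>)))"
      unfolding linked_def
      using chain_onD(3)[OF chain_on_mono[OF C], of 0] chain_comb_in_simplex[OF C t[OF \<zeta>]]
        multi_fibre_topspace_mono[OF fib[OF x[OF \<zeta>]]] by blast
  next
    show "continuous_on ?Z (\<lambda>\<zeta>. fst (snd \<zeta>) v)" for v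
      by (rule continuous_on_eval, intro continuous_on_projections)
    show "continuous_on ?Z (\<lambda>\<zeta>. chain_comb n C (snd (snd \<zeta>)) v)" for v
      by (rule continuous_on_chain_comb, intro continuous_on_projections)
  qed
  then show "continuous_map (top_of_set ?Z) (classifying_space (multi_cat A k' l'))
      (\<lambda>(s, x, t). cat_functor_map (multi_class A k l x (chain_comb n C t)))"
  proof (rule continuous_map_eq)
    fix \<zeta> assume "\<zeta> \<in> topspace (top_of_set ?Z)"
    then have \<zeta>: "\<zeta> \<in> ?Z" by simp
    show "multi_class A k' l' (fst (snd \<zeta>)) (chain_comb n C (snd (snd \<zeta>))) =
        (case \<zeta> of (s, x, t) \<Rightarrow> cat_functor_map (multi_class A k l x (chain_comb n C t)))"
      using classifying_map_multi_class[OF C t[OF \<zeta>] fib[OF x[OF \<zeta>]]] by (simp add: case_prod_unfold)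
  qed
qed

lemma continuous_map_cat_incl: "continuous_map (cat_space A k l) (cat_space A k' l') (cat_incl A k' l')"
proof -
  have "continuous_map (cat_space A k l) (classifying_space (multi_cat A k' l')) (projr \<circ> cat_incl A k' l')"
    using continuous_map_pullback[OF continuous_map_cat_functor_map, of "range Inr" projr]
    unfolding cat_space_def
    by (rule continuous_map_eq) (auto simp: topspace_pullback_topology cat_incl_def)
  then show ?thesis
    unfolding cat_space_def[of A k' l']
    by (rule continuous_map_pullback') (auto simp: cat_space_def topspace_pullback_topology cat_incl_def)
qed

lemma comparison_map_natural:
  assumes "p \<in> topspace (cat_space A k l)"
  shows "comparison_map A (cat_incl A k' l' p) = row_incl (comparison_map A p)"
proof -
  obtain c where p: "p = Inr c" and "c \<in> topspace (classifying_space (multi_cat A k l))"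
    using assms by (auto simp: cat_space_def topspace_pullback_topology)
  then obtain n C x t where C: "chain_on (multi_rel A k 1) n C"
      "x \<in> topspace (fibre (multi_rel A k 1) (transp_rel (multi_rel A k l)) (C 0))" "t \<in> standard_simplex n"
      and c: "c = multi_class A k l x (chain_comb n C t)"
    unfolding multi_cat_def topspace_classifying_space by blast
  have "cat_to_row A (cat_functor_map c) = cat_to_row A c"
    unfolding cat_to_row_def c classifying_map_multi_class[OF C(1,3,2)]
      class_coords(1)[OF coord_class_nonempty[OF C]]
      class_coords(1)[OF coord_class_nonempty[OF chain_on_mono[OF C(1)] multi_fibre_topspace_mono[OF C(2)] C(3)]] ..
  then show ?thesis
    by (simp add: p comparison_map_def cat_incl_def row_incl_def)
qed

end

theorem theorem3:
  fixes A :: "('i, 'j) relation" and k k' l l' :: nat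
  assumes "k \<ge> k'" and "k' \<ge> 1" and "l \<ge> l'" and "l' \<ge> 1"
  shows "\<exists>zs ws.
    weak_zigzag (row_space A k l) zs (cat_space A k l) \<and>
    weak_zigzag (row_space A k' l') ws (cat_space A k' l') \<and>
    ho_eq (row_space A k l) (cat_space A k' l')
      (zs @ [Fwd (cat_space A k l) (cat_incl A k' l') (cat_space A k' l')])
      (Fwd (row_space A k l) row_incl (row_space A k' l') # ws)"
proof -
  have f: "weak_equivalence (cat_space A k l) (row_space A k l) (comparison_map A)"
    using assms by (intro weak_equivalence_comparison_map) simp
  have f': "weak_equivalence (cat_space A k' l') (row_space A k' l') (comparison_map A)"
    using assms by (intro weak_equivalence_comparison_map) simp
  have z: "weak_zigzag R [Bwd R g C] C" if "weak_equivalence C R g" for R C :: "'c topology" and g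
    using that by (auto simp: weak_zigzag_def intro: zigzag.intros)
  show ?thesis
    using z[OF f] z[OF f'] ho_eq_square[OF f f' continuous_map_cat_incl[OF assms(1,3)]
        continuous_map_row_incl[OF assms(1,3)] comparison_map_natural[OF assms(1,3)]]
    by (intro exI[of _ "[Bwd (row_space A k l) (comparison_map A) (cat_space A k l)]"]
        exI[of _ "[Bwd (row_space A k' l') (comparison_map A) (cat_space A k' l')]"]) simp
qed

end
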